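(* Let $p$ be a prime. The following hold. (1) $I_{\max}=1$ for (F): every $3$-group of maximal class of order $3^4$. (2) $I_{\max}=2$ for each of the following $2$-groups: (H1) $\langle a,b,c,d\mid a^4=b^2=c^2=d^2=1,[a,b]=c,[c,a]=d,[c,b]=[d,a]=[d,b]=1\rangle$; (H2) $\langle a,b,c\mid a^8=b^2=c^2=1,[a,b]=c,[c,a]=a^4,[c,b]=1\rangle$; (H3) $\langle a,b,c\mid a^8=c^2=1,b^2=a^4,[a,b]=c,[c,a]=b^2,[c,b]=1\rangle$; (I1) $\langle a,b,c,d\mid a^{2^n}=b^2=c^2=d^2=1,[a,b]=c,[c,a]=d,[c,b]=[d,a]=[d,b]=1\rangle$, where $n\ge3$; (I2) $\langle a,b,c\mid a^{2^{n+1}}=b^2=c^2=1,[a,b]=c,[c,a]=a^{2^n},[c,b]=1\rangle$, where $n\ge3$; (I3) $\langle a,b,c\mid a^{2^n}=b^4=c^2=1,[a,b]=c,[c,a]=b^2,[c,b]=1\rangle$, where $n\ge3$. (3) $I_{\max}=m$ for each of the following groups (in (G1)--(G3): $m>1$ if $p\le3$; in (J2), (J4), (J6): $n>m$, and $m>1$ if $p=2$): (G1) $\langle a,b,c\mid a^{p^{m+1}}=b^{p^m}=c^p=1,[a,b]=c,[c,a]=1,[c,b]=a^{\nu p^m}\rangle$, where $\nu=1$ or a fixed quadratic non-residue modulo $p$; (G2) $\langle a,b,c,d\mid a^{p^m}=b^{p^m}=c^p=d^p=1,[a,b]=c,[c,a]=d,[c,b]=1,[d,a]=[d,b]=1\rangle$;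 (G3) $\langle a,b,c\mid a^{p^{m+1}}=b^{p^m}=c^p=1,[a,b]=c,[c,a]=a^{p^m},[c,b]=1\rangle$; (J2) $\langle a,b,c\mid a^{p^{n+1}}=b^{p^m}=c^p=1,[a,b]=c,[c,a]=a^{p^n},[c,b]=1\rangle$; (J4) $\langle a,b,c\mid a^{p^n}=b^{p^{m+1}}=c^p=1,[a,b]=c,[c,a]=b^{\nu p^m},[c,b]=1\rangle$, where $\nu=1$ or a fixed quadratic non-residue modulo $p$; (J6) $\langle a,b,c,d\mid a^{p^n}=b^{p^m}=c^p=d^p=1,[a,b]=c,[c,a]=d,[c,b]=1,[d,a]=[d,b]=1\rangle$. (4) $I_{\max}=n$ for each of the following groups, where $n>m$, and $m>1$ if $p=2$: (J1) $\langle a,b,c\mid a^{p^{n+1}}=b^{p^m}=c^p=1,[a,b]=c,[c,a]=1,[c,b]=a^{\nu p^n}\rangle$, where $\nu=1$ or a fixed quadratic non-residue modulo $p$; (J3) $\langle a,b,c\mid a^{p^n}=b^{p^{m+1}}=c^p=1,[a,b]=c,[c,a]=1,[c,b]=b^{p^m}\rangle$; (J5) $\langle a,b,c,d\mid a^{p^n}=b^{p^m}=c^p=d^p=1,[a,b]=c,[c,a]=1,[c,b]=d,[d,a]=[d,b]=1\rangle$.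
   Context: $[x,y]=x^{-1}y^{-1}xy$. An $\mathcal{A}_1$-group is a minimal non-abelian $p$-group. For a finite non-abelian $p$-group $G$, $p^{I_{\max}}$ denotes the maximal index in $G$ of the $\mathcal{A}_1$-subgroups of $G$. $m,n$ are positive integers. A $3$-group of order $3^4$ is of maximal class if its nilpotency class is $3$. For $p=2$ only $\nu=1$ occurs. *)

theory Defs
  imports "HOL-Algebra.Generated_Groups" "HOL-Number_Theory.Residues"
begin

section \<open>Commutators and nilpotency class\<close>

definition commutator :: "('a, 'b) monoid_scheme \<Rightarrow> 'a \<Rightarrow> 'a \<Rightarrow> 'a" (\<open>\<lbrakk>_, _\<rbrakk>\<index>\<close>) where
  "\<lbrakk>x, y\<rbrakk>\<^bsub>G\<^esub> = inv\<^bsub>G\<^esub> x \<otimes>\<^bsub>G\<^esub> inv\<^bsub>G\<^esub> y \<otimes>\<^bsub>G\<^esub> x \<otimes>\<^bsub>G\<^esub> y"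

text \<open>The index is shifted: \<open>lower_central G i\<close> is usually written \<open>\<gamma>\<close> with subscript \<open>i + 1\<close>.\<close>

primrec lower_central :: "('a, 'b) monoid_scheme \<Rightarrow> nat \<Rightarrow> 'a set" where
  "lower_central G 0 = carrier G"
| "lower_central G (Suc i) =
     generate G {\<lbrakk>x, y\<rbrakk>\<^bsub>G\<^esub> | x y. x \<in> lower_central G i \<and> y \<in> carrier G}"

definition has_nilpotency_class :: "('a, 'b) monoid_scheme \<Rightarrow> nat \<Rightarrow> bool" where
  "has_nilpotency_class G c \<longleftrightarrow>
     lower_central G c = {\<one>\<^bsub>G\<^esub>} \<and> (\<forall>i<c. lower_central G i \<noteq> {\<one>\<^bsub>G\<^esub>})"


section \<open>Minimal non-abelian subgroups\<close>

definition finite_p_group :: "nat \<Rightarrow> ('a, 'b) monoid_scheme \<Rightarrow> bool" where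
  "finite_p_group p G \<longleftrightarrow> group G \<and> finite (carrier G) \<and> (\<exists>k. order G = p ^ k)"

definition A1_group :: "nat \<Rightarrow> ('a, 'b) monoid_scheme \<Rightarrow> bool" where
  "A1_group p G \<longleftrightarrow> finite_p_group p G \<and> \<not> comm_group G \<and>
     (\<forall>H. subgroup H G \<and> H \<noteq> carrier G \<longrightarrow> comm_group (G\<lparr>carrier := H\<rparr>))"

definition A1_subgroup :: "nat \<Rightarrow> 'a set \<Rightarrow> ('a, 'b) monoid_scheme \<Rightarrow> bool" where
  "A1_subgroup p H G \<longleftrightarrow> subgroup H G \<and> A1_group p (G\<lparr>carrier := H\<rparr>)"

text \<open>Only meaningful for finite non-abelian \<open>p\<close>-groups: there the set of indices is finite and
  non-empty and consists of powers of \<open>p\<close>.\<close>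

definition Imax :: "nat \<Rightarrow> ('a, 'b) monoid_scheme \<Rightarrow> nat" where
  "Imax p G = (THE k. p ^ k = Max {card (rcosets\<^bsub>G\<^esub> H) | H. A1_subgroup p H G})"

text \<open>The claim \<open>Imax p G = k\<close> together with what is needed for \<open>Imax p G\<close> to be meaningful.\<close>

definition has_Imax :: "nat \<Rightarrow> ('a, 'b) monoid_scheme \<Rightarrow> nat \<Rightarrow> bool" where
  "has_Imax p G k \<longleftrightarrow> finite_p_group p G \<and> \<not> comm_group G \<and> Imax p G = k"


section \<open>Free groups and presentations\<close>

text \<open>A letter \<open>(x, True)\<close> stands for the generator \<open>x\<close>, and \<open>(x, False)\<close> for its inverse.\<close>

type_synonym 'x word = "('x \<times> bool) list"

definition words :: "'x set \<Rightarrow> 'x word set" where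
  "words S = lists (S \<times> UNIV)"

definition cancellation :: "'x set \<Rightarrow> ('x word \<times> 'x word) set" where
  "cancellation S = {(u @ [(x, e), (x, \<not> e)] @ v, u @ v) | u x e v.
     u \<in> words S \<and> v \<in> words S \<and> x \<in> S}"

definition free_eq :: "'x set \<Rightarrow> ('x word \<times> 'x word) set" where
  "free_eq S = (cancellation S \<union> (cancellation S)\<inverse>)\<^sup>*"

definition free_group :: "'x set \<Rightarrow> 'x word set monoid" where
  "free_group S = \<lparr>carrier = words S // free_eq S,
     monoid.mult = (\<lambda>P Q. \<Union>u\<in>P. \<Union>v\<in>Q. free_eq S `` {u @ v}),
     one = free_eq S `` {[]}\<rparr>"

definition free_gen :: "'x set \<Rightarrow> 'x \<Rightarrow> 'x word set" where
  "free_gen S x = free_eq S `` {[(x, True)]}"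

definition normal_closure :: "('a, 'b) monoid_scheme \<Rightarrow> 'a set \<Rightarrow> 'a set" where
  "normal_closure G S = \<Inter>{N. N \<lhd> G \<and> S \<subseteq> N}"

text \<open>A pair \<open>(u, v)\<close> of elements of the free group encodes the defining relation \<open>u = v\<close>.\<close>

definition presented_group ::
    "'x set \<Rightarrow> ('x word set \<times> 'x word set) set \<Rightarrow> 'x word set set monoid" where
  "presented_group S R = free_group S Mod
     normal_closure (free_group S)
       {u \<otimes>\<^bsub>free_group S\<^esub> inv\<^bsub>free_group S\<^esub> v | u v. (u, v) \<in> R}"

datatype generator = GA | GB | GC | GD

type_synonym pgroup = "generator word set set monoid"

definition presented3 ::
    "(generator word set monoid \<Rightarrow> generator word set \<Rightarrow> generator word set \<Rightarrow> generator word set \<Rightarrow>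
       (generator word set \<times> generator word set) set) \<Rightarrow> pgroup" where
  "presented3 R = (let S = {GA, GB, GC} in
     presented_group S (R (free_group S) (free_gen S GA) (free_gen S GB) (free_gen S GC)))"

definition presented4 ::
    "(generator word set monoid \<Rightarrow> generator word set \<Rightarrow> generator word set \<Rightarrow> generator word set \<Rightarrow>
       generator word set \<Rightarrow> (generator word set \<times> generator word set) set) \<Rightarrow> pgroup" where
  "presented4 R = (let S = {GA, GB, GC, GD} in
     presented_group S (R (free_group S)
       (free_gen S GA) (free_gen S GB) (free_gen S GC) (free_gen S GD)))"


section \<open>The groups\<close>

context
  fixes F :: "('a, 'b) monoid_scheme" (structure)
begin

definition rel_H1 where
  "rel_H1 a b c d = {(a [^] (4::nat), \<one>), (b [^] (2::nat), \<one>), (c [^] (2::nat), \<one>),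
     (d [^] (2::nat), \<one>), (\<lbrakk>a, b\<rbrakk>, c), (\<lbrakk>c, a\<rbrakk>, d), (\<lbrakk>c, b\<rbrakk>, \<one>), (\<lbrakk>d, a\<rbrakk>, \<one>), (\<lbrakk>d, b\<rbrakk>, \<one>)}"

definition rel_H2 where
  "rel_H2 a b c = {(a [^] (8::nat), \<one>), (b [^] (2::nat), \<one>), (c [^] (2::nat), \<one>),
     (\<lbrakk>a, b\<rbrakk>, c), (\<lbrakk>c, a\<rbrakk>, a [^] (4::nat)), (\<lbrakk>c, b\<rbrakk>, \<one>)}"

definition rel_H3 where
  "rel_H3 a b c = {(a [^] (8::nat), \<one>), (c [^] (2::nat), \<one>), (b [^] (2::nat), a [^] (4::nat)),
     (\<lbrakk>a, b\<rbrakk>, c), (\<lbrakk>c, a\<rbrakk>, b [^] (2::nat)), (\<lbrakk>c, b\<rbrakk>, \<one>)}"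

definition rel_I1 where
  "rel_I1 (n::nat) a b c d = {(a [^] ((2::nat) ^ n), \<one>), (b [^] (2::nat), \<one>),
     (c [^] (2::nat), \<one>), (d [^] (2::nat), \<one>),
     (\<lbrakk>a, b\<rbrakk>, c), (\<lbrakk>c, a\<rbrakk>, d), (\<lbrakk>c, b\<rbrakk>, \<one>), (\<lbrakk>d, a\<rbrakk>, \<one>), (\<lbrakk>d, b\<rbrakk>, \<one>)}"

definition rel_I2 where
  "rel_I2 (n::nat) a b c = {(a [^] ((2::nat) ^ (n + 1)), \<one>), (b [^] (2::nat), \<one>),
     (c [^] (2::nat), \<one>),
     (\<lbrakk>a, b\<rbrakk>, c), (\<lbrakk>c, a\<rbrakk>, a [^] ((2::nat) ^ n)), (\<lbrakk>c, b\<rbrakk>, \<one>)}"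

definition rel_I3 where
  "rel_I3 (n::nat) a b c = {(a [^] ((2::nat) ^ n), \<one>), (b [^] (4::nat), \<one>), (c [^] (2::nat), \<one>),
     (\<lbrakk>a, b\<rbrakk>, c), (\<lbrakk>c, a\<rbrakk>, b [^] (2::nat)), (\<lbrakk>c, b\<rbrakk>, \<one>)}"

definition rel_G1 where
  "rel_G1 (p::nat) (m::nat) (\<nu>::int) a b c =
    {(a [^] (p ^ (m + 1)), \<one>), (b [^] (p ^ m), \<one>), (c [^] p, \<one>),
     (\<lbrakk>a, b\<rbrakk>, c), (\<lbrakk>c, a\<rbrakk>, \<one>), (\<lbrakk>c, b\<rbrakk>, a [^] (\<nu> * int p ^ m))}"

definition rel_G2 where
  "rel_G2 (p::nat) (m::nat) a b c d =
    {(a [^] (p ^ m), \<one>), (b [^] (p ^ m), \<one>), (c [^] p, \<one>), (d [^] p, \<one>),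
     (\<lbrakk>a, b\<rbrakk>, c), (\<lbrakk>c, a\<rbrakk>, d), (\<lbrakk>c, b\<rbrakk>, \<one>), (\<lbrakk>d, a\<rbrakk>, \<one>), (\<lbrakk>d, b\<rbrakk>, \<one>)}"

definition rel_G3 where
  "rel_G3 (p::nat) (m::nat) a b c =
    {(a [^] (p ^ (m + 1)), \<one>), (b [^] (p ^ m), \<one>), (c [^] p, \<one>),
     (\<lbrakk>a, b\<rbrakk>, c), (\<lbrakk>c, a\<rbrakk>, a [^] (p ^ m)), (\<lbrakk>c, b\<rbrakk>, \<one>)}"

definition rel_J1 where
  "rel_J1 (p::nat) (n::nat) (m::nat) (\<nu>::int) a b c =
    {(a [^] (p ^ (n + 1)), \<one>), (b [^] (p ^ m), \<one>), (c [^] p, \<one>),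
     (\<lbrakk>a, b\<rbrakk>, c), (\<lbrakk>c, a\<rbrakk>, \<one>), (\<lbrakk>c, b\<rbrakk>, a [^] (\<nu> * int p ^ n))}"

definition rel_J2 where
  "rel_J2 (p::nat) (n::nat) (m::nat) a b c =
    {(a [^] (p ^ (n + 1)), \<one>), (b [^] (p ^ m), \<one>), (c [^] p, \<one>),
     (\<lbrakk>a, b\<rbrakk>, c), (\<lbrakk>c, a\<rbrakk>, a [^] (p ^ n)), (\<lbrakk>c, b\<rbrakk>, \<one>)}"

definition rel_J3 where
  "rel_J3 (p::nat) (n::nat) (m::nat) a b c =
    {(a [^] (p ^ n), \<one>), (b [^] (p ^ (m + 1)), \<one>), (c [^] p, \<one>),
     (\<lbrakk>a, b\<rbrakk>, c), (\<lbrakk>c, a\<rbrakk>, \<one>), (\<lbrakk>c, b\<rbrakk>, b [^] (p ^ m))}"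

definition rel_J4 where
  "rel_J4 (p::nat) (n::nat) (m::nat) (\<nu>::int) a b c =
    {(a [^] (p ^ n), \<one>), (b [^] (p ^ (m + 1)), \<one>), (c [^] p, \<one>),
     (\<lbrakk>a, b\<rbrakk>, c), (\<lbrakk>c, a\<rbrakk>, b [^] (\<nu> * int p ^ m)), (\<lbrakk>c, b\<rbrakk>, \<one>)}"

definition rel_J5 where
  "rel_J5 (p::nat) (n::nat) (m::nat) a b c d =
    {(a [^] (p ^ n), \<one>), (b [^] (p ^ m), \<one>), (c [^] p, \<one>), (d [^] p, \<one>),
     (\<lbrakk>a, b\<rbrakk>, c), (\<lbrakk>c, a\<rbrakk>, \<one>), (\<lbrakk>c, b\<rbrakk>, d), (\<lbrakk>d, a\<rbrakk>, \<one>), (\<lbrakk>d, b\<rbrakk>, \<one>)}"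

definition rel_J6 where
  "rel_J6 (p::nat) (n::nat) (m::nat) a b c d =
    {(a [^] (p ^ n), \<one>), (b [^] (p ^ m), \<one>), (c [^] p, \<one>), (d [^] p, \<one>),
     (\<lbrakk>a, b\<rbrakk>, c), (\<lbrakk>c, a\<rbrakk>, d), (\<lbrakk>c, b\<rbrakk>, \<one>), (\<lbrakk>d, a\<rbrakk>, \<one>), (\<lbrakk>d, b\<rbrakk>, \<one>)}"

end

definition group_H1 :: pgroup where "group_H1 = presented4 rel_H1"
definition group_H2 :: pgroup where "group_H2 = presented3 rel_H2"
definition group_H3 :: pgroup where "group_H3 = presented3 rel_H3"

definition group_I1 :: "nat \<Rightarrow> pgroup" where "group_I1 n = presented4 (\<lambda>F. rel_I1 F n)"
definition group_I2 :: "nat \<Rightarrow> pgroup" where "group_I2 n = presented3 (\<lambda>F. rel_I2 F n)"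
definition group_I3 :: "nat \<Rightarrow> pgroup" where "group_I3 n = presented3 (\<lambda>F. rel_I3 F n)"

definition group_G1 :: "nat \<Rightarrow> nat \<Rightarrow> int \<Rightarrow> pgroup" where
  "group_G1 p m \<nu> = presented3 (\<lambda>F. rel_G1 F p m \<nu>)"
definition group_G2 :: "nat \<Rightarrow> nat \<Rightarrow> pgroup" where
  "group_G2 p m = presented4 (\<lambda>F. rel_G2 F p m)"
definition group_G3 :: "nat \<Rightarrow> nat \<Rightarrow> pgroup" where
  "group_G3 p m = presented3 (\<lambda>F. rel_G3 F p m)"

definition group_J1 :: "nat \<Rightarrow> nat \<Rightarrow> nat \<Rightarrow> int \<Rightarrow> pgroup" where
  "group_J1 p n m \<nu> = presented3 (\<lambda>F. rel_J1 F p n m \<nu>)"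
definition group_J2 :: "nat \<Rightarrow> nat \<Rightarrow> nat \<Rightarrow> pgroup" where
  "group_J2 p n m = presented3 (\<lambda>F. rel_J2 F p n m)"
definition group_J3 :: "nat \<Rightarrow> nat \<Rightarrow> nat \<Rightarrow> pgroup" where
  "group_J3 p n m = presented3 (\<lambda>F. rel_J3 F p n m)"
definition group_J4 :: "nat \<Rightarrow> nat \<Rightarrow> nat \<Rightarrow> int \<Rightarrow> pgroup" where
  "group_J4 p n m \<nu> = presented3 (\<lambda>F. rel_J4 F p n m \<nu>)"
definition group_J5 :: "nat \<Rightarrow> nat \<Rightarrow> nat \<Rightarrow> pgroup" where
  "group_J5 p n m = presented4 (\<lambda>F. rel_J5 F p n m)"
definition group_J6 :: "nat \<Rightarrow> nat \<Rightarrow> nat \<Rightarrow> pgroup" where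
  "group_J6 p n m = presented4 (\<lambda>F. rel_J6 F p n m)"

text \<open>No integer is a quadratic non-residue modulo 2, so only \<open>\<nu> = 1\<close> remains for \<open>p = 2\<close>.
  A non-residue is automatically prime to \<open>p\<close>, since \<^const>\<open>QuadRes\<close> holds at multiples of \<open>p\<close>.\<close>

definition admissible_nu :: "nat \<Rightarrow> int \<Rightarrow> bool" where
  "admissible_nu p \<nu> \<longleftrightarrow> \<nu> = 1 \<or> \<not> QuadRes (int p) \<nu>"

end

theory Submission
  imports Defs
begin

text \<open>A non-abelian subgroup of least order is minimal non-abelian, so \<open>I\<^sub>m\<^sub>a\<^sub>x\<close> is determined by the least
  order of a non-abelian subgroup. Up to renaming generators, every group in the lists (H), (I), (G), (J)
  has generators \<open>a, b\<close> such that \<open>c = [a, b]\<close> commutes with \<open>b\<close>, \<open>z = [c, a]\<close> is central, \<open>c\<close> and \<open>z\<close> have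
  order \<open>p\<close>, and the powers of \<open>a\<close> and \<open>b\<close> with exponents \<open>p^r\<close> and \<open>p^s\<close> lie in \<open>\<langle>z\<rangle>\<close>. Such a
  group is a quotient of an explicit group structure on quadruples of integers, so it has order
  \<open>p^(r + s + 2)\<close>. A subgroup containing two non-commuting elements, not both in the centralizer of \<open>c\<close>,
  contains \<open>z\<close> and has order at least \<open>p^(r + 2)\<close>, which is the order of \<open>\<langle>a, c\<rangle>\<close>. The centralizer of
  \<open>c\<close> is abelian for odd \<open>p\<close>; for \<open>p = 2\<close> its non-abelian subgroups have order at least \<open>2^(r + s)\<close>, attained
  by \<open>\<langle>a\<^sup>2, b\<rangle>\<close>. Hence \<open>I\<^sub>m\<^sub>a\<^sub>x = s\<close>, except that \<open>I\<^sub>m\<^sub>a\<^sub>x = 2\<close> if \<open>p = 2\<close> and \<open>s = 1\<close>. In (F), a non-abelian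
  subgroup generated by an element of the commutator subgroup and one further element is proper.\<close>

section \<open>Orders of non-abelian subgroups\<close>

text \<open>The obstacle is that a presentation bounds a group only from above: its relations might
  collapse \<open>c\<close> or \<open>z\<close>. Hence one infinite group \<open>nil4\<close>, free
  of all parameters, is built, and its factor group by an explicit subgroup \<open>Ker\<close>
  supplies the bound from below. Evaluating quadruples maps \<open>nil4\<close> onto the presented
  group and kills \<open>Ker\<close>; the presented group maps in turn to the factor group, so the
  kernel is exactly \<open>Ker\<close>. All counting then becomes arithmetic with exponents.

  In some families \<open>z\<close> is a generator of its own, in others a power of \<open>a\<close>
  or of \<open>b\<close>. The numbers \<epsilon> and \<delta> in a^(p^r) = z^\<epsilon> and b^(p^s)
  = z^\<delta> absorb this difference; a factor \<nu> reappears as its inverse modulo p.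

  The prime 2 is special because the exponent of z in a^(-i) b a^i is -i(i-1)/2. For i = 2 it is
  odd, so for p = 2 the element a^2 centralizes c but not b, which creates a second kind of small
  non-abelian subgroup. For i = p^r it has to vanish modulo p, which forces r \<ge> 2 when p =
  2.\<close>

lemma (in group) comm_group_subgroup_iff:
  assumes "subgroup H G"
  shows "comm_group (G\<lparr>carrier := H\<rparr>) \<longleftrightarrow> (\<forall>x\<in>H. \<forall>y\<in>H. x \<otimes> y = y \<otimes> x)"
proof
  assume "comm_group (G\<lparr>carrier := H\<rparr>)"
  then interpret H: comm_group "G\<lparr>carrier := H\<rparr>" .
  show "\<forall>x\<in>H. \<forall>y\<in>H. x \<otimes> y = y \<otimes> x"
    using H.m_comm by simp
next
  interpret H: group "G\<lparr>carrier := H\<rparr>"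
    by (rule subgroup_imp_group[OF assms])
  assume "\<forall>x\<in>H. \<forall>y\<in>H. x \<otimes> y = y \<otimes> x"
  then show "comm_group (G\<lparr>carrier := H\<rparr>)"
    by (intro H.group_comm_groupI) auto
qed

lemma (in group) card_subgroup_prime_power:
  assumes "prime (p::nat)" "order G = p ^ e" "subgroup H G"
  shows "\<exists>k. card H = p ^ k"
proof -
  have "card H dvd p ^ e"
    using lagrange[OF assms(3)] assms(2) by (metis dvd_triv_right)
  then show ?thesis
    using assms(1) by (auto simp: divides_primepow_nat)
qed

text \<open>Only inequalities are asked for: \<open>least\<close>, applied to \<open>H\<close>
  itself, turns the upper bound on its order into an equality, so no subgroup order is ever computed
  exactly. Proper subgroups of \<open>H\<close> lie below the bound in \<open>least\<close> and are
  therefore abelian.\<close>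

lemma (in group) has_ImaxI:
  assumes p: "prime (p::nat)" and ord: "order G = p ^ e"
    and H: "subgroup H G" "x \<in> H" "y \<in> H" "x \<otimes> y \<noteq> y \<otimes> x"
    and cardH: "card H * p ^ k \<le> order G"
    and least: "\<And>K x y. subgroup K G \<Longrightarrow> x \<in> K \<Longrightarrow> y \<in> K \<Longrightarrow> x \<otimes> y \<noteq> y \<otimes> x \<Longrightarrow>
      order G \<le> card K * p ^ k"
  shows "has_Imax p G k"
proof -
  have p0: "p > 1" using p by (rule prime_gt_1_nat)
  have fin: "finite (carrier G)"
    using ord p0 order_gt_0_iff_finite by simp
  have finsub: "finite K" if "subgroup K G" for K
    using that fin finite_subset subgroup.subset by blast
  have eqH: "card H * p ^ k = order G"
    using cardH least[OF H] by simp
  have "\<not> comm_group G"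
  proof
    assume "comm_group G"
    then interpret comm_group G .
    show False using H m_comm subgroup.mem_carrier by metis
  qed
  have A1: "A1_subgroup p H G"
    unfolding A1_subgroup_def A1_group_def finite_p_group_def
  proof (intro conjI allI impI)
    show "\<not> comm_group (G\<lparr>carrier := H\<rparr>)"
      using H comm_group_subgroup_iff by blast
    show "\<exists>k. order (G\<lparr>carrier := H\<rparr>) = p ^ k"
      using card_subgroup_prime_power[OF p ord H(1)] by (simp add: order_def)
    fix K assume K: "subgroup K (G\<lparr>carrier := H\<rparr>) \<and> K \<noteq> carrier (G\<lparr>carrier := H\<rparr>)"
    then have KG: "subgroup K G" using H(1) incl_subgroup by blast
    have "K \<subset> H" using K subgroup.subset by fastforce
    then have "card K < card H" using finsub[OF H(1)] psubset_card_mono by blast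
    then have "card K * p ^ k < card H * p ^ k" using p0 by simp
    then have "card K * p ^ k < order G" using eqH by simp
    then have "comm_group (G\<lparr>carrier := K\<rparr>)"
      using least[OF KG] comm_group_subgroup_iff[OF KG] by (meson not_le)
    then show "comm_group (G\<lparr>carrier := H, carrier := K\<rparr>)" by simp
  qed (use H finsub subgroup_imp_group in auto)
  define I where "I = {card (rcosets H) | H. A1_subgroup p H G}"
  have idx: "card (rcosets K) * card K = p ^ e" if "subgroup K G" for K
    using lagrange[OF that] ord by simp
  have card0: "card K > 0" if "subgroup K G" for K
    using finsub[OF that] subgroup.one_closed[OF that] by (metis card_gt_0_iff empty_iff)
  have "p ^ k = card (rcosets H)"
    using idx[OF H(1)] eqH ord card0[OF H(1)] by (metis mult.commute mult_cancel2 neq0_conv)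
  then have mem: "p ^ k \<in> I" using A1 by (auto simp: I_def)
  moreover have le: "i \<le> p ^ k" if "i \<in> I" for i
  proof -
    obtain K where K: "i = card (rcosets K)" "A1_subgroup p K G" using \<open>i \<in> I\<close> by (auto simp: I_def)
    then have KG: "subgroup K G" and nc: "\<not> comm_group (G\<lparr>carrier := K\<rparr>)"
      by (auto simp: A1_subgroup_def A1_group_def)
    have "order G \<le> card K * p ^ k"
      using nc comm_group_subgroup_iff[OF KG] least[OF KG] by blast
    then have "i * card K \<le> p ^ k * card K"
      using idx[OF KG] ord K by (simp add: mult.commute)
    then show ?thesis using card0[OF KG] by simp
  qed
  moreover have "finite I" using le by (auto intro: finite_subset[of _ "{..p ^ k}"])
  ultimately have "Max I = p ^ k" by (intro Max_eqI)
  then have "Imax p G = k"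
    unfolding Imax_def I_def[symmetric] using p0 by (intro the_equality) (auto simp: power_inject_exp)
  then show ?thesis
    using \<open>\<not> comm_group G\<close> fin ord is_group by (auto simp: has_Imax_def finite_p_group_def)
qed

section \<open>Commutator calculus and centralizers\<close>

lemma (in group) inv_mult_cancel:
  assumes "x \<in> carrier G" "y \<in> carrier G"
  shows "x \<otimes> (inv x \<otimes> y) = y" "inv x \<otimes> (x \<otimes> y) = y"
  using assms by (simp_all add: m_assoc[symmetric])

lemma (in group) commutator_closed [simp]:
  "x \<in> carrier G \<Longrightarrow> y \<in> carrier G \<Longrightarrow> \<lbrakk>x, y\<rbrakk> \<in> carrier G"
  by (simp add: commutator_def)

lemma (in group) mult_eq_mult_commutator:
  "x \<in> carrier G \<Longrightarrow> y \<in> carrier G \<Longrightarrow> x \<otimes> y = y \<otimes> x \<otimes> \<lbrakk>x, y\<rbrakk>"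
  using inv_mult_cancel(1)[of "y \<otimes> x" "x \<otimes> y"] by (simp add: commutator_def m_assoc inv_mult_group)

lemma (in group) commutator_eqI:
  assumes "x \<in> carrier G" "y \<in> carrier G" "w \<in> carrier G" "x \<otimes> y = y \<otimes> x \<otimes> w"
  shows "\<lbrakk>x, y\<rbrakk> = w"
  using assms mult_eq_mult_commutator by (metis Units_eq Units_l_cancel commutator_closed m_closed)

lemma (in group) commutator_eq_one_iff:
  "x \<in> carrier G \<Longrightarrow> y \<in> carrier G \<Longrightarrow> \<lbrakk>x, y\<rbrakk> = \<one> \<longleftrightarrow> x \<otimes> y = y \<otimes> x"
  by (metis commutator_eqI m_closed mult_eq_mult_commutator one_closed r_one)

lemma (in group) subgroup_commutator_closed:
  "subgroup H G \<Longrightarrow> x \<in> H \<Longrightarrow> y \<in> H \<Longrightarrow> \<lbrakk>x, y\<rbrakk> \<in> H"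
  by (simp add: commutator_def subgroup.m_closed subgroup.m_inv_closed)

text \<open>Centralizers are taken inside \<open>H\<close> to build chains of subgroups of
  \<open>H\<close>. With \<open>H = carrier G\<close> and a single \<open>s\<close>, the same fact
  shows that whatever commutes with two elements commutes with their commutator.\<close>

lemma (in group) subgroup_centralizer:
  assumes "subgroup H G" "S \<subseteq> carrier G"
  shows "subgroup {h \<in> H. \<forall>s\<in>S. h \<otimes> s = s \<otimes> h} G"
proof (rule subgroupI)
  show "{h \<in> H. \<forall>s\<in>S. h \<otimes> s = s \<otimes> h} \<subseteq> carrier G"
    using subgroup.subset[OF assms(1)] by auto
  show "{h \<in> H. \<forall>s\<in>S. h \<otimes> s = s \<otimes> h} \<noteq> {}"
    using subgroup.one_closed[OF assms(1)] assms(2) by force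
next
  fix h assume h: "h \<in> {h \<in> H. \<forall>s\<in>S. h \<otimes> s = s \<otimes> h}"
  have "inv h \<otimes> s = s \<otimes> inv h" if "s \<in> S" for s
  proof -
    have C: "h \<in> carrier G" "s \<in> carrier G" and hs: "h \<otimes> s = s \<otimes> h"
      using h that assms subgroup.mem_carrier by auto
    have "inv h \<otimes> s = inv h \<otimes> (s \<otimes> h) \<otimes> inv h" using C by (simp add: m_assoc)
    also have "\<dots> = s \<otimes> inv h" using C by (simp add: hs[symmetric] m_assoc inv_mult_cancel)
    finally show ?thesis .
  qed
  then show "inv h \<in> {h \<in> H. \<forall>s\<in>S. h \<otimes> s = s \<otimes> h}"
    using h subgroup.m_inv_closed[OF assms(1)] by auto
next
  fix h g assume h: "h \<in> {h \<in> H. \<forall>s\<in>S. h \<otimes> s = s \<otimes> h}" and g: "g \<in> {h \<in> H. \<forall>s\<in>S. h \<otimes> s = s \<otimes> h}"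
  have "h \<otimes> g \<otimes> s = s \<otimes> (h \<otimes> g)" if "s \<in> S" for s
  proof -
    have C: "h \<in> carrier G" "g \<in> carrier G" "s \<in> carrier G"
      and "h \<otimes> s = s \<otimes> h" "g \<otimes> s = s \<otimes> g"
      using h g that assms subgroup.mem_carrier by auto
    then show ?thesis by (metis m_assoc)
  qed
  then show "h \<otimes> g \<in> {h \<in> H. \<forall>s\<in>S. h \<otimes> s = s \<otimes> h}"
    using h g subgroup.m_closed[OF assms(1)] by auto
qed

subsection \<open>Groups of class 3\<close>

lemmas [simp del] = lower_central.simps(2)

text \<open>This says class at most 3. That the class is exactly 3 enters separately, as
  \<open>\<gamma>3 \<noteq> {\<one>}\<close>.\<close>

locale class3_group = group +
  assumes lower_central_3: "lower_central G 3 = {\<one>}"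
begin

abbreviation "\<gamma>2 \<equiv> lower_central G (Suc 0)"
abbreviation "\<gamma>3 \<equiv> lower_central G 2"

lemma lower_central_in_carrier: "lower_central G i \<subseteq> carrier G"
proof (induction i)
  case (Suc i)
  then have "{\<lbrakk>x, y\<rbrakk> | x y. x \<in> lower_central G i \<and> y \<in> carrier G} \<subseteq> carrier G" by auto
  then show ?case unfolding lower_central.simps by (rule generate_incl)
qed auto

lemma subgroup_lower_central: "subgroup (lower_central G i) G"
proof (cases i)
  case (Suc j)
  have "{\<lbrakk>x, y\<rbrakk> | x y. x \<in> lower_central G j \<and> y \<in> carrier G} \<subseteq> carrier G"
    using lower_central_in_carrier[of j] by auto
  then show ?thesis unfolding Suc lower_central.simps by (rule generate_is_subgroup)
qed (simp add: subgroup_self)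

lemma commutator_in_lower_central:
  "x \<in> lower_central G i \<Longrightarrow> y \<in> carrier G \<Longrightarrow> \<lbrakk>x, y\<rbrakk> \<in> lower_central G (Suc i)"
  by (auto simp: lower_central.simps(2) intro: generate.incl)

lemma \<gamma>2_eq: "\<gamma>2 = generate G {\<lbrakk>x, y\<rbrakk> | x y. x \<in> carrier G \<and> y \<in> carrier G}"
  by (simp add: lower_central.simps(2))

lemma \<gamma>3_eq: "\<gamma>3 = generate G {\<lbrakk>x, y\<rbrakk> | x y. x \<in> \<gamma>2 \<and> y \<in> carrier G}"
  by (simp add: lower_central.simps(2) numeral_2_eq_2)

lemma \<gamma>2I: "x \<in> carrier G \<Longrightarrow> y \<in> carrier G \<Longrightarrow> \<lbrakk>x, y\<rbrakk> \<in> \<gamma>2"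
  using commutator_in_lower_central[of x 0 y] by simp

lemma \<gamma>3I: "x \<in> \<gamma>2 \<Longrightarrow> y \<in> carrier G \<Longrightarrow> \<lbrakk>x, y\<rbrakk> \<in> \<gamma>3"
  using commutator_in_lower_central[of x "Suc 0" y] by (simp add: numeral_2_eq_2)

lemma \<gamma>3_central:
  assumes "x \<in> \<gamma>3" "y \<in> carrier G"
  shows "x \<otimes> y = y \<otimes> x"
proof -
  have "\<lbrakk>x, y\<rbrakk> \<in> lower_central G 3"
    using commutator_in_lower_central[of x 2 y] assms by (simp add: numeral_3_eq_3 numeral_2_eq_2)
  then show ?thesis
    using assms lower_central_3 lower_central_in_carrier commutator_eq_one_iff by blast
qed

lemma \<gamma>3_subset_\<gamma>2: "\<gamma>3 \<subseteq> \<gamma>2"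
proof -
  have "{\<lbrakk>x, y\<rbrakk> | x y. x \<in> \<gamma>2 \<and> y \<in> carrier G} \<subseteq> {\<lbrakk>x, y\<rbrakk> | x y. x \<in> carrier G \<and> y \<in> carrier G}"
    using lower_central_in_carrier[of "Suc 0"] by blast
  then show ?thesis using mono_generate unfolding \<gamma>2_eq \<gamma>3_eq by blast
qed

text \<open>If w = [x, y] fails to commute with one of x and y, say t, then the pair (w, t) does the
  job: its commutator lies in \<open>\<gamma>3\<close> and is central.\<close>

lemma exists_central_commutator:
  assumes "x \<in> carrier G" "y \<in> carrier G" "x \<otimes> y \<noteq> y \<otimes> x"
    and H: "subgroup H G" "x \<in> H" "y \<in> H"
  shows "\<exists>x\<in>H. \<exists>y\<in>H. x \<otimes> y \<noteq> y \<otimes> x \<and> \<lbrakk>x, y\<rbrakk> \<otimes> x = x \<otimes> \<lbrakk>x, y\<rbrakk> \<and> \<lbrakk>x, y\<rbrakk> \<otimes> y = y \<otimes> \<lbrakk>x, y\<rbrakk>"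
proof -
  define w where "w = \<lbrakk>x, y\<rbrakk>"
  have w: "w \<in> H" "w \<in> \<gamma>2" "w \<in> carrier G"
    using assms \<gamma>2I subgroup_commutator_closed by (auto simp: w_def)
  show ?thesis
  proof (cases "w \<otimes> x = x \<otimes> w \<and> w \<otimes> y = y \<otimes> w")
    case True
    then show ?thesis using assms by (auto simp: w_def)
  next
    case False
    then obtain t where t: "t \<in> H" "t \<in> carrier G" "w \<otimes> t \<noteq> t \<otimes> w" using assms by auto
    have "\<lbrakk>w, t\<rbrakk> \<in> \<gamma>3" using \<gamma>3I w t by auto
    then show ?thesis using \<gamma>3_central w t by (intro bexI[of _ w] bexI[of _ t]) auto
  qed
qed

text \<open>If \<open>w = [x, y]\<close> is central in \<open>H\<close>, then the centre, the centralizer of \<open>x\<close> and \<open>H\<close> itself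
  form a chain of proper inclusions, as \<open>w\<close>, \<open>x\<close> and \<open>y\<close> show.\<close>

lemma card_nonabelian_subgroup_ge:
  assumes p: "prime (p::nat)" and ord: "order G = p ^ e"
    and K: "subgroup K G" "x \<in> K" "y \<in> K" "x \<otimes> y \<noteq> y \<otimes> x"
  shows "p ^ 3 \<le> card K"
proof -
  have p1: "p > 1" using p by (rule prime_gt_1_nat)
  have fin: "finite (carrier G)" using ord p1 order_gt_0_iff_finite by simp
  have KC: "K \<subseteq> carrier G" by (rule subgroup.subset[OF K(1)])
  then obtain u v where uv: "u \<in> K" "v \<in> K" "u \<otimes> v \<noteq> v \<otimes> u"
      "\<lbrakk>u, v\<rbrakk> \<otimes> u = u \<otimes> \<lbrakk>u, v\<rbrakk>" "\<lbrakk>u, v\<rbrakk> \<otimes> v = v \<otimes> \<lbrakk>u, v\<rbrakk>"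
    using exists_central_commutator[of x y K] K by blast
  have uvC: "u \<in> carrier G" "v \<in> carrier G" using uv KC by auto
  define C where "C S = {h \<in> K. \<forall>s\<in>S. h \<otimes> s = s \<otimes> h}" for S
  have sub: "subgroup (C S) G" if "S \<subseteq> carrier G" for S
    unfolding C_def by (rule subgroup_centralizer[OF K(1) that])
  have "C {u, v} \<subset> C {u}" using uv by (auto simp: C_def)
  moreover have "C {u} \<subset> K"
  proof -
    have "v \<notin> C {u}" using uv(3) by (auto simp: C_def)
    then show ?thesis using uv(2) by (auto simp: C_def)
  qed
  moreover have "{\<one>} \<subset> C {u, v}"
  proof -
    have "\<lbrakk>u, v\<rbrakk> \<in> C {u, v}" using uv subgroup_commutator_closed[OF K(1)] by (auto simp: C_def)
    moreover have "\<lbrakk>u, v\<rbrakk> \<noteq> \<one>" using uv uvC commutator_eq_one_iff by blast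
    moreover have "\<one> \<in> C {u, v}" using sub uvC by (simp add: subgroup.one_closed)
    ultimately show ?thesis by blast
  qed
  ultimately have lt: "1 < card (C {u, v})" "card (C {u, v}) < card (C {u})" "card (C {u}) < card K"
    using psubset_card_mono[of "C {u, v}" "{\<one>}"] psubset_card_mono[of "C {u}" "C {u, v}"]
      psubset_card_mono[of K "C {u}"] KC fin finite_subset sub[THEN subgroup.subset] uvC
    by (auto simp: finite_subset)
  obtain i j k where "card (C {u, v}) = p ^ i" "card (C {u}) = p ^ j" and k: "card K = p ^ k"
    using card_subgroup_prime_power[OF p ord] sub uvC K(1)
    by (metis empty_subsetI insert_subset)
  then have "0 < i" "i < j" "j < k"
    using lt p1 by (auto simp: power_strict_increasing_iff intro: gr0I)
  then show ?thesis using k p1 by (simp add: power_increasing_iff)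
qed

text \<open>Moving y^j to the left past u costs only [u, y^j], which lies in
  \<open>\<gamma>3\<close> and can be collected at the end. The formula serves twice: for closure of
  the products y^i u under multiplication, and for comparing gh with hg.\<close>

lemma power_\<gamma>2_mult:
  assumes "y \<in> carrier G" "u \<in> \<gamma>2" "v \<in> \<gamma>2"
  shows "\<exists>w\<in>\<gamma>3. y [^] (i::int) \<otimes> u \<otimes> (y [^] (j::int) \<otimes> v) = y [^] (i + j) \<otimes> (u \<otimes> v \<otimes> w)"
proof -
  have C: "u \<in> carrier G" "v \<in> carrier G" using assms lower_central_in_carrier[of "Suc 0"] by auto
  define w where "w = \<lbrakk>u, y [^] j\<rbrakk>"
  have w: "w \<in> \<gamma>3" "w \<in> carrier G" using assms C by (auto simp: w_def intro: \<gamma>3I)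
  have "u \<otimes> y [^] j = y [^] j \<otimes> u \<otimes> w"
    unfolding w_def using assms C by (intro mult_eq_mult_commutator) auto
  then have "y [^] i \<otimes> u \<otimes> (y [^] j \<otimes> v) = y [^] i \<otimes> (y [^] j \<otimes> u \<otimes> w) \<otimes> v"
    using C assms(1) by (metis (no_types, lifting) int_pow_closed m_assoc m_closed)
  also have "\<dots> = y [^] (i + j) \<otimes> (u \<otimes> (w \<otimes> v))"
    using C assms w by (simp add: m_assoc int_pow_mult)
  also have "w \<otimes> v = v \<otimes> w" using w C by (intro \<gamma>3_central)
  finally have "y [^] i \<otimes> u \<otimes> (y [^] j \<otimes> v) = y [^] (i + j) \<otimes> (u \<otimes> v \<otimes> w)"
    using w C by (simp add: m_assoc)
  then show ?thesis using w by blast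
qed

lemma generate_\<gamma>2_subset:
  assumes x: "x \<in> \<gamma>2" and y: "y \<in> carrier G"
  shows "generate G {x, y} \<subseteq> {y [^] (i::int) \<otimes> u | i u. u \<in> \<gamma>2}" (is "_ \<subseteq> ?S")
proof -
  interpret \<gamma>2: subgroup \<gamma>2 G by (rule subgroup_lower_central)
  have "subgroup ?S G"
  proof (rule subgroupI)
    show "?S \<subseteq> carrier G" using y by auto
    show "?S \<noteq> {}" using x by blast
    show mult: "g \<otimes> h \<in> ?S" if gh: "g \<in> ?S" "h \<in> ?S" for g h
    proof -
      obtain i u j v where "g = y [^] (i::int) \<otimes> u" "h = y [^] (j::int) \<otimes> v" and uv: "u \<in> \<gamma>2" "v \<in> \<gamma>2"
        using gh by blast
      with power_\<gamma>2_mult[OF y uv, of i j] obtain w where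
        "w \<in> \<gamma>3" "g \<otimes> h = y [^] (i + j) \<otimes> (u \<otimes> v \<otimes> w)" by blast
      moreover have "u \<otimes> v \<otimes> w \<in> \<gamma>2" using uv \<open>w \<in> \<gamma>3\<close> \<gamma>3_subset_\<gamma>2 by auto
      ultimately show ?thesis by blast
    qed
    show "inv g \<in> ?S" if g: "g \<in> ?S" for g
    proof -
      obtain i u where u: "g = y [^] (i::int) \<otimes> u" "u \<in> \<gamma>2" using g by blast
      \<comment> \<open>The inverse of y^i u is u^(-1) y^(-i), with the factors in the wrong order.
        Each factor alone has the required form, so closure under products finishes the
        argument.\<close>
      have "inv u = y [^] (0::int) \<otimes> inv u" "y [^] (-i) = y [^] (-i) \<otimes> \<one>" using u y by auto
      then have "inv u \<in> ?S" "y [^] (-i) \<in> ?S"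
        using u \<gamma>2.m_inv_closed \<gamma>2.one_closed by blast+
      moreover have "inv g = inv u \<otimes> y [^] (-i)"
        using u y by (simp add: inv_mult_group int_pow_neg)
      ultimately show ?thesis using mult by simp
    qed
  qed
  moreover have "x \<in> ?S"
  proof -
    have "x = y [^] (0::int) \<otimes> x" using x by auto
    then show ?thesis using x by blast
  qed
  moreover have "y \<in> ?S"
  proof -
    have "y = y [^] (1::int) \<otimes> \<one>" using y by auto
    then show ?thesis using \<gamma>2.one_closed by blast
  qed
  ultimately show ?thesis by (intro generate_subgroup_incl) auto
qed

text \<open>Elements of \<open>\<gamma>2\<close> are non-generators: if \<open>G\<close> were generated by \<open>y\<close> and \<open>\<gamma>2\<close>, then \<open>\<gamma>2 = \<gamma>3\<close>
  and hence \<open>\<gamma>3 = 1\<close>.\<close>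

lemma generate_\<gamma>2_neq_carrier:
  assumes "\<gamma>3 \<noteq> {\<one>}" and x: "x \<in> \<gamma>2" and y: "y \<in> carrier G"
  shows "generate G {x, y} \<noteq> carrier G"
proof
  interpret \<gamma>2: subgroup \<gamma>2 G by (rule subgroup_lower_central)
  interpret \<gamma>3: subgroup \<gamma>3 G by (rule subgroup_lower_central)
  assume gen: "generate G {x, y} = carrier G"
  have comm: "\<lbrakk>g, h\<rbrakk> \<in> \<gamma>3" if gh: "g \<in> carrier G" "h \<in> carrier G" for g h
  proof -
    obtain i u j v where g: "g = y [^] (i::int) \<otimes> u" and h: "h = y [^] (j::int) \<otimes> v"
        and uv: "u \<in> \<gamma>2" "v \<in> \<gamma>2"
    proof -
      have "g \<in> {y [^] (i::int) \<otimes> u | i u. u \<in> \<gamma>2}" "h \<in> {y [^] (i::int) \<otimes> u | i u. u \<in> \<gamma>2}"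
        using gh generate_\<gamma>2_subset[OF x y] gen by auto
      then show thesis using that by auto
    qed
    obtain w where w: "w \<in> \<gamma>3" "g \<otimes> h = y [^] (i + j) \<otimes> (u \<otimes> v \<otimes> w)"
      using power_\<gamma>2_mult[OF y uv, of i j] g h by blast
    obtain w' where w': "w' \<in> \<gamma>3" "h \<otimes> g = y [^] (j + i) \<otimes> (v \<otimes> u \<otimes> w')"
      using power_\<gamma>2_mult[OF y uv(2,1), of j i] g h by blast
    define t where "t = \<lbrakk>u, v\<rbrakk>"
    have t: "t \<in> \<gamma>3" using uv \<gamma>3I by (auto simp: t_def)
    \<comment> \<open>The normal forms of gh and hg share the same power of y. Their parts in
      \<open>\<gamma>2\<close> differ by t, w and w', all in \<open>\<gamma>3\<close>, so the
      commutator [g, h] lies in \<open>\<gamma>3\<close>.\<close>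
    have "u \<otimes> v \<otimes> w = v \<otimes> u \<otimes> w' \<otimes> (inv w' \<otimes> t \<otimes> w)"
    proof -
      have "u \<otimes> v = v \<otimes> u \<otimes> t" unfolding t_def using uv by (intro mult_eq_mult_commutator) auto
      moreover have "w' \<otimes> (inv w' \<otimes> t \<otimes> w) = t \<otimes> w" using w w' t by (simp add: m_assoc[symmetric])
      ultimately show ?thesis using uv t w w' by (simp add: m_assoc)
    qed
    then have "g \<otimes> h = h \<otimes> g \<otimes> (inv w' \<otimes> t \<otimes> w)"
      using w w' uv y t by (simp add: m_assoc add.commute)
    then have "\<lbrakk>g, h\<rbrakk> = inv w' \<otimes> t \<otimes> w" using gh t w w' by (intro commutator_eqI) auto
    then show ?thesis using t w w' by simp
  qed
  have "\<gamma>2 \<subseteq> \<gamma>3"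
    unfolding \<gamma>2_eq using comm by (intro generate_subgroup_incl \<gamma>3.subgroup_axioms) auto
  then have triv: "{\<lbrakk>g, h\<rbrakk> | g h. g \<in> \<gamma>2 \<and> h \<in> carrier G} \<subseteq> {\<one>}"
    using \<gamma>3_central commutator_eq_one_iff \<gamma>2.mem_carrier by blast
  have "\<gamma>3 \<subseteq> {\<one>}"
    using generate_subgroup_incl[OF triv triv_subgroup] by (simp add: \<gamma>3_eq)
  then show False using assms(1) \<gamma>3.one_closed by blast
qed

end

text \<open>Two estimates meet at p^3, for every prime p: a proper subgroup of a group of order p^4
  has at most this order, and a non-abelian subgroup has at least this order. A suitable pair x, y
  exists because \<open>\<gamma>3\<close> is not trivial.\<close>

lemma has_Imax_maximal_class:
  fixes G (structure)
  assumes "group G" and p: "prime (p::nat)" and ord: "order G = p ^ 4" and cl: "has_nilpotency_class G 3"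
  shows "has_Imax p G 1"
proof -
  interpret class3_group G
    using assms by (simp add: class3_group_def class3_group_axioms_def has_nilpotency_class_def)
  have \<gamma>3: "\<gamma>3 \<noteq> {\<one>}" using cl by (simp add: has_nilpotency_class_def)
  have p1: "p > 1" using p by (rule prime_gt_1_nat)
  then have fin: "finite (carrier G)" using ord order_gt_0_iff_finite by simp
  obtain x y where xy: "x \<in> \<gamma>2" "y \<in> carrier G" "\<lbrakk>x, y\<rbrakk> \<noteq> \<one>"
  proof (rule ccontr)
    assume "\<not> thesis"
    then have triv: "{\<lbrakk>g, h\<rbrakk> | g h. g \<in> \<gamma>2 \<and> h \<in> carrier G} \<subseteq> {\<one>}" using that by blast
    have "\<gamma>3 \<subseteq> {\<one>}"
      using generate_subgroup_incl[OF triv triv_subgroup] by (simp add: \<gamma>3_eq)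
    then show False using \<gamma>3 subgroup.one_closed[OF subgroup_lower_central[of 2]] by blast
  qed
  then have xC: "x \<in> carrier G" using lower_central_in_carrier by blast
  define H where "H = generate G {x, y}"
  have H: "subgroup H G" unfolding H_def using xC xy by (intro generate_is_subgroup) auto
  have "H \<subset> carrier G"
    using generate_\<gamma>2_neq_carrier[OF \<gamma>3 xy(1,2)] subgroup.subset[OF H] by (auto simp: H_def)
  then have lt: "card H < p ^ 4"
    using psubset_card_mono[OF fin] ord by (simp add: order_def)
  obtain k where k: "card H = p ^ k" using card_subgroup_prime_power[OF p ord H] by blast
  then have "k \<le> 3" using lt p1 power_strict_increasing_iff[OF p1, of k 4] by simp
  then have card: "card H \<le> p ^ 3" using k p1 by (simp add: power_increasing_iff)
  show ?thesis
  proof (rule has_ImaxI[OF p ord H])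
    show "x \<in> H" "y \<in> H" by (auto simp: H_def intro: generate.incl)
    show "x \<otimes> y \<noteq> y \<otimes> x" using xy xC commutator_eq_one_iff by blast
    show "card H * p ^ 1 \<le> order G" using card p1 ord by (simp add: power_numeral_reduce)
  next
    fix K x y assume "subgroup K G" "x \<in> K" "y \<in> K" "x \<otimes> y \<noteq> y \<otimes> x"
    then have "p ^ 3 \<le> card K" by (rule card_nonabelian_subgroup_ge[OF p ord])
    then show "order G \<le> card K * p ^ 1" using p1 ord by (simp add: power_numeral_reduce)
  qed
qed

section \<open>Free groups and presentations\<close>

lemma words_append [simp]: "u @ v \<in> words S \<longleftrightarrow> u \<in> words S \<and> v \<in> words S"
  by (auto simp: words_def)

lemma words_Nil [simp]: "[] \<in> words S"
  by (simp add: words_def)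

lemma words_Cons [simp]: "x # u \<in> words S \<longleftrightarrow> fst x \<in> S \<and> u \<in> words S"
  by (cases x) (auto simp: words_def)

text \<open>The relation lives on all lists. A list with a letter outside \<open>S\<close> is
  related only to itself, so this does not affect the classes of words over
  \<open>S\<close>.\<close>

lemma equiv_free_eq: "equiv UNIV (free_eq S)"
  unfolding free_eq_def
  by (intro equivI refl_rtrancl sym_rtrancl trans_rtrancl sym_Un_converse) auto

lemma free_eq_refl [simp]: "(u, u) \<in> free_eq S"
  by (simp add: free_eq_def)

lemma free_eq_sym: "(u, v) \<in> free_eq S \<Longrightarrow> (v, u) \<in> free_eq S"
  using equiv_free_eq by (metis equiv_def symD)

lemma free_eq_trans: "(u, v) \<in> free_eq S \<Longrightarrow> (v, w) \<in> free_eq S \<Longrightarrow> (u, w) \<in> free_eq S"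
  using equiv_free_eq by (metis equiv_def transD)

lemma free_eq_words:
  assumes "(u, v) \<in> free_eq S"
  shows "u \<in> words S \<longleftrightarrow> v \<in> words S"
  using assms unfolding free_eq_def
  by (induction) (auto simp: cancellation_def)

lemma free_eq_append_aux:
  assumes "(u, v) \<in> free_eq S" "s \<in> words S" "t \<in> words S"
  shows "(s @ u @ t, s @ v @ t) \<in> free_eq S"
  using assms(1) unfolding free_eq_def
proof (induction)
  case (step v w)
  \<comment> \<open>A cancellation inside a context is again one: the context is absorbed into the
    words around the cancelled pair.\<close>
  have cl: "(s @ x @ t, s @ y @ t) \<in> cancellation S" if xy: "(x, y) \<in> cancellation S" for x y
  proof -
    obtain p a e q where "x = p @ [(a, e), (a, \<not> e)] @ q" "y = p @ q" "p \<in> words S" "q \<in> words S" "a \<in> S"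
      using xy unfolding cancellation_def by blast
    then show ?thesis
      unfolding cancellation_def using assms(2,3)
      by (intro CollectI exI[of _ "s @ p"] exI[of _ a] exI[of _ e] exI[of _ "q @ t"]) simp
  qed
  have "(s @ v @ t, s @ w @ t) \<in> cancellation S \<union> (cancellation S)\<inverse>"
    using step.hyps(2) cl by auto
  then show ?case using step.IH by (rule rtrancl_into_rtrancl[rotated])
qed auto

lemma free_eq_append:
  assumes "(u, u') \<in> free_eq S" "(v, v') \<in> free_eq S" "u \<in> words S" "v \<in> words S"
  shows "(u @ v, u' @ v') \<in> free_eq S"
proof -
  have "u' \<in> words S" using assms free_eq_words by blast
  then show ?thesis
    using free_eq_append_aux[OF assms(1), of "[]" v] free_eq_append_aux[OF assms(2), of u' "[]"] assms
    by (auto intro: free_eq_trans)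
qed

lemma free_class_eq_iff: "free_eq S `` {u} = free_eq S `` {v} \<longleftrightarrow> (u, v) \<in> free_eq S"
  using eq_equiv_class_iff[OF equiv_free_eq] by blast

lemma carrier_free_group: "carrier (free_group S) = (\<lambda>u. free_eq S `` {u}) ` words S"
  by (auto simp: free_group_def quotient_def)

lemma one_free_group: "\<one>\<^bsub>free_group S\<^esub> = free_eq S `` {[]}"
  by (simp add: free_group_def)

lemma mult_free_group:
  assumes "u \<in> words S" "v \<in> words S"
  shows "free_eq S `` {u} \<otimes>\<^bsub>free_group S\<^esub> free_eq S `` {v} = free_eq S `` {u @ v}"
proof -
  have "free_eq S `` {u' @ v'} = free_eq S `` {u @ v}"
    if "u' \<in> free_eq S `` {u}" "v' \<in> free_eq S `` {v}" for u' v'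
    using that assms free_eq_append[of u u' S v v'] free_class_eq_iff by (auto intro: free_eq_sym)
  moreover have "u \<in> free_eq S `` {u}" "v \<in> free_eq S `` {v}" by auto
  ultimately show ?thesis unfolding free_group_def monoid.simps by blast
qed

definition inv_letter :: "'x \<times> bool \<Rightarrow> 'x \<times> bool" where
  "inv_letter l = (fst l, \<not> snd l)"

lemma words_inverse: "u \<in> words S \<Longrightarrow> rev (map inv_letter u) \<in> words S"
  by (induction u) (auto simp: inv_letter_def)

lemma free_eq_inverse:
  "u \<in> words S \<Longrightarrow> (rev (map inv_letter u) @ u, []) \<in> free_eq S"
proof (induction u)
  case (Cons l u)
  have inv: "rev (map inv_letter u) \<in> words S"
    using Cons.prems by (simp add: words_inverse)
  \<comment> \<open>The pair that cancels is the innermost one, where the reversed inverse word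
    meets the word itself.\<close>
  have "(rev (map inv_letter u) @ [inv_letter l, l] @ u, rev (map inv_letter u) @ u) \<in> cancellation S"
    unfolding cancellation_def using Cons.prems inv
    by (intro CollectI exI[of _ "rev (map inv_letter u)"] exI[of _ "fst l"] exI[of _ "\<not> snd l"] exI[of _ u])
      (simp add: inv_letter_def)
  then have "(rev (map inv_letter (l # u)) @ l # u, rev (map inv_letter u) @ u) \<in> free_eq S"
    by (auto simp: free_eq_def)
  then show ?case using Cons by (auto intro: free_eq_trans)
qed auto

lemma group_free_group: "group (free_group S)"
proof (rule groupI)
  fix x assume "x \<in> carrier (free_group S)"
  then obtain u where u: "x = free_eq S `` {u}" "u \<in> words S" by (auto simp: carrier_free_group)
  have "rev (map inv_letter u) \<in> words S" using u by (simp add: words_inverse)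
  then show "\<exists>y\<in>carrier (free_group S). y \<otimes>\<^bsub>free_group S\<^esub> x = \<one>\<^bsub>free_group S\<^esub>"
    using u free_eq_inverse
    by (auto simp: carrier_free_group mult_free_group one_free_group free_class_eq_iff)
qed (auto simp: carrier_free_group mult_free_group one_free_group)

lemma free_gen_closed: "x \<in> S \<Longrightarrow> free_gen S x \<in> carrier (free_group S)"
  by (auto simp: free_gen_def carrier_free_group)

text \<open>Its purpose is that a subgroup of a presented group is everything as soon as it contains
  the images of the generators.\<close>

lemma generate_free_gen: "generate (free_group S) (free_gen S ` S) = carrier (free_group S)"
proof
  interpret F: group "free_group S" by (rule group_free_group)
  let ?H = "generate (free_group S) (free_gen S ` S)"
  have sub: "free_gen S ` S \<subseteq> carrier (free_group S)" using free_gen_closed by auto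
  then show "?H \<subseteq> carrier (free_group S)" by (rule F.generate_incl)
  interpret H: subgroup ?H "free_group S" using sub by (rule F.generate_is_subgroup)
  have letter: "free_eq S `` {[(x, e)]} \<in> ?H" if x: "x \<in> S" for x e
  proof (cases e)
    case True
    then show ?thesis using x by (auto intro!: generate.incl simp: free_gen_def)
  next
    case False
    have "free_eq S `` {[(x, False)]} \<otimes>\<^bsub>free_group S\<^esub> free_gen S x = \<one>\<^bsub>free_group S\<^esub>"
      using x free_eq_inverse[of "[(x, True)]" S]
      by (simp add: free_gen_def mult_free_group one_free_group free_class_eq_iff inv_letter_def)
    then have "inv\<^bsub>free_group S\<^esub> (free_gen S x) = free_eq S `` {[(x, False)]}"
      using x by (intro F.inv_equality) (auto simp: carrier_free_group free_gen_def)
    then show ?thesis using False x by (metis generate.inv imageI)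
  qed
  have "free_eq S `` {u} \<in> ?H" if "u \<in> words S" for u
    using that
  proof (induction u)
    case Nil
    then show ?case using H.one_closed by (simp add: one_free_group)
  next
    case (Cons l u)
    then have "free_eq S `` {l # u} = free_eq S `` {[l]} \<otimes>\<^bsub>free_group S\<^esub> free_eq S `` {u}"
      by (simp add: mult_free_group)
    then show ?case using Cons letter[of "fst l" "snd l"] by (simp add: H.m_closed)
  qed
  then show "carrier (free_group S) \<subseteq> ?H" by (auto simp: carrier_free_group)
qed

definition letter_value :: "('a, 'b) monoid_scheme \<Rightarrow> ('x \<Rightarrow> 'a) \<Rightarrow> 'x \<times> bool \<Rightarrow> 'a" where
  "letter_value L f l = (if snd l then f (fst l) else inv\<^bsub>L\<^esub> (f (fst l)))"

primrec word_value :: "('a, 'b) monoid_scheme \<Rightarrow> ('x \<Rightarrow> 'a) \<Rightarrow> 'x word \<Rightarrow> 'a" where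
  "word_value L f [] = \<one>\<^bsub>L\<^esub>"
| "word_value L f (l # u) = letter_value L f l \<otimes>\<^bsub>L\<^esub> word_value L f u"

text \<open>The existence half of the universal property. Evaluation of words is multiplicative and
  does not see cancellations, hence descends to classes.\<close>

lemma free_group_hom_exists:
  assumes "group L" and f: "\<And>x. x \<in> S \<Longrightarrow> f x \<in> carrier L"
  shows "\<exists>h. h \<in> hom (free_group S) L \<and> (\<forall>x\<in>S. h (free_gen S x) = f x)"
proof -
  interpret L: group L by fact
  let ?v = "word_value L f"
  have letter: "fst l \<in> S \<Longrightarrow> letter_value L f l \<in> carrier L" for l
    using f by (simp add: letter_value_def)
  have closed: "u \<in> words S \<Longrightarrow> ?v u \<in> carrier L" for u
    by (induction u) (auto simp: letter)
  have app: "u \<in> words S \<Longrightarrow> v \<in> words S \<Longrightarrow> ?v (u @ v) = ?v u \<otimes>\<^bsub>L\<^esub> ?v v" for u v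
    by (induction u) (auto simp: letter closed L.m_assoc)
  have canc: "?v u = ?v v" if "(u, v) \<in> cancellation S" for u v
  proof -
    obtain s x e t where uv: "u = s @ [(x, e), (x, \<not> e)] @ t" "v = s @ t"
        "s \<in> words S" "t \<in> words S" "x \<in> S"
      using \<open>(u, v) \<in> cancellation S\<close> by (auto simp: cancellation_def)
    then show ?thesis
      using f[of x] closed by (cases e) (auto simp: app letter_value_def L.inv_mult_cancel)
  qed
  have resp: "?v u = ?v v" if "(u, v) \<in> free_eq S" for u v
    using that unfolding free_eq_def by (induction) (auto simp: canc)
  \<comment> \<open>The chosen representative does not matter, by \<open>resp\<close>.\<close>
  define h where "h P = ?v (SOME u. u \<in> P)" for P
  have h: "h (free_eq S `` {u}) = ?v u" for u
  proof -
    have "u \<in> free_eq S `` {u}" by simp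
    then have "(SOME v. v \<in> free_eq S `` {u}) \<in> free_eq S `` {u}" by (rule someI)
    then show ?thesis unfolding h_def using resp by simp
  qed
  have "h \<in> hom (free_group S) L"
    by (rule homI) (auto simp: carrier_free_group h closed mult_free_group app)
  moreover have "h (free_gen S x) = f x" if "x \<in> S" for x
    using f[OF that] by (simp add: free_gen_def h letter_value_def)
  ultimately show ?thesis by blast
qed

section \<open>Normal closures and von Dyck's theorem\<close>

lemma (in group) normal_closure_normal:
  assumes "S \<subseteq> carrier G"
  shows "normal_closure G S \<lhd> G"
proof (rule normal_inv_iff[THEN iffD2], intro conjI ballI)
  \<comment> \<open>The family being intersected must be non-empty for the intersection to be a
    subgroup.\<close>
  have "carrier G \<in> {N. N \<lhd> G \<and> S \<subseteq> N}" using assms normal_self by simp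
  then show "subgroup (normal_closure G S) G"
    unfolding normal_closure_def by (intro subgroups_Inter) (auto simp: normal_imp_subgroup)
  fix x n assume "x \<in> carrier G" "n \<in> normal_closure G S"
  then show "x \<otimes> n \<otimes> inv x \<in> normal_closure G S"
    unfolding normal_closure_def using normal.inv_op_closed2 by fastforce
qed

lemma normal_closure_incl: "S \<subseteq> normal_closure G S"
  by (auto simp: normal_closure_def)

lemma normal_closure_minimal: "N \<lhd> G \<Longrightarrow> S \<subseteq> N \<Longrightarrow> normal_closure G S \<subseteq> N"
  by (auto simp: normal_closure_def)

text \<open>Von Dyck's theorem. The projection \<open>q\<close> is hidden behind an existential
  quantifier, so that later arguments rely on its properties and never on cosets.\<close>

lemma presented_group_hom_exists:
  fixes R S defines "F \<equiv> free_group S" and "G \<equiv> presented_group S R"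
  assumes "R \<subseteq> carrier (free_group S) \<times> carrier (free_group S)"
  shows "\<exists>q. group G \<and> q \<in> hom F G \<and> q ` carrier F = carrier G \<and> (\<forall>(u, v)\<in>R. q u = q v) \<and>
    (\<forall>h (L :: ('a, 'b) monoid_scheme). group L \<longrightarrow> h \<in> hom F L \<longrightarrow> (\<forall>(u, v)\<in>R. h u = h v) \<longrightarrow>
      (\<exists>g \<in> hom G L. \<forall>u \<in> carrier F. g (q u) = h u))"
proof -
  interpret F: group "free_group S" by (rule group_free_group)
  define T where "T = {u \<otimes>\<^bsub>free_group S\<^esub> inv\<^bsub>free_group S\<^esub> v | u v. (u, v) \<in> R}"
  define N where "N = normal_closure (free_group S) T"
  have R: "u \<in> carrier (free_group S) \<and> v \<in> carrier (free_group S)" if "(u, v) \<in> R" for u v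
    using assms(3) that by auto
  have T: "T \<subseteq> carrier (free_group S)" using R by (auto simp: T_def)
  have G: "G = free_group S Mod N"
    by (simp add: G_def presented_group_def N_def T_def)
  interpret N: normal N "free_group S"
    unfolding N_def by (rule F.normal_closure_normal[OF T])
  define q where "q u = N #>\<^bsub>free_group S\<^esub> u" for u
  show ?thesis
    unfolding F_def
  proof (intro exI[of _ q] conjI allI impI ballI)
    show "group G" unfolding G by (rule N.factorgroup_is_group)
    show "q \<in> hom (free_group S) G"
      unfolding G q_def by (rule N.r_coset_hom_Mod)
    show "q ` carrier (free_group S) = carrier G"
      unfolding G q_def by (auto simp: carrier_FactGroup)
    fix x assume "x \<in> R"
    then obtain u v where x: "x = (u, v)" and uv: "(u, v) \<in> R" by (cases x) auto
    from uv have "u \<otimes>\<^bsub>free_group S\<^esub> inv\<^bsub>free_group S\<^esub> v \<in> N"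
      unfolding N_def by (intro normal_closure_incl[THEN subsetD]) (auto simp: T_def)
    then have "u \<in> N #>\<^bsub>free_group S\<^esub> v"
      using R[OF uv] by (intro N.rcos_module_rev) auto
    then have "q u = q v"
      unfolding q_def using R[OF uv] by (metis F.repr_independence N.subgroup_axioms)
    then show "case x of (u, v) \<Rightarrow> q u = q v" by (simp add: x)
  next
    fix h and L :: "('a, 'b) monoid_scheme"
    assume "group L" and h: "h \<in> hom (free_group S) L" and hR: "\<forall>(u, v)\<in>R. h u = h v"
    interpret h: group_hom "free_group S" L h
      using \<open>group L\<close> h by (simp add: group_hom_def group_hom_axioms_def F.is_group)
    have "T \<subseteq> kernel (free_group S) L h"
      using R hR by (auto simp: T_def kernel_def)
    then have "N \<subseteq> kernel (free_group S) L h"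
      unfolding N_def using h.normal_kernel by (intro normal_closure_minimal)
    then have "h u = h v" if "u \<in> carrier (free_group S)" "v \<in> carrier (free_group S)" "q u = q v" for u v
    proof -
      have "u \<in> N #>\<^bsub>free_group S\<^esub> v"
        using that unfolding q_def by (metis F.rcos_self N.subgroup_axioms)
      then have "u \<otimes>\<^bsub>free_group S\<^esub> inv\<^bsub>free_group S\<^esub> v \<in> N"
        using that by (intro N.rcos_module_imp) auto
      then have "h (u \<otimes>\<^bsub>free_group S\<^esub> inv\<^bsub>free_group S\<^esub> v) = \<one>\<^bsub>L\<^esub>"
        using \<open>N \<subseteq> _\<close> by (auto simp: kernel_def)
      then have "h u \<otimes>\<^bsub>L\<^esub> inv\<^bsub>L\<^esub> (h v) = \<one>\<^bsub>L\<^esub>" using that by simp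
      then show ?thesis using that by (metis h.H.inv_equality h.H.inv_inv h.hom_closed h.H.inv_closed)
    qed
    then show "\<exists>g \<in> hom (G) L. \<forall>u \<in> carrier (free_group S). g (q u) = h u"
      using FactGroup_universal[OF h N.normal_axioms] unfolding G q_def by metis
  qed
qed

section \<open>A nilpotent group of class 3 on quadruples of integers\<close>

text \<open>The binomial coefficient i over 2, for all integers. It is the sum 0 + 1 + ... + (i - 1)
  of the powers of c met by the successive letters a when a^i is moved past b.\<close>

definition tri :: "int \<Rightarrow> int" where
  "tri i = i * (i - 1) div 2"

lemma two_tri: "2 * tri i = i * (i - 1)"
  by (simp add: tri_def)

lemma tri_0 [simp]: "tri 0 = 0" and tri_1 [simp]: "tri 1 = 0"
  by (simp_all add: tri_def)

lemma tri_add: "tri (i + j) = tri i + tri j + i * j"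
proof -
  have "2 * tri (i + j) = 2 * (tri i + tri j + i * j)"
    using two_tri[of i] two_tri[of j] two_tri[of "i + j"] by (simp add: algebra_simps)
  then show ?thesis by simp
qed

lemma tri_minus: "tri (- i) = i * i - tri i"
  using tri_add[of i "- i"] by simp

lemma tri_double: "tri (2 * i) = 2 * i * i - i"
  using two_tri[of "2 * i"] by (simp add: algebra_simps)

text \<open>For odd p the denominator 2 is invertible. For p = 2 it costs one factor 2, so
  divisibility by 4 is asked for: \<open>tri 2 = 1\<close> is odd.\<close>

lemma dvd_tri:
  assumes "prime (p::nat)" "int p dvd i" "p = 2 \<Longrightarrow> 4 dvd i"
  shows "int p dvd tri i"
proof (cases "p = 2")
  case True
  then obtain j where "i = 4 * j" using assms by auto
  then have "tri i = 2 * (j * (4 * j - 1))" using two_tri[of i] by simp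
  then show ?thesis using True by (metis dvd_triv_left of_nat_numeral)
next
  case False
  then have "coprime (int p) 2"
    using assms(1) by (simp add: prime_odd_nat prime_ge_2_nat coprime_commute odd_iff_mod_2_eq_one order_le_neq_trans)
  moreover have "int p dvd 2 * tri i" using assms(2) by (simp add: two_tri)
  ultimately show ?thesis by (simp add: coprime_dvd_mult_right_iff)
qed

text \<open>The tuple \<open>(i, j, k, l)\<close> stands for \<open>a^i b^j c^k z^l\<close>, where \<open>c = [a, b]\<close> commutes with \<open>b\<close> and
  \<open>z = [c, a]\<close> is central. Conjugation by \<open>a^i\<close> turns \<open>b\<close> into \<open>b c^(-i) z^(-tri i)\<close> and \<open>c\<close> into \<open>c z^i\<close>.\<close>

type_synonym quad = "int \<times> int \<times> int \<times> int"

fun quad_mult :: "quad \<Rightarrow> quad \<Rightarrow> quad" where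
  "quad_mult (i, j, k, l) (i', j', k', l') =
     (i + i', j + j', k + k' - j * i', l + l' + k * i' - j * tri i')"

definition nil4 :: "quad monoid" where
  "nil4 = \<lparr>carrier = UNIV, monoid.mult = quad_mult, one = (0, 0, 0, 0)\<rparr>"

lemma nil4_simps [simp]:
  "carrier nil4 = UNIV" "x \<otimes>\<^bsub>nil4\<^esub> y = quad_mult x y" "\<one>\<^bsub>nil4\<^esub> = (0, 0, 0, 0)"
  by (simp_all add: nil4_def)

lemma group_nil4: "group nil4"
proof (rule groupI)
  fix x :: quad
  obtain i j k l where x: "x = (i, j, k, l)" by (cases x) auto
  show "\<exists>y\<in>carrier nil4. y \<otimes>\<^bsub>nil4\<^esub> x = \<one>\<^bsub>nil4\<^esub>"
    unfolding x by (rule bexI[of _ "(- i, - j, - k - j * i, - l + k * i + j * i * i - j * tri i)"])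
      (auto simp: algebra_simps)
next
  fix x y z :: quad
  \<comment> \<open>In the last coordinate the failure of \<open>tri\<close> to be additive, a
    product of two first coordinates, is matched by the term -j * i' that the third coordinate has
    acquired.\<close>
  show "x \<otimes>\<^bsub>nil4\<^esub> y \<otimes>\<^bsub>nil4\<^esub> z = x \<otimes>\<^bsub>nil4\<^esub> (y \<otimes>\<^bsub>nil4\<^esub> z)"
    by (cases x; cases y; cases z) (auto simp: algebra_simps tri_add)
qed auto

interpretation nil4: group nil4 by (rule group_nil4)

lemma inv_nil4: "inv\<^bsub>nil4\<^esub> (i, j, k, l) = (- i, - j, - k - j * i, - l + k * i + j * i * i - j * tri i)"
  by (rule nil4.inv_equality) (auto simp: algebra_simps)

text \<open>The pair p = 2, r = 1 has to be excluded: if a^2 were a power of the central element z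
  and c^2 = 1, then conjugating b by a^2 would multiply it by z^(-1), hence z = 1.\<close>

locale nil4_params =
  fixes p r s :: nat and \<epsilon> \<delta> :: int
  assumes prime_p: "prime p" and r_pos: "r \<ge> 1" and s_pos: "s \<ge> 1" and r_2: "p = 2 \<Longrightarrow> r \<ge> 2"
begin

abbreviation "P \<equiv> int p"

lemma p_gt_1: "p > 1" using prime_p by (rule prime_gt_1_nat)

lemma prime_P: "prime P" using prime_p by simp

lemma P_dvd_Pr [simp]: "P dvd P ^ r" and P_dvd_Ps [simp]: "P dvd P ^ s"
  using r_pos s_pos by (simp_all add: dvd_power)

lemma dvd_tri_Pr [simp]: "P dvd tri (P ^ r * u)"
proof (rule dvd_tri[OF prime_p])
  show "P dvd P ^ r * u" by simp
  assume "p = 2"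
  then have "(2::int) ^ 2 dvd 2 ^ r" using r_2 by (intro le_imp_power_dvd) simp
  then show "4 dvd P ^ r * u" using \<open>p = 2\<close> by simp
qed

text \<open>The consequences of \<open>a^(p^r) = z^\<epsilon>\<close>, \<open>b^(p^s) = z^\<delta>\<close> and \<open>c^p = z^p = 1\<close>.\<close>

definition Ker :: "quad set" where
  "Ker = {(i, j, k, l). \<exists>u v. i = P ^ r * u \<and> j = P ^ s * v \<and> P dvd k \<and> P dvd \<epsilon> * u + \<delta> * v + l}"

lemma Ker_iff: "(i, j, k, l) \<in> Ker \<longleftrightarrow>
    (\<exists>u v. i = P ^ r * u \<and> j = P ^ s * v \<and> P dvd k \<and> P dvd \<epsilon> * u + \<delta> * v + l)"
  by (simp add: Ker_def)

lemma KerI: "P dvd k \<Longrightarrow> P dvd \<epsilon> * u + \<delta> * v + l \<Longrightarrow> (P ^ r * u, P ^ s * v, k, l) \<in> Ker"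
  unfolding Ker_iff by blast

lemma KerE:
  assumes "x \<in> Ker"
  obtains u v k l where "x = (P ^ r * u, P ^ s * v, k, l)" "P dvd k" "P dvd \<epsilon> * u + \<delta> * v + l"
  using assms unfolding Ker_def by blast

text \<open>Every correction term in a product, an inverse or a conjugate contains a factor P^r,
  P^s, an exponent of c divisible by P, or \<open>tri (P ^ r * u)\<close>, and so vanishes modulo P.
  What remains of the condition on \<epsilon> * u + \<delta> * v + l is additive.\<close>

lemma normal_Ker: "Ker \<lhd> nil4"
proof (rule nil4.normal_inv_iff[THEN iffD2], intro conjI ballI)
  show "subgroup Ker nil4"
  proof (rule nil4.subgroupI)
    show "Ker \<noteq> {}" using KerI[of 0 0 0 0] by auto
  next
    fix x assume "x \<in> Ker"
    then obtain u v k l where x: "x = (P ^ r * u, P ^ s * v, k, l)"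
        and d: "P dvd k" "P dvd \<epsilon> * u + \<delta> * v + l"
      by (rule KerE)
    have "(P ^ r * (- u), P ^ s * (- v), - k - P ^ s * v * (P ^ r * u),
        - l + k * (P ^ r * u) + P ^ s * v * (P ^ r * u) * (P ^ r * u) - P ^ s * v * tri (P ^ r * u)) \<in> Ker"
    proof (rule KerI)
      have "P dvd (- (\<epsilon> * u + \<delta> * v + l)) + (k * (P ^ r * u) + P ^ s * v * (P ^ r * u) * (P ^ r * u)
          - P ^ s * v * tri (P ^ r * u))"
        using d by (intro dvd_add[OF dvd_minus_iff[THEN iffD2, OF d(2)]] dvd_add dvd_diff) auto
      then show "P dvd \<epsilon> * (- u) + \<delta> * (- v) + (- l + k * (P ^ r * u) +
          P ^ s * v * (P ^ r * u) * (P ^ r * u) - P ^ s * v * tri (P ^ r * u))"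
        by (simp add: algebra_simps)
    qed (use d in auto)
    then show "inv\<^bsub>nil4\<^esub> x \<in> Ker" by (simp add: x inv_nil4)
  next
    fix x y assume "x \<in> Ker" "y \<in> Ker"
    then obtain u v k l u' v' k' l' where x: "x = (P ^ r * u, P ^ s * v, k, l)"
        and d: "P dvd k" "P dvd \<epsilon> * u + \<delta> * v + l"
        and y: "y = (P ^ r * u', P ^ s * v', k', l')"
        and d': "P dvd k'" "P dvd \<epsilon> * u' + \<delta> * v' + l'"
      by (metis KerE)
    have "(P ^ r * (u + u'), P ^ s * (v + v'), k + k' - P ^ s * v * (P ^ r * u'),
        l + l' + k * (P ^ r * u') - P ^ s * v * tri (P ^ r * u')) \<in> Ker"
    proof (rule KerI)
      have "P dvd (\<epsilon> * u + \<delta> * v + l) + (\<epsilon> * u' + \<delta> * v' + l') +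
          (k * (P ^ r * u') - P ^ s * v * tri (P ^ r * u'))"
        using d d' by (intro dvd_add[OF dvd_add[OF d(2) d'(2)]] dvd_diff) auto
      then show "P dvd \<epsilon> * (u + u') + \<delta> * (v + v') +
          (l + l' + k * (P ^ r * u') - P ^ s * v * tri (P ^ r * u'))"
        by (simp add: algebra_simps)
    qed (use d d' in auto)
    then show "x \<otimes>\<^bsub>nil4\<^esub> y \<in> Ker" by (simp add: x y algebra_simps)
  qed auto
next
  fix x n :: quad assume "n \<in> Ker"
  then obtain u v k' l' where n: "n = (P ^ r * u, P ^ s * v, k', l')"
      and d: "P dvd k'" "P dvd \<epsilon> * u + \<delta> * v + l'"
    by (rule KerE)
  obtain i j k l where x: "x = (i, j, k, l)" by (cases x) auto
  have "(P ^ r * u, P ^ s * v, k' - j * (P ^ r * u) + P ^ s * v * i,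
      l' + k * (P ^ r * u) - j * tri (P ^ r * u) - k' * i + j * (P ^ r * u) * i - P ^ s * v * (i * i - tri i)) \<in> Ker"
  proof (rule KerI)
    have "P dvd (\<epsilon> * u + \<delta> * v + l') + (k * (P ^ r * u) - j * tri (P ^ r * u) - k' * i
        + j * (P ^ r * u) * i - P ^ s * v * (i * i - tri i))"
      using d by (intro dvd_add[OF d(2)] dvd_add dvd_diff) auto
    then show "P dvd \<epsilon> * u + \<delta> * v + (l' + k * (P ^ r * u) - j * tri (P ^ r * u) - k' * i
        + j * (P ^ r * u) * i - P ^ s * v * (i * i - tri i))"
      by (simp add: algebra_simps)
  qed (use d in \<open>auto intro!: dvd_add dvd_diff\<close>)
  \<comment> \<open>The terms in i and j alone come from x and its inverse and cancel, because
    tri(-i) = i * i - tri i.\<close>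
  moreover have "j * i * i - j * tri i - j * (i * i - tri i) = 0" by (simp add: algebra_simps)
  ultimately show "x \<otimes>\<^bsub>nil4\<^esub> n \<otimes>\<^bsub>nil4\<^esub> inv\<^bsub>nil4\<^esub> x \<in> Ker"
    by (simp add: x n inv_nil4 tri_minus algebra_simps)
qed

end

text \<open>An arbitrary image with kernel \<open>Ker\<close> is considered, not just the factor
  group: the facts below are applied both to the factor group and to the presented groups.\<close>

locale nil4_image = nil4_params + group +
  fixes \<phi> :: "quad \<Rightarrow> 'a"
  assumes hom_\<phi>: "\<phi> \<in> hom nil4 G" and surj_\<phi>: "range \<phi> = carrier G"
    and ker_\<phi>: "\<phi> x = \<one> \<longleftrightarrow> x \<in> Ker"
begin

sublocale \<phi>: group_hom nil4 G \<phi>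
  using hom_\<phi> by (simp add: group_hom_def group_hom_axioms_def is_group group_nil4)

lemma \<phi>_closed [simp]: "\<phi> x \<in> carrier G"
  using \<phi>.hom_closed[of x] by simp

lemma \<phi>_mult: "\<phi> x \<otimes> \<phi> y = \<phi> (quad_mult x y)"
  using \<phi>.hom_mult[of x y] by simp

text \<open>The two images agree iff the quotient of the quadruples lies in \<open>Ker\<close>. Its
  last coordinates K and L contain mixed terms, but these are divisible by P once i - i' is a
  multiple of P^r, which leaves plain coordinate differences.\<close>

lemma \<phi>_eq_iff: "\<phi> (i, j, k, l) = \<phi> (i', j', k', l') \<longleftrightarrow>
    (\<exists>u v. i = i' + P ^ r * u \<and> j = j' + P ^ s * v \<and> P dvd k - k' \<and> P dvd \<epsilon> * u + \<delta> * v + (l - l'))"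
proof -
  define K where "K = k - k' + j' * (i - i')"
  define L where "L = l - l' - k' * (i - i') + j' * tri (i - i')"
  have "\<phi> (i, j, k, l) = \<phi> (i', j', k', l') \<longleftrightarrow> inv (\<phi> (i', j', k', l')) \<otimes> \<phi> (i, j, k, l) = \<one>"
    by (metis \<phi>_closed inv_closed inv_equality inv_inv l_inv)
  also have "\<dots> \<longleftrightarrow> quad_mult (inv\<^bsub>nil4\<^esub> (i', j', k', l')) (i, j, k, l) \<in> Ker"
    by (simp add: \<phi>.hom_inv[symmetric] \<phi>_mult ker_\<phi> del: \<phi>.hom_inv)
  also have "quad_mult (inv\<^bsub>nil4\<^esub> (i', j', k', l')) (i, j, k, l) = (i - i', j - j', K, L)"
  proof -
    have "j' * tri i = j' * (tri i' + tri (i - i') + i' * (i - i'))"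
      using tri_add[of i' "i - i'"] by simp
    then show ?thesis by (simp add: inv_nil4 K_def L_def algebra_simps)
  qed
  also have "\<dots> \<in> Ker \<longleftrightarrow> (\<exists>u v. i = i' + P ^ r * u \<and> j = j' + P ^ s * v \<and> P dvd K \<and>
      P dvd \<epsilon> * u + \<delta> * v + L)"
    unfolding Ker_iff by (intro iff_exI) (auto simp: algebra_simps)
  also have "\<dots> \<longleftrightarrow> (\<exists>u v. i = i' + P ^ r * u \<and> j = j' + P ^ s * v \<and> P dvd k - k' \<and>
      P dvd \<epsilon> * u + \<delta> * v + (l - l'))"
  proof (intro iff_exI conj_cong refl)
    fix u v assume i: "i = i' + P ^ r * u"
    show "P dvd K \<longleftrightarrow> P dvd k - k'"
      unfolding K_def i by (subst dvd_add_left_iff) auto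
    have "\<epsilon> * u + \<delta> * v + L = \<epsilon> * u + \<delta> * v + (l - l') + (j' * tri (P ^ r * u) - k' * (P ^ r * u))"
      by (simp add: L_def i)
    moreover have "P dvd j' * tri (P ^ r * u) - k' * (P ^ r * u)" by (intro dvd_diff) auto
    ultimately show "P dvd \<epsilon> * u + \<delta> * v + L \<longleftrightarrow> P dvd \<epsilon> * u + \<delta> * v + (l - l')"
      by (metis dvd_add_left_iff)
  qed
  finally show ?thesis .
qed

lemma \<phi>_eqI:
  "i = i' + P ^ r * u \<Longrightarrow> j = j' + P ^ s * v \<Longrightarrow> P dvd k - k' \<Longrightarrow> P dvd \<epsilon> * u + \<delta> * v + (l - l') \<Longrightarrow>
    \<phi> (i, j, k, l) = \<phi> (i', j', k', l')"
  unfolding \<phi>_eq_iff by blast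

lemma P_pos: "P > 0" "P ^ r > 0" "P ^ s > 0" using p_gt_1 by auto

text \<open>Addition with carry: the quotients of i by P^r and of j by P^s are carried over to the
  exponent of z, with weights \<epsilon> and \<delta>.\<close>

lemma \<phi>_reduce: "\<phi> (i, j, k, l) =
    \<phi> (i mod P ^ r, j mod P ^ s, k mod P, (l + \<epsilon> * (i div P ^ r) + \<delta> * (j div P ^ s)) mod P)"
  by (rule \<phi>_eqI[where u = "i div P ^ r" and v = "j div P ^ s"])
    (simp_all add: algebra_simps minus_mod_eq_mult_div[symmetric] mod_eq_dvd_iff[symmetric] mod_simps)


lemma card_box: "card ({0..<P ^ r} \<times> {0..<P ^ s} \<times> {0..<P} \<times> {0..<P}) = p ^ (r + s + 2)"
  by (simp add: card_cartesian_product power_add nat_power_eq power2_eq_square)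

lemma order_eq: "order G = p ^ (r + s + 2)"
proof -
  let ?B = "{0..<P ^ r} \<times> {0..<P ^ s} \<times> {0..<P} \<times> {0..<P}"
  have "inj_on \<phi> ?B"
  proof (rule inj_onI)
    fix x y assume xy: "x \<in> ?B" "y \<in> ?B" "\<phi> x = \<phi> y"
    obtain i j k l i' j' k' l' where x: "x = (i, j, k, l)" and y: "y = (i', j', k', l')"
      by (cases x; cases y) auto
    obtain u v where uv: "i = i' + P ^ r * u" "j = j' + P ^ s * v" "P dvd k - k'"
        "P dvd \<epsilon> * u + \<delta> * v + (l - l')"
      using xy(3) unfolding x y \<phi>_eq_iff by blast
    have "i mod P ^ r = i' mod P ^ r" "j mod P ^ s = j' mod P ^ s" using uv by simp_all
    then have "i = i'" "j = j'" using xy(1,2) by (simp_all add: x y)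
    then have "u = 0" "v = 0" using uv p_gt_1 by simp_all
    then have "k mod P = k' mod P" "l mod P = l' mod P" using uv by (simp_all add: mod_eq_dvd_iff)
    then show "x = y" using xy(1,2) \<open>i = i'\<close> \<open>j = j'\<close> by (simp add: x y)
  qed
  moreover have "carrier G = \<phi> ` ?B"
  proof -
    have "\<phi> x \<in> \<phi> ` ?B" for x
    proof (cases x)
      case (fields i j k l)
      have "(i mod P ^ r, j mod P ^ s, k mod P, (l + \<epsilon> * (i div P ^ r) + \<delta> * (j div P ^ s)) mod P) \<in> ?B"
        using P_pos by simp
      then show ?thesis unfolding fields \<phi>_reduce[of i] by (rule imageI)
    qed
    then show ?thesis unfolding surj_\<phi>[symmetric] by blast
  qed
  ultimately show ?thesis using card_box by (simp add: order_def card_image)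
qed

section \<open>Powers and lower bounds for non-abelian subgroups\<close>

lemma finite_carrier: "finite (carrier G)"
  using order_eq p_gt_1 order_gt_0_iff_finite by simp

lemma finite_subgroup: "subgroup H G \<Longrightarrow> finite H"
  using finite_carrier finite_subset subgroup.subset by blast

text \<open>Only the exponents of a and b behave linearly, and only they matter later; the other two
  are left unspecified.\<close>

lemma \<phi>_nat_pow: "\<exists>k' l'. \<phi> (i, j, k, l) [^] (t::nat) = \<phi> (int t * i, int t * j, k', l')"
proof (induction t)
  case 0
  show ?case using \<phi>.hom_one by (intro exI[of _ 0]) simp
next
  case (Suc t)
  then obtain k' l' where "\<phi> (i, j, k, l) [^] t = \<phi> (int t * i, int t * j, k', l')" by blast
  then show ?case by (auto simp: \<phi>_mult algebra_simps)
qed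

lemma \<phi>_nat_pow_0: "\<phi> (0, j, k, l) [^] (t::nat) = \<phi> (0, int t * j, int t * k, int t * l)"
proof (induction t)
  case 0
  show ?case using \<phi>.hom_one by simp
qed (simp add: \<phi>_mult algebra_simps)

lemma \<phi>_int_pow: "\<exists>k' l'. \<phi> (i, j, k, l) [^] (t::int) = \<phi> (t * i, t * j, k', l')"
proof (cases t rule: int_cases2)
  case (nonneg n)
  then show ?thesis using \<phi>_nat_pow[of i j k l n] by (simp add: int_pow_int)
next
  case (nonpos n)
  obtain k' l' where "\<phi> (i, j, k, l) [^] n = \<phi> (int n * i, int n * j, k', l')"
    using \<phi>_nat_pow by blast
  then have "\<phi> (i, j, k, l) [^] t = \<phi> (inv\<^bsub>nil4\<^esub> (int n * i, int n * j, k', l'))"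
    using nonpos by (simp add: int_pow_neg_int \<phi>.hom_inv)
  then show ?thesis unfolding inv_nil4 nonpos by auto
qed

text \<open>If \<open>H\<close> is not contained in the centralizer of \<open>c\<close>, then \<open>H\<close> contains \<open>z\<close> and an element of
  \<open>\<langle>b, c, z\<rangle>\<close> outside \<open>\<langle>b, z\<rangle>\<close>.\<close>

lemma nonabelian_elements:
  assumes H: "subgroup H G" and x: "x = \<phi> (i, j, k, l)" "x \<in> H" "\<not> P dvd i"
    and y: "y \<in> H" "x \<otimes> y \<noteq> y \<otimes> x"
  obtains j' k' l' \<eta> where "\<phi> (0, j', k', l') \<in> H" "\<not> P dvd k'" "\<phi> (0, 0, 0, \<eta>) \<in> H" "\<not> P dvd \<eta>"
proof -
  interpret H: subgroup H G by fact
  have xC: "x \<in> carrier G" "y \<in> carrier G" using x y by auto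
  then obtain i2 j2 k2 l2 where y2: "y = \<phi> (i2, j2, k2, l2)"
    using surj_\<phi> by (metis prod_cases4 rangeE)
  have "coprime P i" using x(3) prime_P by (intro prime_imp_coprime)
  then have "coprime i (P ^ r)" by (simp add: coprime_commute)
  then obtain t0 where "[i * t0 = 1] (mod P ^ r)" using cong_solve_coprime_int by blast
  then have t0: "P ^ r dvd i * t0 - 1" by (simp add: cong_iff_dvd_diff)
  \<comment> \<open>The power of x that cancels the exponent of a in y modulo P^r, since t0 inverts
    i there. Reduction modulo P^r makes the number non-negative, so \<open>nat\<close> changes
    nothing.\<close>
  define t where "t = nat ((- i2 * t0) mod P ^ r)"
  have "P ^ r dvd int t - (- i2 * t0)"
    unfolding mod_eq_dvd_iff[symmetric] using P_pos by (simp add: t_def)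
  then have "P ^ r dvd (int t - (- i2 * t0)) * i + (- i2) * (i * t0 - 1)"
    using t0 by (intro dvd_add dvd_mult dvd_mult2)
  then have "P ^ r dvd i2 + int t * i" by (simp add: algebra_simps)
  then obtain u where u: "i2 + int t * i = P ^ r * u" by blast
  obtain e f where ef: "x [^] t = \<phi> (int t * i, int t * j, e, f)"
    using \<phi>_nat_pow x by blast
  define y1 where "y1 = y \<otimes> x [^] t"
  have "\<exists>k l. y1 = \<phi> (P ^ r * u, j2 + int t * j, k, l)"
    unfolding y1_def y2 ef \<phi>_mult by (auto simp: u)
  then obtain k1 l0 where "y1 = \<phi> (P ^ r * u, j2 + int t * j, k1, l0)" by blast
  also have "\<dots> = \<phi> (0, j2 + int t * j, k1, l0 + \<epsilon> * u)"
    by (rule \<phi>_eqI[where u = u and v = 0]) auto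
  finally obtain j1 l1 where y1: "y1 = \<phi> (0, j1, k1, l1)" by blast
  have y1H: "y1 \<in> H" unfolding y1_def using x y H.m_closed
    by (metis H nat_pow_0 group.subgroup_self subgroup_int_pow_closed int_pow_int)
  have nc: "y1 \<otimes> x \<noteq> x \<otimes> y1"
  proof
    assume eq: "y1 \<otimes> x = x \<otimes> y1"
    have "y \<otimes> x \<otimes> x [^] t = y1 \<otimes> x"
      unfolding y1_def using xC by (simp add: m_assoc nat_pow_Suc2[symmetric])
    also have "\<dots> = x \<otimes> y \<otimes> x [^] t" unfolding eq using xC by (simp add: y1_def m_assoc)
    finally show False using xC y(2) by simp
  qed
  \<comment> \<open>The exponents of c and z in the commutator [y1, x].\<close>
  define \<kappa> where "\<kappa> = - j1 * i"
  define \<mu> where "\<mu> = k1 * i - j1 * tri i"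
  define w where "w = \<phi> (0, 0, \<kappa>, \<mu>)"
  have w: "y1 \<otimes> x = x \<otimes> y1 \<otimes> w"
    unfolding y1 x w_def \<kappa>_def \<mu>_def by (simp add: \<phi>_mult algebra_simps)
  have wH: "w \<in> H"
  proof -
    have "w = inv (x \<otimes> y1) \<otimes> (y1 \<otimes> x)"
      unfolding w using xC y1 by (simp add: w_def inv_mult_cancel m_assoc inv_mult_group)
    then show ?thesis using x y1H by simp
  qed
  have w1: "w \<noteq> \<one>" using w nc xC y1 by auto
  \<comment> \<open>If P does not divide j1, then w itself has an exponent of c prime to p, and
    [w, x] is the power of z wanted. Otherwise w is a non-trivial power of z, which forces P not to
    divide k1, so y1 is the element wanted.\<close>
  show thesis
  proof (cases "P dvd j1")
    case False
    then have \<kappa>: "\<not> P dvd \<kappa>" using x(3) prime_P by (simp add: \<kappa>_def prime_dvd_mult_iff)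
    have eq: "w \<otimes> x = x \<otimes> w \<otimes> \<phi> (0, 0, 0, \<kappa> * i)"
      unfolding x w_def by (simp add: \<phi>_mult algebra_simps)
    have "\<phi> (0, 0, 0, \<kappa> * i) = inv (x \<otimes> w) \<otimes> (w \<otimes> x)"
      unfolding eq using xC by (simp add: w_def inv_mult_cancel m_assoc inv_mult_group)
    then have "\<phi> (0, 0, 0, \<kappa> * i) \<in> H" using x wH by simp
    then show thesis
      using that[of 0 \<kappa> \<mu> "\<kappa> * i"] wH \<kappa> x(3) prime_P by (simp add: w_def prime_dvd_mult_iff)
  next
    case True
    have w': "w = \<phi> (0, 0, 0, \<mu>)"
      unfolding w_def by (rule \<phi>_eqI[where u = 0 and v = 0]) (use True in \<open>auto simp: \<kappa>_def\<close>)
    have \<mu>: "\<not> P dvd \<mu>"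
    proof
      assume "P dvd \<mu>"
      then have "(P ^ r * 0, P ^ s * 0, 0, \<mu>) \<in> Ker" by (intro KerI) auto
      then show False using w1 w' ker_\<phi> by simp
    qed
    have "\<not> P dvd k1"
    proof
      assume "P dvd k1"
      then have "P dvd \<mu>" using True by (auto simp: \<mu>_def intro!: dvd_diff)
      then show False using \<mu> by simp
    qed
    then show thesis using that[of j1 k1 l1 \<mu>] y1H wH w' \<mu> y1 by simp
  qed
qed

lemma eq_of_dvd_mult_diff:
  assumes "P dvd int V * k - int V' * k" "\<not> P dvd k" "V < p" "V' < p"
  shows "V = V'"
proof -
  have "P dvd (int V - int V') * k" using assms(1) by (simp add: algebra_simps)
  then have "P dvd int V - int V'" using assms(2) prime_P by (simp add: prime_dvd_mult_iff)
  then have "int V mod P = int V' mod P" by (simp add: mod_eq_dvd_iff)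
  then show ?thesis using assms(3,4) by simp
qed

text \<open>The products x^U g^V h^W with U < p^r and V, W < p are pairwise distinct, where g and h
  are the two elements from \<open>nonabelian_elements\<close>: U is read off from the exponent of
  a, as i is a unit modulo P^r, then V from that of c and W from that of z.\<close>

lemma card_nonabelian_ge:
  assumes H: "subgroup H G" and x: "x = \<phi> (i, j, k, l)" "x \<in> H" "\<not> P dvd i"
    and y: "y \<in> H" "x \<otimes> y \<noteq> y \<otimes> x"
  shows "p ^ (r + 2) \<le> card H"
proof -
  interpret H: subgroup H G by fact
  obtain j' k' l' \<eta> where g: "\<phi> (0, j', k', l') \<in> H" "\<not> P dvd k'" "\<phi> (0, 0, 0, \<eta>) \<in> H" "\<not> P dvd \<eta>"
    using nonabelian_elements[OF assms] by blast
  define f where "f = (\<lambda>(U, V, W). x [^] (U::nat) \<otimes>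
    (\<phi> (0, j', k', l') [^] (V::nat) \<otimes> \<phi> (0, 0, 0, \<eta>) [^] (W::nat)))"
  let ?B = "{..<p ^ r} \<times> {..<p} \<times> {..<p}"
  have pow: "h [^] (t::nat) \<in> H" if "h \<in> H" for h t
    using subgroup_int_pow_closed[OF H that, of "int t"] by (simp add: int_pow_int)
  have "inj_on f ?B"
  proof (rule inj_onI)
    fix A A' assume A: "A \<in> ?B" "A' \<in> ?B" and eq: "f A = f A'"
    obtain U V W U' V' W' where A': "A = (U, V, W)" "A' = (U', V', W')" by (cases A; cases A') auto
    have f: "f (U, V, W) = x [^] U \<otimes> \<phi> (0, int V * j', int V * k', int V * l' + int W * \<eta>)" for U V W
      by (simp add: f_def \<phi>_nat_pow_0 \<phi>_mult)
    obtain a b a' b' where ab: "x [^] U = \<phi> (int U * i, int U * j, a, b)"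
        "x [^] U' = \<phi> (int U' * i, int U' * j, a', b')"
      using \<phi>_nat_pow x by metis
    have "\<exists>u. int U * i = int U' * i + P ^ r * u"
      using eq unfolding A' f ab \<phi>_mult by (auto simp: \<phi>_eq_iff)
    then have "P ^ r dvd (int U - int U') * i" by (auto simp: algebra_simps)
    moreover have "coprime (P ^ r) i" using x(3) prime_P by (simp add: prime_imp_coprime)
    ultimately have "int U mod P ^ r = int U' mod P ^ r"
      by (simp add: coprime_dvd_mult_left_iff mod_eq_dvd_iff)
    moreover have "int U < P ^ r" "int U' < P ^ r"
      using A by (simp_all add: A' flip: of_nat_power)
    ultimately have U: "U = U'" by simp
    have "\<phi> (0, int V * j', int V * k', int V * l' + int W * \<eta>) =
        \<phi> (0, int V' * j', int V' * k', int V' * l' + int W' * \<eta>)"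
      using eq x unfolding A' f U by simp
    then obtain u v where uv: "0 = P ^ r * u" "int V * j' = int V' * j' + P ^ s * v"
        "P dvd int V * k' - int V' * k'"
        "P dvd \<epsilon> * u + \<delta> * v + (int V * l' + int W * \<eta> - (int V' * l' + int W' * \<eta>))"
      by (auto simp: \<phi>_eq_iff)
    have V: "V = V'" using eq_of_dvd_mult_diff[OF uv(3) g(2)] A by (simp add: A')
    \<comment> \<open>Once V = V', no carry from a or b reaches the exponent of z.\<close>
    then have "u = 0" "v = 0" using uv p_gt_1 by simp_all
    then have "P dvd int W * \<eta> - int W' * \<eta>" using uv(4) V by simp
    then have "W = W'" using eq_of_dvd_mult_diff[OF _ g(4)] A by (simp add: A')
    then show "A = A'" using U V by (simp add: A')
  qed
  moreover have "f ` ?B \<subseteq> H" using g x pow by (auto simp: f_def)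
  ultimately have "card ?B \<le> card H"
    using finite_subgroup[OF H] by (intro card_inj_on_le) auto
  then show ?thesis
    by (simp add: card_cartesian_product power_add power2_eq_square mult.commute mult.left_commute)
qed


text \<open>The centralizer of \<open>c\<close> is abelian for odd \<open>p\<close>. For \<open>p = 2\<close> it is not, as \<open>[a\<^sup>2, b] = z\<close>; the
  determinant of the exponents modulo \<open>z, c\<close> decides whether two of its elements commute.\<close>

lemma centralizer_nonabelian:
  assumes H: "subgroup H G"
    and x: "\<phi> (P * i, j, k, l) \<in> H" and y: "\<phi> (P * i', j', k', l') \<in> H"
    and nc: "\<phi> (P * i, j, k, l) \<otimes> \<phi> (P * i', j', k', l') \<noteq> \<phi> (P * i', j', k', l') \<otimes> \<phi> (P * i, j, k, l)"
  shows "p = 2 \<and> odd (i * j' - i' * j) \<and> \<phi> (0, 0, 0, 1) \<in> H"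
proof -
  interpret H: subgroup H G by fact
  let ?x = "\<phi> (P * i, j, k, l)" and ?y = "\<phi> (P * i', j', k', l')"
  \<comment> \<open>The exponents of z and c in the commutator of the two elements.\<close>
  define D where "D = k * (P * i') - j * tri (P * i') - (k' * (P * i) - j' * tri (P * i))"
  define E where "E = - j * (P * i') - (- j' * (P * i))"
  have w: "?x \<otimes> ?y = ?y \<otimes> ?x \<otimes> \<phi> (0, 0, E, D)"
    by (simp add: \<phi>_mult D_def E_def algebra_simps)
  have "P dvd E" by (simp add: E_def)
  then have ED: "\<phi> (0, 0, E, D) = \<phi> (0, 0, 0, D + P * t)" for t
    by (intro \<phi>_eqI[where u = 0 and v = 0]) auto
  have nD: "\<not> P dvd D"
  proof
    assume "P dvd D"
    then have "(P ^ r * 0, P ^ s * 0, 0, D) \<in> Ker" by (intro KerI) auto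
    then have "\<phi> (0, 0, E, D) = \<one>" using ED[of 0] by (simp add: ker_\<phi>)
    then show False using nc w by simp
  qed
  have p2: "p = 2"
  proof (rule ccontr)
    assume "p \<noteq> 2"
    then have "P dvd tri (P * t)" for t by (intro dvd_tri prime_p) auto
    then have "P dvd D" unfolding D_def by (intro dvd_diff) auto
    then show False using nD by simp
  qed
  \<comment> \<open>As tri(2i) = 2 * i * i - i, the only part of D that survives modulo 2 is the
    determinant.\<close>
  have D: "D = 2 * (k * i' - k' * i - j * (i' * i') + j' * (i * i)) + (i' * j - i * j')"
    by (simp only: D_def p2 tri_double of_nat_numeral) (simp add: algebra_simps)
  have odd: "odd (i * j' - i' * j)" using nD unfolding D p2 by simp
  have "odd D" using nD p2 by simp
  then obtain t where "D = 2 * t + 1" by (rule oddE)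
  then have "\<phi> (0, 0, E, D) = \<phi> (0, 0, 0, 1)" using ED[of "- t"] p2 by simp
  moreover have "\<phi> (0, 0, E, D) \<in> H"
  proof -
    have "\<phi> (0, 0, E, D) = inv (?y \<otimes> ?x) \<otimes> (?x \<otimes> ?y)"
      unfolding w by (simp add: inv_mult_cancel m_assoc inv_mult_group)
    then show ?thesis using x y by simp
  qed
  ultimately show ?thesis using p2 odd by simp
qed

text \<open>An odd determinant is invertible modulo any power of 2, so the two elements realize all
  pairs of exponents (2U, V) in \<open>H\<close>. This gives 2^(r-1) * 2^s elements modulo c and z,
  and z doubles the number. The modulus 2^(r+s) is a common multiple of 2^r and 2^s, so one inverse
  serves both coordinates.\<close>

lemma card_centralizer_nonabelian_ge:
  assumes H: "subgroup H G"
    and x: "\<phi> (P * i, j, k, l) \<in> H" and y: "\<phi> (P * i', j', k', l') \<in> H"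
    and nc: "\<phi> (P * i, j, k, l) \<otimes> \<phi> (P * i', j', k', l') \<noteq> \<phi> (P * i', j', k', l') \<otimes> \<phi> (P * i, j, k, l)"
  shows "p ^ (r + s) \<le> card H"
proof -
  interpret H: subgroup H G by fact
  define \<Delta> where "\<Delta> = i * j' - i' * j"
  have p2: "p = 2" and odd: "odd \<Delta>" and z: "\<phi> (0, 0, 0, 1) \<in> H"
    using centralizer_nonabelian[OF assms] by (auto simp: \<Delta>_def)
  have "coprime \<Delta> (2 ^ (r + s))" using odd by (simp add: coprime_commute)
  then obtain d where "[\<Delta> * d = 1] (mod 2 ^ (r + s))" using cong_solve_coprime_int by blast
  then obtain e where e: "\<Delta> * d = 1 + 2 ^ (r + s) * e" by (metis cong_iff_lin cong_sym)
  have "\<exists>h\<in>H. \<exists>u v k l. h = \<phi> (2 * (U + 2 ^ (r + s) * u), V + 2 ^ (r + s) * v, k, l)" for U V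
  proof -
    \<comment> \<open>Cramer's rule for u * (i, j) + v * (i', j') = (U, V), with d in place of the
      reciprocal of the determinant.\<close>
    define u where "u = d * (U * j' - V * i')"
    define v where "v = d * (V * i - U * j)"
    obtain k1 l1 where 1: "\<phi> (P * i, j, k, l) [^] u = \<phi> (u * (P * i), u * j, k1, l1)"
      using \<phi>_int_pow by blast
    obtain k2 l2 where 2: "\<phi> (P * i', j', k', l') [^] v = \<phi> (v * (P * i'), v * j', k2, l2)"
      using \<phi>_int_pow by blast
    have "u * (P * i) + v * (P * i') = 2 * (U * (\<Delta> * d))" "u * j + v * j' = V * (\<Delta> * d)"
      by (simp_all add: p2 u_def v_def \<Delta>_def algebra_simps)
    then have "u * (P * i) + v * (P * i') = 2 * (U + 2 ^ (r + s) * (U * e))"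
        "u * j + v * j' = V + 2 ^ (r + s) * (V * e)"
      by (simp_all add: e algebra_simps)
    then have "\<phi> (P * i, j, k, l) [^] u \<otimes> \<phi> (P * i', j', k', l') [^] v \<in>
        {\<phi> (2 * (U + 2 ^ (r + s) * u), V + 2 ^ (r + s) * v, k, l) | u v k l. True}"
      unfolding 1 2 \<phi>_mult by auto
    moreover have "\<phi> (P * i, j, k, l) [^] u \<otimes> \<phi> (P * i', j', k', l') [^] v \<in> H"
      using x y by (intro H.m_closed subgroup_int_pow_closed[OF H])
    ultimately show ?thesis by blast
  qed
  then obtain h where h: "\<And>U V. h U V \<in> H"
      "\<And>U V. \<exists>u v k l. h U V = \<phi> (2 * (U + 2 ^ (r + s) * u), V + 2 ^ (r + s) * v, k, l)"
    by metis
  define f where "f = (\<lambda>(U, V, W). h U V \<otimes> \<phi> (0, 0, 0, W))"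
  let ?B = "{0..<2 ^ (r - 1) :: int} \<times> {0..<2 ^ s :: int} \<times> {0..<2::int}"
  have zW: "\<phi> (0, 0, 0, W) \<in> H" if "W \<in> {0..<2}" for W
  proof -
    have "W = 0 \<or> W = 1" using that by auto
    then show ?thesis using z \<phi>.hom_one H.one_closed by auto
  qed
  have 2: "(2::int) ^ r = 2 * 2 ^ (r - 1)" using r_pos by (simp flip: power_Suc)
  have "inj_on f ?B"
  proof (rule inj_onI)
    fix A A' assume A: "A \<in> ?B" "A' \<in> ?B" and eq: "f A = f A'"
    obtain U V W U' V' W' where A': "A = (U, V, W)" "A' = (U', V', W')" by (cases A; cases A') auto
    obtain u v k l where "h U V = \<phi> (2 * (U + 2 ^ (r + s) * u), V + 2 ^ (r + s) * v, k, l)"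
      using h(2) by blast
    moreover obtain u' v' k' l' where
      "h U' V' = \<phi> (2 * (U' + 2 ^ (r + s) * u'), V' + 2 ^ (r + s) * v', k', l')"
      using h(2) by blast
    ultimately obtain a b where
        a: "2 * (U + 2 ^ (r + s) * u) = 2 * (U' + 2 ^ (r + s) * u') + P ^ r * a" and
        b: "V + 2 ^ (r + s) * v = V' + 2 ^ (r + s) * v' + P ^ s * b"
      using eq unfolding A' f_def by (auto simp: \<phi>_mult \<phi>_eq_iff)
    have "U - U' = 2 ^ (r - 1) * (2 * 2 ^ s * (u' - u) + a)"
      using a unfolding p2 power_add of_nat_numeral 2 by (simp add: algebra_simps)
    then have "2 ^ (r - 1) dvd U - U'" by simp
    then have U: "U = U'" using A by (simp add: A' mod_eq_dvd_iff[symmetric])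
    have "V - V' = 2 ^ s * (2 ^ r * (v' - v) + b)"
      using b unfolding p2 power_add of_nat_numeral by (simp add: algebra_simps)
    then have "2 ^ s dvd V - V'" by simp
    then have V: "V = V'" using A by (simp add: A' mod_eq_dvd_iff[symmetric])
    have "h U V \<in> carrier G" using h(1) by auto
    then have "\<phi> (0, 0, 0, W) = \<phi> (0, 0, 0, W')" using eq unfolding A' f_def U V by simp
    then have "2 dvd W - W'" using p_gt_1 by (auto simp: \<phi>_eq_iff p2)
    then have "W = W'" using A by (simp add: A' mod_eq_dvd_iff[symmetric])
    then show "A = A'" using U V by (simp add: A')
  qed
  moreover have "f ` ?B \<subseteq> H" using h(1) zW by (auto simp: f_def)
  ultimately have "card ?B \<le> card H"
    using finite_subgroup[OF H] by (intro card_inj_on_le) auto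
  moreover have "card ?B = 2 ^ (r - 1) * (2 ^ s * 2)" by (simp add: card_cartesian_product nat_power_eq)
  moreover have "\<dots> = p ^ (r + s)" using r_pos by (cases r) (simp_all add: p2 power_add)
  ultimately show ?thesis by simp
qed

text \<open>The case distinction is whether x or y has an exponent of a prime to p; if neither has,
  both centralize c.\<close>

lemma card_nonabelian_cases:
  assumes H: "subgroup H G" "x \<in> H" "y \<in> H" "x \<otimes> y \<noteq> y \<otimes> x"
  shows "p ^ (r + 2) \<le> card H \<or> p = 2 \<and> p ^ (r + s) \<le> card H"
proof (cases "\<exists>i j k l. \<phi> (i, j, k, l) \<in> {x, y} \<and> \<not> P dvd i")
  case True
  then obtain i j k l where "\<phi> (i, j, k, l) \<in> {x, y}" "\<not> P dvd i" by blast
  then show ?thesis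
    using card_nonabelian_ge[OF H(1) refl, of i j k l x] card_nonabelian_ge[OF H(1) refl, of i j k l y] H
    by auto
next
  case False
  have "x \<in> range \<phi>" "y \<in> range \<phi>" using H subgroup.mem_carrier surj_\<phi> by fastforce+
  then obtain i j k l i' j' k' l' where xy: "x = \<phi> (i, j, k, l)" "y = \<phi> (i', j', k', l')" by auto
  then obtain m m' where "i = P * m" "i' = P * m'" using False by blast
  then show ?thesis
    using xy H centralizer_nonabelian[OF H(1), of m j k l m' j' k' l']
      card_centralizer_nonabelian_ge[OF H(1), of m j k l m' j' k' l'] by simp
qed

section \<open>Non-abelian subgroups of least order\<close>

lemma card_\<phi>_image_le:
  assumes "finite B" "\<And>i j k l. (i, j, k, l) \<in> X \<Longrightarrow>
    (i mod P ^ r, j mod P ^ s, k mod P, (l + \<epsilon> * (i div P ^ r) + \<delta> * (j div P ^ s)) mod P) \<in> B"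
  shows "card (\<phi> ` X) \<le> card B"
proof -
  have "\<phi> x \<in> \<phi> ` B" if "x \<in> X" for x
  proof (cases x)
    case (fields i j k l)
    then show ?thesis using assms(2)[of i j k l] \<phi>_reduce[of i j k l] that by (metis imageI)
  qed
  then have "\<phi> ` X \<subseteq> \<phi> ` B" by blast
  then show ?thesis using assms(1) by (meson card_image_le card_mono finite_imageI order_trans)
qed

lemma subgroup_\<phi>_image: "subgroup X nil4 \<Longrightarrow> subgroup (\<phi> ` X) G"
  by (rule \<phi>.subgroup_img_is_subgroup)

text \<open>Here \<open>\<langle>a, c\<rangle>\<close> is a non-abelian subgroup of least order.\<close>

lemma has_Imax_s:
  assumes "p = 2 \<Longrightarrow> s \<ge> 2"
  shows "has_Imax p G s"
proof -
  define X :: "quad set" where "X = {(i, j, k, l). j = 0}"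
  have X: "subgroup X nil4"
    by (rule nil4.subgroupI) (auto simp: X_def inv_nil4)
  have ne: "\<phi> (0, 0, 1, 0) \<otimes> \<phi> (1, 0, 0, 0) \<noteq> \<phi> (1, 0, 0, 0) \<otimes> \<phi> (0, 0, 1, 0)"
    using p_gt_1 by (auto simp: \<phi>_mult \<phi>_eq_iff)
  have "card (\<phi> ` X) \<le> card ({0..<P ^ r} \<times> {0::int} \<times> {0..<P} \<times> {0..<P})"
    using P_pos by (intro card_\<phi>_image_le) (auto simp: X_def)
  also have "\<dots> = p ^ (r + 2)"
    by (simp add: card_cartesian_product power_add nat_power_eq power2_eq_square)
  finally have card: "card (\<phi> ` X) * p ^ s \<le> p ^ (r + 2) * p ^ s" by (intro mult_right_mono) auto
  show ?thesis
  proof (rule has_ImaxI[OF prime_p order_eq subgroup_\<phi>_image[OF X] _ _ ne])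
    show "card (\<phi> ` X) * p ^ s \<le> order G" using card by (simp add: order_eq power_add mult_ac)
    fix K x y assume K: "subgroup K G" "x \<in> K" "y \<in> K" "x \<otimes> y \<noteq> y \<otimes> x"
    have "p ^ (r + 2) \<le> card K"
      using card_nonabelian_cases[OF K]
    proof
      assume "p = 2 \<and> p ^ (r + s) \<le> card K"
      \<comment> \<open>Here s \<ge> 2 ensures that the centralizer of c contains no smaller
        non-abelian subgroup.\<close>
      moreover have "p = 2 \<Longrightarrow> p ^ (r + 2) \<le> p ^ (r + s)" using assms by (intro power_increasing) auto
      ultimately show ?thesis by linarith
    qed
    then have "p ^ (r + 2) * p ^ s \<le> card K * p ^ s" by (intro mult_right_mono) auto
    then show "order G \<le> card K * p ^ s" by (simp add: order_eq power_add mult_ac)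
  qed (auto simp: X_def)
qed

text \<open>Here \<open>\<langle>a\<^sup>2, b\<rangle>\<close> is a non-abelian subgroup of least order.\<close>

lemma has_Imax_2:
  assumes p2: "p = 2" and s1: "s = 1"
  shows "has_Imax 2 G 2"
proof -
  \<comment> \<open>With i even, the exponent of c changes under multiplication by even amounts
    only, so c stays outside. The group is non-abelian because \<open>tri 2 = 1\<close> makes a^2
    and b differ in order by z.\<close>
  define X :: "quad set" where "X = {(i, j, k, l). even i \<and> even k}"
  have X: "subgroup X nil4"
    by (rule nil4.subgroupI) (auto simp: X_def inv_nil4)
  have ne: "\<phi> (2, 0, 0, 0) \<otimes> \<phi> (0, 1, 0, 0) \<noteq> \<phi> (0, 1, 0, 0) \<otimes> \<phi> (2, 0, 0, 0)"
    using p_gt_1 tri_double[of 1] by (auto simp: \<phi>_mult \<phi>_eq_iff p2)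
  have r: "r = Suc (r - 1)" using r_pos by simp
  have Pr: "(2::int) ^ r = 2 * 2 ^ (r - 1)" using r by (metis power_Suc)
  have "card (\<phi> ` X) \<le> card ((\<lambda>i. 2 * i) ` {0..<2 ^ (r - 1) :: int} \<times> {0..<2::int} \<times> {0::int} \<times> {0..<2::int})"
  proof (intro card_\<phi>_image_le)
    fix i j k l assume "(i, j, k, l) \<in> X"
    then obtain m where m: "i = 2 * m" "even k" by (auto simp: X_def)
    have "i mod P ^ r = 2 * (m mod 2 ^ (r - 1))"
      by (simp only: p2 of_nat_numeral Pr m(1) mult_mod_right)
    then show "(i mod P ^ r, j mod P ^ s, k mod P, (l + \<epsilon> * (i div P ^ r) + \<delta> * (j div P ^ s)) mod P)
        \<in> (\<lambda>i. 2 * i) ` {0..<2 ^ (r - 1)} \<times> {0..<2} \<times> {0} \<times> {0..<2}"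
      using m by (auto simp: p2 s1)
  qed auto
  also have "\<dots> = 2 ^ (r - 1) * (2 * 2)"
    by (simp add: card_cartesian_product card_image inj_on_def nat_power_eq)
  also have "\<dots> = 2 ^ (r + 1)" using r by (metis Suc_eq_plus1 mult.assoc mult.commute power_Suc)
  finally have card: "card (\<phi> ` X) \<le> 2 ^ (r + 1)" .
  show ?thesis
    \<comment> \<open>Every 2 in the goal becomes p, which is why the index 4 appears below as p ^
      p.\<close>
    unfolding p2[symmetric]
  proof (rule has_ImaxI[OF prime_p order_eq subgroup_\<phi>_image[OF X] _ _ ne])
    show "card (\<phi> ` X) * p ^ p \<le> order G" using card by (simp add: order_eq p2 s1 power_add)
    fix K x y assume K: "subgroup K G" "x \<in> K" "y \<in> K" "x \<otimes> y \<noteq> y \<otimes> x"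
    then show "order G \<le> card K * p ^ p"
      using card_nonabelian_cases[OF K] by (auto simp: order_eq p2 s1 power_add)
  qed (auto simp: X_def)
qed

end

section \<open>From the relations to the model\<close>

text \<open>Conjugation by y is an automorphism and commutes with powers. The inverse-free form lets
  the case w = x speak directly about commuting elements.\<close>

lemma (in group) int_pow_conj:
  assumes "x \<in> carrier G" "y \<in> carrier G" "w \<in> carrier G" "x \<otimes> y = y \<otimes> w"
  shows "x [^] (k::int) \<otimes> y = y \<otimes> w [^] k"
proof -
  have nat: "x [^] n \<otimes> y = y \<otimes> w [^] n" for n :: nat
  proof (induction n)
    case (Suc n)
    have "x [^] Suc n \<otimes> y = x [^] n \<otimes> y \<otimes> w" using assms by (simp add: m_assoc)
    then show ?case using assms Suc by (simp add: m_assoc)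
  qed (use assms in simp)
  show ?thesis
  proof (cases k rule: int_cases2)
    case (nonneg n)
    then show ?thesis using nat by (simp add: int_pow_int)
  next
    case (nonpos n)
    have "inv (x [^] n) \<otimes> y = inv (x [^] n) \<otimes> (y \<otimes> w [^] n) \<otimes> inv (w [^] n)"
      using assms by (simp add: m_assoc)
    also have "\<dots> = y \<otimes> inv (w [^] n)"
      using assms by (simp add: nat[symmetric] m_assoc inv_mult_cancel)
    finally show ?thesis using nonpos assms by (simp add: int_pow_neg_int)
  qed
qed

lemma (in group) int_pow_commute:
  assumes "x \<in> carrier G" "y \<in> carrier G" "x \<otimes> y = y \<otimes> x"
  shows "x [^] (k::int) \<otimes> y [^] (l::int) = y [^] l \<otimes> x [^] k"
proof -
  have "x [^] k \<otimes> y = y \<otimes> x [^] k" using assms by (intro int_pow_conj)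
  then show ?thesis using assms int_pow_conj[of y "x [^] k" y l] by simp
qed

lemma (in group) int_pow_eq_one:
  assumes "x \<in> carrier G" "x [^] (n::nat) = \<one>" "int n dvd k"
  shows "x [^] (k::int) = \<one>"
proof -
  obtain m where "k = int n * m" using assms(3) by blast
  then have "x [^] k = (x [^] int n) [^] m" using assms(1) by (simp add: int_pow_pow)
  then show ?thesis using assms(2) by (simp add: int_pow_int)
qed

lemma (in group) int_pow_cong:
  assumes "x \<in> carrier G" "x [^] (n::nat) = \<one>" "int n dvd k - l"
  shows "x [^] (k::int) = x [^] (l::int)"
proof -
  have "x [^] k = x [^] (k - l) \<otimes> x [^] l" using assms(1) by (simp add: int_pow_mult[symmetric])
  then show ?thesis using assms int_pow_eq_one[OF assms] by simp
qed

text \<open>The relation is read as conjugation by c, which sends a to a z or back: c (a z^(-1)) = a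
  c. As only a has to commute with z here, the result can later help to prove that c and z
  commute.\<close>

lemma (in group) commute_pow_central:
  assumes C: "a \<in> carrier G" "c \<in> carrier G" "z \<in> carrier G"
    and ca: "c \<otimes> a = a \<otimes> (c \<otimes> z)" and za: "z \<otimes> a = a \<otimes> z"
  shows "c \<otimes> a [^] (i::int) = a [^] i \<otimes> (c \<otimes> z [^] i)"
proof -
  have "c \<otimes> (a \<otimes> inv z) = c \<otimes> a \<otimes> inv z" using C by (simp add: m_assoc)
  also have "\<dots> = a \<otimes> c" unfolding ca using C by (simp add: m_assoc)
  finally have "a [^] i \<otimes> c = c \<otimes> (a \<otimes> inv z) [^] i" using C by (intro int_pow_conj) auto
  also have "inv z \<otimes> a = a \<otimes> inv z"
    using C za int_pow_conj[of z a z "-1"] by (simp add: int_pow_neg)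
  then have "(a \<otimes> inv z) [^] i = a [^] i \<otimes> inv (z [^] i)"
    using C by (simp add: int_pow_mult_distrib int_pow_inv)
  finally have "a [^] i \<otimes> c \<otimes> z [^] i = c \<otimes> (a [^] i \<otimes> inv (z [^] i)) \<otimes> z [^] i" by simp
  then show ?thesis using C by (simp add: m_assoc)
qed

text \<open>That z and b commute is left to \<open>nil4_central\<close>: when z is a power of a,
  this is derived from the formula for b a^i proved here.\<close>

locale nil4_elements = group +
  fixes a b c z
  assumes closed [simp]: "a \<in> carrier G" "b \<in> carrier G" "c \<in> carrier G" "z \<in> carrier G"
    and za: "z \<otimes> a = a \<otimes> z" and zc: "z \<otimes> c = c \<otimes> z"
    and ca: "c \<otimes> a = a \<otimes> (c \<otimes> z)" and ba: "b \<otimes> a = a \<otimes> (b \<otimes> inv c)"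
begin

lemma c_pow_a: "c [^] (k::int) \<otimes> a = a \<otimes> (c [^] k \<otimes> z [^] k)"
  using int_pow_conj[OF _ _ _ ca, of k] int_pow_mult_distrib[OF zc[symmetric], of k] by simp

lemma z_pow_a: "z [^] (l::int) \<otimes> a = a \<otimes> z [^] l"
  using int_pow_conj[OF _ _ _ za] by simp

text \<open>The conjugate a^(-i) b a^i, as \<open>b_a_pow\<close> confirms.\<close>

definition "X i = b \<otimes> (c [^] (- i) \<otimes> z [^] (- tri i))" for i :: int

lemma X_closed [simp]: "X i \<in> carrier G"
  by (simp add: X_def)

lemma inv_pow: "inv c = c [^] (- 1 :: int)" "inv z = z [^] (- 1 :: int)"
  by (simp_all add: int_pow_neg)

lemma X_a: "X i \<otimes> a = a \<otimes> X (i + 1)"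
proof -
  have "X i \<otimes> a = b \<otimes> (c [^] (- i) \<otimes> a \<otimes> z [^] (- tri i))"
    by (simp add: X_def m_assoc z_pow_a)
  also have "\<dots> = b \<otimes> a \<otimes> (c [^] (- i) \<otimes> (z [^] (- i) \<otimes> z [^] (- tri i)))"
    by (simp add: c_pow_a m_assoc)
  also have "\<dots> = a \<otimes> (b \<otimes> ((c [^] (- 1 :: int) \<otimes> c [^] (- i)) \<otimes> (z [^] (- i) \<otimes> z [^] (- tri i))))"
    by (simp add: ba m_assoc inv_pow)
  also have "\<dots> = a \<otimes> X (i + 1)"
  proof -
    have "- (i + 1) = - 1 + - i" "- tri (i + 1) = - i + - tri i" using tri_add[of i 1] by simp_all
    then show ?thesis by (simp only: X_def int_pow_mult closed)
  qed
  finally show ?thesis .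
qed

lemma X_inv_a: "X i \<otimes> inv a = inv a \<otimes> X (i - 1)"
proof -
  have "X i \<otimes> inv a = inv a \<otimes> (a \<otimes> X i) \<otimes> inv a" by (simp add: m_assoc[symmetric])
  also have "a \<otimes> X i = X (i - 1) \<otimes> a" using X_a[of "i - 1"] by simp
  finally show ?thesis by (simp add: m_assoc)
qed

lemma b_a_pow: "b \<otimes> a [^] (i::int) = a [^] i \<otimes> X i"
proof (induction i rule: int_induct[where k = 0])
  case base
  show ?case by (simp add: X_def)
next
  case (step1 i)
  have "b \<otimes> a [^] (i + 1) = a [^] i \<otimes> (X i \<otimes> a)"
    using step1 by (simp add: int_pow_mult m_assoc[symmetric])
  then show ?case by (simp add: X_a int_pow_mult m_assoc)
next
  case (step2 i)
  have "b \<otimes> a [^] (i - 1) = a [^] i \<otimes> (X i \<otimes> inv a)"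
    using step2 by (simp add: int_pow_diff m_assoc[symmetric])
  then show ?case by (simp add: X_inv_a int_pow_diff m_assoc)
qed

lemma c_a_pow: "c \<otimes> a [^] (i::int) = a [^] i \<otimes> (c \<otimes> z [^] i)"
  using commute_pow_central[OF _ _ _ ca za] by simp

end

locale nil4_central = nil4_elements +
  assumes cb: "c \<otimes> b = b \<otimes> c" and zb: "z \<otimes> b = b \<otimes> z"
begin

definition n :: "int \<Rightarrow> int \<Rightarrow> int \<Rightarrow> 'a" where
  "n j k l = b [^] j \<otimes> (c [^] k \<otimes> z [^] l)"

lemma n_closed [simp]: "n j k l \<in> carrier G"
  by (simp add: n_def)

lemma n_mult: "n j k l \<otimes> n j' k' l' = n (j + j') (k + k') (l + l')"
proof -
  have lcomm: "u \<otimes> (v \<otimes> w) = v \<otimes> (u \<otimes> w)"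
    if "u \<otimes> v = v \<otimes> u" "u \<in> carrier G" "v \<in> carrier G" "w \<in> carrier G" for u v w
    using that by (simp add: m_assoc[symmetric])
  note cb' = int_pow_commute[OF _ _ cb] and zb' = int_pow_commute[OF _ _ zb] and zc' = int_pow_commute[OF _ _ zc]
  show ?thesis
    by (simp add: n_def m_assoc int_pow_mult cb' zb' zc' lcomm[OF cb'] lcomm[OF zb'] lcomm[OF zc'])
qed

text \<open>This identity is the origin of \<open>quad_mult\<close>: it collects powers of a on the
  left of the abelian group generated by b, c and z.\<close>

lemma n_a_pow: "n j k l \<otimes> a [^] i = a [^] i \<otimes> n j (k - j * i) (l + k * i - j * tri i)"
proof -
  have X: "X i = n 1 (- i) (- tri i)" by (simp add: X_def n_def)
  have n0: "n j 0 0 = b [^] j" "n 0 k 0 = c [^] k" "n 0 0 l = z [^] l" for j k l by (simp_all add: n_def)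
  have X_pow: "n 1 u v [^] (j::int) = n j (u * j) (v * j)" for u v j
  proof (induction j rule: int_induct[where k = 0])
    case base
    show ?case by (simp add: n_def)
  next
    case (step1 j)
    then show ?case by (simp add: int_pow_mult n_mult algebra_simps)
  next
    case (step2 j)
    have "n 1 u v \<otimes> n (-1) (- u) (- v) = \<one>" unfolding n_mult by (simp add: n_def)
    then have "inv (n 1 u v) = n (-1) (- u) (- v)" by (metis inv_equality inv_inv inv_closed n_closed)
    then show ?case using step2 by (simp add: int_pow_diff n_mult algebra_simps)
  qed
  have b: "b [^] j \<otimes> a [^] i = a [^] i \<otimes> n j (- i * j) (- tri i * j)"
    using int_pow_conj[OF _ _ _ b_a_pow[of i], of j] by (simp add: X X_pow)
  have c: "c [^] k \<otimes> a [^] i = a [^] i \<otimes> n 0 k (k * i)"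
  proof -
    have "c \<otimes> z [^] i = z [^] i \<otimes> c" using int_pow_conj[OF _ _ _ zc, of i] by simp
    then have "(c \<otimes> z [^] i) [^] k = c [^] k \<otimes> (z [^] i) [^] k"
      by (intro int_pow_mult_distrib) auto
    then have "(c \<otimes> z [^] i) [^] k = n 0 k (i * k)" by (simp add: int_pow_pow n_def)
    then show ?thesis using int_pow_conj[OF _ _ _ c_a_pow[of i], of k] by (simp add: mult.commute)
  qed
  have z: "z [^] l \<otimes> a [^] i = a [^] i \<otimes> z [^] l" by (rule int_pow_commute) (simp_all add: za)
  have "n j k l \<otimes> a [^] i = b [^] j \<otimes> (c [^] k \<otimes> a [^] i) \<otimes> z [^] l"
    by (simp add: n_def m_assoc z)
  also have "\<dots> = (b [^] j \<otimes> a [^] i) \<otimes> (n 0 k (k * i) \<otimes> n 0 0 l)" by (simp add: c n0 m_assoc)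
  also have "\<dots> = a [^] i \<otimes> (n j (- i * j) (- tri i * j) \<otimes> (n 0 k (k * i) \<otimes> n 0 0 l))"
    by (simp add: b m_assoc)
  finally show ?thesis by (simp add: n_mult algebra_simps)
qed

definition eval :: "quad \<Rightarrow> 'a" where
  "eval = (\<lambda>(i, j, k, l). a [^] i \<otimes> n j k l)"

lemma eval_hom: "eval \<in> hom nil4 G"
proof (rule homI)
  fix x y :: quad
  show "eval (x \<otimes>\<^bsub>nil4\<^esub> y) = eval x \<otimes> eval y"
  proof (cases x; cases y)
    fix i j k l i' j' k' l' assume x: "x = (i, j, k, l)" and y: "y = (i', j', k', l')"
    have "eval x \<otimes> eval y = a [^] i \<otimes> (n j k l \<otimes> a [^] i' \<otimes> n j' k' l')"
      by (simp add: eval_def x y m_assoc)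
    also have "\<dots> = a [^] (i + i') \<otimes> n (j + j') (k - j * i' + k') (l + k * i' - j * tri i' + l')"
      unfolding n_a_pow by (simp add: m_assoc int_pow_mult n_mult)
    also have "\<dots> = eval (x \<otimes>\<^bsub>nil4\<^esub> y)" by (simp add: x y eval_def algebra_simps)
    finally show ?thesis by simp
  qed
qed (auto simp: eval_def split: prod.splits)

end

text \<open>The common shape of all presentations. It spells out that z commutes with a and b and
  that z^p = 1, which the presentations without \<open>d\<close> leave implicit.\<close>

definition nil4_rel ::
    "('a, 'b) monoid_scheme \<Rightarrow> nat \<Rightarrow> nat \<Rightarrow> nat \<Rightarrow> int \<Rightarrow> int \<Rightarrow> 'a \<Rightarrow> 'a \<Rightarrow> 'a \<Rightarrow> 'a \<Rightarrow> bool" where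
  "nil4_rel G p r s \<epsilon> \<delta> a b c z \<longleftrightarrow> {a, b, c, z} \<subseteq> carrier G \<and>
     \<lbrakk>a, b\<rbrakk>\<^bsub>G\<^esub> = c \<and> \<lbrakk>c, a\<rbrakk>\<^bsub>G\<^esub> = z \<and> \<lbrakk>c, b\<rbrakk>\<^bsub>G\<^esub> = \<one>\<^bsub>G\<^esub> \<and> \<lbrakk>z, a\<rbrakk>\<^bsub>G\<^esub> = \<one>\<^bsub>G\<^esub> \<and> \<lbrakk>z, b\<rbrakk>\<^bsub>G\<^esub> = \<one>\<^bsub>G\<^esub> \<and>
     c [^]\<^bsub>G\<^esub> p = \<one>\<^bsub>G\<^esub> \<and> z [^]\<^bsub>G\<^esub> p = \<one>\<^bsub>G\<^esub> \<and>
     a [^]\<^bsub>G\<^esub> (p ^ r) = z [^]\<^bsub>G\<^esub> \<epsilon> \<and> b [^]\<^bsub>G\<^esub> (p ^ s) = z [^]\<^bsub>G\<^esub> \<delta>"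

lemma (in group) commute_commutator:
  assumes "x \<in> carrier G" "y \<in> carrier G" "w \<in> carrier G" "w \<otimes> x = x \<otimes> w" "w \<otimes> y = y \<otimes> w"
  shows "w \<otimes> \<lbrakk>x, y\<rbrakk> = \<lbrakk>x, y\<rbrakk> \<otimes> w"
proof -
  have "subgroup {h \<in> carrier G. \<forall>s\<in>{w}. h \<otimes> s = s \<otimes> h} G"
    using assms by (intro subgroup_centralizer subgroup_self) auto
  then have "\<lbrakk>x, y\<rbrakk> \<in> {h \<in> carrier G. \<forall>s\<in>{w}. h \<otimes> s = s \<otimes> h}"
    using assms by (intro subgroup_commutator_closed) auto
  then show ?thesis by auto
qed

lemma (in group) nil4_elementsI:
  assumes "{a, b} \<subseteq> carrier G" "\<lbrakk>a, b\<rbrakk> = c" "\<lbrakk>c, a\<rbrakk> = z" "z \<otimes> a = a \<otimes> z" "z \<otimes> c = c \<otimes> z"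
  shows "nil4_elements G a b c z"
proof -
  have C: "a \<in> carrier G" "b \<in> carrier G" "c \<in> carrier G" "z \<in> carrier G"
    using assms by auto
  have "c \<otimes> a = a \<otimes> (c \<otimes> z)" using mult_eq_mult_commutator[of c a] C assms by (simp add: m_assoc)
  moreover have "b \<otimes> a = a \<otimes> (b \<otimes> inv c)"
  proof -
    have "a \<otimes> b = b \<otimes> a \<otimes> c" using mult_eq_mult_commutator[of a b] C assms by simp
    then have "a \<otimes> b \<otimes> inv c = b \<otimes> a \<otimes> c \<otimes> inv c" by simp
    then show ?thesis using C by (simp add: m_assoc)
  qed
  ultimately show ?thesis using assms C by unfold_locales auto
qed

lemma (in group) nil4_rel_central:
  assumes "nil4_rel G p r s \<epsilon> \<delta> a b c z"
  shows "nil4_central G a b c z"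
proof -
  have C: "a \<in> carrier G" "b \<in> carrier G" "c \<in> carrier G" "z \<in> carrier G"
    and eqs: "\<lbrakk>a, b\<rbrakk> = c" "\<lbrakk>c, a\<rbrakk> = z" "c \<otimes> b = b \<otimes> c" "z \<otimes> a = a \<otimes> z" "z \<otimes> b = b \<otimes> z"
    using assms commutator_eq_one_iff by (auto simp: nil4_rel_def)
  have "z \<otimes> c = c \<otimes> z" using commute_commutator[of a b z] C eqs by simp
  then have "nil4_elements G a b c z" using C eqs by (intro nil4_elementsI) auto
  then show ?thesis using eqs by (simp add: nil4_central_def nil4_central_axioms_def)
qed

lemma nil4_unit_pow:
  "(1, 0, 0, 0) [^]\<^bsub>nil4\<^esub> (t::int) = (t, 0, 0, 0)" "(0, 1, 0, 0) [^]\<^bsub>nil4\<^esub> t = (0, t, 0, 0)"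
  "(0, 0, 1, 0) [^]\<^bsub>nil4\<^esub> t = (0, 0, t, 0)" "(0, 0, 0, 1) [^]\<^bsub>nil4\<^esub> t = (0, 0, 0, t)"
proof -
  have nat: "(1, 0, 0, 0) [^]\<^bsub>nil4\<^esub> n = (int n, 0, 0, 0)" "(0, 1, 0, 0) [^]\<^bsub>nil4\<^esub> n = (0, int n, 0, 0)"
    "(0, 0, 1, 0) [^]\<^bsub>nil4\<^esub> n = (0, 0, int n, 0)" "(0, 0, 0, 1) [^]\<^bsub>nil4\<^esub> n = (0, 0, 0, int n)" for n :: nat
    by (induction n) auto
  show "(1, 0, 0, 0) [^]\<^bsub>nil4\<^esub> t = (t, 0, 0, 0)" "(0, 1, 0, 0) [^]\<^bsub>nil4\<^esub> t = (0, t, 0, 0)"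
    "(0, 0, 1, 0) [^]\<^bsub>nil4\<^esub> t = (0, 0, t, 0)" "(0, 0, 0, 1) [^]\<^bsub>nil4\<^esub> t = (0, 0, 0, t)"
    by (cases t rule: int_cases2; simp add: int_pow_int nil4.int_pow_neg_int nat inv_nil4)+
qed

context nil4_image
begin

lemma \<phi>_normal_form: "\<phi> (i, j, k, l) =
    \<phi> (1, 0, 0, 0) [^] i \<otimes> (\<phi> (0, 1, 0, 0) [^] j \<otimes> (\<phi> (0, 0, 1, 0) [^] k \<otimes> \<phi> (0, 0, 0, 1) [^] l))"
  by (simp add: \<phi>.hom_int_pow[symmetric] nil4_unit_pow \<phi>_mult del: \<phi>.hom_int_pow)

lemma nil4_rel_\<phi>:
  "nil4_rel G p r s \<epsilon> \<delta> (\<phi> (1, 0, 0, 0)) (\<phi> (0, 1, 0, 0)) (\<phi> (0, 0, 1, 0)) (\<phi> (0, 0, 0, 1))"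
  unfolding nil4_rel_def
proof (intro conjI)
  show "\<lbrakk>\<phi> (1, 0, 0, 0), \<phi> (0, 1, 0, 0)\<rbrakk> = \<phi> (0, 0, 1, 0)"
    "\<lbrakk>\<phi> (0, 0, 1, 0), \<phi> (1, 0, 0, 0)\<rbrakk> = \<phi> (0, 0, 0, 1)"
    by (rule commutator_eqI; simp add: \<phi>_mult)+
  show "\<lbrakk>\<phi> (0, 0, 1, 0), \<phi> (0, 1, 0, 0)\<rbrakk> = \<one>" "\<lbrakk>\<phi> (0, 0, 0, 1), \<phi> (1, 0, 0, 0)\<rbrakk> = \<one>"
    "\<lbrakk>\<phi> (0, 0, 0, 1), \<phi> (0, 1, 0, 0)\<rbrakk> = \<one>"
    by (simp_all add: commutator_eq_one_iff \<phi>_mult)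
  have one: "\<one> = \<phi> (0, 0, 0, 0)" using \<phi>.hom_one by simp
  show "\<phi> (0, 0, 1, 0) [^] p = \<one>" "\<phi> (0, 0, 0, 1) [^] p = \<one>"
    unfolding one \<phi>_nat_pow_0 by (rule \<phi>_eqI[where u = 0 and v = 0]; simp)+
  have z: "\<phi> (0, 0, 0, 1) [^] t = \<phi> (0, 0, 0, t)" for t :: int
    by (simp add: \<phi>.hom_int_pow[symmetric] nil4_unit_pow del: \<phi>.hom_int_pow)
  have "\<phi> (1, 0, 0, 0) [^] (p ^ r) = \<phi> (P ^ r, 0, 0, 0)"
    by (simp add: \<phi>.hom_int_pow[symmetric] nil4_unit_pow int_pow_int[symmetric] del: \<phi>.hom_int_pow)
  also have "\<dots> = \<phi> (0, 0, 0, \<epsilon>)" by (rule \<phi>_eqI[where u = 1 and v = 0]) auto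
  finally show "\<phi> (1, 0, 0, 0) [^] (p ^ r) = \<phi> (0, 0, 0, 1) [^] \<epsilon>" by (simp add: z)
  have "\<phi> (0, 1, 0, 0) [^] (p ^ s) = \<phi> (0, P ^ s, 0, 0)" by (simp add: \<phi>_nat_pow_0)
  also have "\<dots> = \<phi> (0, 0, 0, \<delta>)" by (rule \<phi>_eqI[where u = 0 and v = 1]) auto
  finally show "\<phi> (0, 1, 0, 0) [^] (p ^ s) = \<phi> (0, 0, 0, 1) [^] \<delta>" by (simp add: z)
qed simp

end

section \<open>Presented groups as images of the model\<close>

context nil4_params
begin

definition model :: "quad set monoid" where
  "model = nil4 Mod Ker"

definition proj :: "quad \<Rightarrow> quad set" where
  "proj x = Ker #>\<^bsub>nil4\<^esub> x"

lemma nil4_image_model: "nil4_image p r s \<epsilon> \<delta> model proj"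
proof -
  interpret Ker: normal Ker nil4 by (rule normal_Ker)
  interpret M: group model unfolding model_def by (rule Ker.factorgroup_is_group)
  show ?thesis
  proof
    show "proj \<in> hom nil4 model"
      unfolding model_def proj_def by (rule Ker.r_coset_hom_Mod)
    show "range proj = carrier model"
      by (simp add: model_def proj_def carrier_FactGroup)
    fix x
    have "Ker #>\<^bsub>nil4\<^esub> x = Ker \<longleftrightarrow> x \<in> Ker"
      using nil4.coset_join1 nil4.coset_join2 Ker.subgroup_axioms by (metis UNIV_I Ker.subset nil4_simps(1))
    then show "proj x = \<one>\<^bsub>model\<^esub> \<longleftrightarrow> x \<in> Ker" by (simp add: model_def proj_def)
  qed
qed

text \<open>The kernel is enclosed from both sides: the relations send \<open>Ker\<close> to 1, and
  since h composed with \<open>eval\<close> is \<open>proj\<close>, nothing outside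
  \<open>Ker\<close> can be sent to 1. Surjectivity holds because a and b generate.\<close>

lemma nil4_image_eval:
  fixes G (structure)
  assumes "group G" and rel: "nil4_rel G p r s \<epsilon> \<delta> a b c z"
    and gen: "\<And>H. subgroup H G \<Longrightarrow> a \<in> H \<Longrightarrow> b \<in> H \<Longrightarrow> H = carrier G"
    and h: "h \<in> hom G model" "h a = proj (1, 0, 0, 0)" "h b = proj (0, 1, 0, 0)"
  shows "nil4_image p r s \<epsilon> \<delta> G (nil4_central.eval G a b c z)"
proof -
  interpret group G by fact
  interpret nil4_central G a b c z using rel by (rule nil4_rel_central)
  interpret M: nil4_image p r s \<epsilon> \<delta> model proj by (rule nil4_image_model)
  interpret h: group_hom G model h
    using h(1) by (simp add: group_hom_def group_hom_axioms_def is_group M.is_group)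
  interpret ev: group_hom nil4 G eval
    using eval_hom by (simp add: group_hom_def group_hom_axioms_def is_group group_nil4)
  have relM: "nil4_rel model p r s \<epsilon> \<delta> (proj (1, 0, 0, 0)) (proj (0, 1, 0, 0)) (proj (0, 0, 1, 0)) (proj (0, 0, 0, 1))"
    by (rule M.nil4_rel_\<phi>)
  have comm: "h \<lbrakk>x, y\<rbrakk> = \<lbrakk>h x, h y\<rbrakk>\<^bsub>model\<^esub>" if "x \<in> carrier G" "y \<in> carrier G" for x y
    using that by (simp add: commutator_def)
  have hc: "h c = proj (0, 0, 1, 0)" and hz: "h z = proj (0, 0, 0, 1)"
    using rel relM comm[of a b] comm[of c a] h by (simp_all add: nil4_rel_def)
  have h_eval: "h (eval (i, j, k, l)) = proj (i, j, k, l)" for i j k l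
    unfolding M.\<phi>_normal_form[of i j k l] by (simp add: eval_def n_def h.hom_int_pow h hc hz)
  show ?thesis
  proof
    show "eval \<in> hom nil4 G" by (rule eval_hom)
    have "subgroup (range eval) G" using ev.subgroup_img_is_subgroup[of UNIV] nil4.subgroup_self by simp
    moreover have "eval (1, 0, 0, 0) = a" "eval (0, 1, 0, 0) = b" by (simp_all add: eval_def n_def)
    ultimately show "range eval = carrier G" using gen by (metis rangeI)
    fix x :: quad
    obtain i j k l where x: "x = (i, j, k, l)" by (cases x) auto
    show "eval x = \<one> \<longleftrightarrow> x \<in> Ker"
    proof
      assume "eval x = \<one>"
      then have "proj x = \<one>\<^bsub>model\<^esub>" using h_eval[of i j k l] by (simp add: x)
      then show "x \<in> Ker" by (simp add: M.ker_\<phi>)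
    next
      assume "x \<in> Ker"
      then obtain u v where uv: "i = P ^ r * u" "j = P ^ s * v" "P dvd k" "P dvd \<epsilon> * u + \<delta> * v + l"
        unfolding x Ker_iff by blast
      have pw: "a [^] (p ^ r) = z [^] \<epsilon>" "b [^] (p ^ s) = z [^] \<delta>" "c [^] p = \<one>" "z [^] p = \<one>"
        using rel by (simp_all add: nil4_rel_def)
      have "a [^] i = (a [^] int (p ^ r)) [^] u" "b [^] j = (b [^] int (p ^ s)) [^] v"
        by (simp_all add: uv int_pow_pow)
      then have "a [^] i = z [^] (\<epsilon> * u)" "b [^] j = z [^] (\<delta> * v)"
        unfolding int_pow_int pw by (simp_all add: int_pow_pow)
      moreover have "c [^] k = \<one>" using pw uv by (intro int_pow_eq_one) auto
      ultimately have "eval x = z [^] (\<epsilon> * u + \<delta> * v + l)"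
        by (simp add: x eval_def n_def int_pow_mult m_assoc)
      then show "eval x = \<one>" using pw uv by (simp add: int_pow_eq_one)
    qed
  qed
qed

text \<open>The hypotheses \<open>rel\<close> and \<open>gen\<close> range over all homomorphisms
  respecting the relators, because the projection is known only through its properties. Here
  \<open>a\<close> and \<open>b\<close> may be any elements of the free group, which admits the pair
  (b, inv a).\<close>

lemma has_Imax_presented_group:
  fixes S :: "'x set"
  assumes R: "R \<subseteq> carrier (free_group S) \<times> carrier (free_group S)"
    and ab: "a \<in> carrier (free_group S)" "b \<in> carrier (free_group S)"
    and rel: "\<And>G :: 'x word set set monoid. \<And>q. group_hom (free_group S) G q \<Longrightarrow>
      \<forall>(u, v)\<in>R. q u = q v \<Longrightarrow> \<exists>c z. nil4_rel G p r s \<epsilon> \<delta> (q a) (q b) c z"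
    and gen: "\<And>G :: 'x word set set monoid. \<And>q H x. group_hom (free_group S) G q \<Longrightarrow>
      \<forall>(u, v)\<in>R. q u = q v \<Longrightarrow> subgroup H G \<Longrightarrow> q a \<in> H \<Longrightarrow> q b \<in> H \<Longrightarrow> x \<in> S \<Longrightarrow>
      q (free_gen S x) \<in> H"
    and h: "group_hom (free_group S) model h" "\<forall>(u, v)\<in>R. h u = h v"
      "h a = proj (1, 0, 0, 0)" "h b = proj (0, 1, 0, 0)"
  shows "has_Imax p (presented_group S R) (if p = 2 \<and> s = 1 then 2 else s)"
proof -
  let ?G = "presented_group S R" and ?F = "free_group S"
  interpret h: group_hom ?F model h by (rule h)
  \<comment> \<open>The type of the targets is fixed together with \<open>q\<close>; the model is
    the only target used.\<close>
  obtain q where q: "group ?G" "q \<in> hom ?F ?G" "q ` carrier ?F = carrier ?G"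
    "\<forall>(u, v)\<in>R. q u = q v"
    "\<forall>h (L :: quad set monoid). group L \<longrightarrow> h \<in> hom ?F L \<longrightarrow>
      (\<forall>(u, v)\<in>R. h u = h v) \<longrightarrow> (\<exists>g \<in> hom ?G L. \<forall>u \<in> carrier ?F. g (q u) = h u)"
    using presented_group_hom_exists[OF R] by (elim exE conjE) (rule that)
  interpret q: group_hom ?F ?G q
    using q by (simp add: group_hom_def group_hom_axioms_def group_free_group)
  obtain c z where rel': "nil4_rel ?G p r s \<epsilon> \<delta> (q a) (q b) c z"
    using rel[OF q.group_hom_axioms q(4)] by blast
  have "\<exists>g \<in> hom ?G model. \<forall>u \<in> carrier ?F. g (q u) = h u"
    by (rule q(5)[THEN spec, THEN spec, THEN mp, THEN mp, THEN mp, OF h.H.is_group h.homh h(2)])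
  then obtain g where g: "g \<in> hom ?G model" "\<And>u. u \<in> carrier ?F \<Longrightarrow> g (q u) = h u"
    by blast
  have "H = carrier ?G" if H: "subgroup H ?G" "q a \<in> H" "q b \<in> H" for H
  proof
    show "H \<subseteq> carrier ?G" by (rule subgroup.subset[OF H(1)])
    have "carrier ?G = generate ?G (q ` free_gen S ` S)"
      using q.generate_img[of "free_gen S ` S"] q(3) generate_free_gen[of S] free_gen_closed[of _ S] by auto
    also have "\<dots> \<subseteq> H"
      using gen[OF q.group_hom_axioms q(4) H] by (intro q.H.generate_subgroup_incl H) auto
    finally show "carrier ?G \<subseteq> H" .
  qed
  then interpret nil4_image p r s \<epsilon> \<delta> ?G "nil4_central.eval ?G (q a) (q b) c z"
    using ab g h by (intro nil4_image_eval[OF q(1) rel' _ g(1)]) auto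
  show ?thesis
  proof (cases "p = 2 \<and> s = 1")
    case True
    then show ?thesis using has_Imax_2 by auto
  next
    case False
    then have "p = 2 \<Longrightarrow> s \<ge> 2" using s_pos by (cases "s = 1") auto
    then have "has_Imax p ?G s" by (rule has_Imax_s)
    then show ?thesis using False by (simp only: if_False)
  qed
qed

end

section \<open>The individual families\<close>

context group
begin

lemma commute_inv:
  assumes "x \<in> carrier G" "y \<in> carrier G" "x \<otimes> y = y \<otimes> x"
  shows "inv x \<otimes> y = y \<otimes> inv x"
  using int_pow_conj[of x y x "-1"] assms by (simp add: int_pow_neg)

text \<open>[b, a^(-1)] is the conjugate a [a, b] a^(-1). The companion below rests in the same way
  on [b^(-1), a] = b [a, b] b^(-1).\<close>

lemma commutator_inv_right:
  assumes "a \<in> carrier G" "b \<in> carrier G" "\<lbrakk>a, b\<rbrakk> = c" "c \<otimes> a = a \<otimes> c"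
  shows "\<lbrakk>b, inv a\<rbrakk> = c"
proof (rule commutator_eqI)
  have c: "c \<in> carrier G" using assms by auto
  have "inv a \<otimes> b \<otimes> c = inv a \<otimes> (b \<otimes> (a \<otimes> c)) \<otimes> inv a"
    unfolding assms(4)[symmetric] using assms(1,2) c by (simp add: m_assoc)
  also have "b \<otimes> (a \<otimes> c) = a \<otimes> b"
    using mult_eq_mult_commutator[of a b] assms c by (simp add: m_assoc)
  finally show "b \<otimes> inv a = inv a \<otimes> b \<otimes> c"
    using assms by (simp add: m_assoc[symmetric])
qed (use assms in auto)

lemma commutator_inv_left:
  assumes "a \<in> carrier G" "b \<in> carrier G" "\<lbrakk>a, b\<rbrakk> = c" "c \<otimes> b = b \<otimes> c"
  shows "\<lbrakk>inv b, a\<rbrakk> = c"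
proof (rule commutator_eqI)
  have c: "c \<in> carrier G" using assms by auto
  have "inv b \<otimes> a = inv b \<otimes> (a \<otimes> b) \<otimes> inv b" using assms(1,2) by (simp add: m_assoc)
  also have "a \<otimes> b = b \<otimes> a \<otimes> c" using mult_eq_mult_commutator[of a b] assms by simp
  also have "inv b \<otimes> (b \<otimes> a \<otimes> c) \<otimes> inv b = a \<otimes> (c \<otimes> inv b)"
    using assms(1,2) c by (simp add: m_assoc inv_mult_cancel)
  also have "c \<otimes> inv b = inv b \<otimes> c" using commute_inv[of b c] assms c by simp
  finally show "inv b \<otimes> a = a \<otimes> inv b \<otimes> c" using assms(1,2) c by (simp add: m_assoc)
qed (use assms in auto)

text \<open>As a power of b, z commutes with b. Conjugation by a sends b to b c^(-1), and the
  exponent \<nu> * p^s kills the power of c, so z commutes with a as well. The inverse \<delta> of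
  \<nu> solves z = b^(\<nu> p^s) for b^(p^s).\<close>

lemma nil4_relI_b:
  assumes C: "a \<in> carrier G" "b \<in> carrier G" and s: "s \<ge> 1" and \<nu>: "int p dvd \<nu> * \<delta> - 1"
    and c: "\<lbrakk>a, b\<rbrakk> = c" and z: "\<lbrakk>c, a\<rbrakk> = z" "z = b [^] (\<nu> * int p ^ s)" and cb: "\<lbrakk>c, b\<rbrakk> = \<one>"
    and pow: "a [^] (p ^ r) = \<one>" "b [^] (p ^ (s + 1)) = \<one>" "c [^] p = \<one>"
  shows "nil4_rel G p r s 0 \<delta> a b c z"
proof -
  have cC: "c \<in> carrier G" and zC: "z \<in> carrier G" using c z C by auto
  have cb': "c \<otimes> b = b \<otimes> c" using cb C cC by (simp add: commutator_eq_one_iff)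
  have zb: "z \<otimes> b = b \<otimes> z" unfolding z(2) using C int_pow_commute[of b b _ 1] by simp
  have ba: "b \<otimes> a = a \<otimes> (b \<otimes> inv c)"
  proof -
    have "b \<otimes> a \<otimes> c = a \<otimes> b" using mult_eq_mult_commutator[of a b] C c by simp
    then have "b \<otimes> a \<otimes> c \<otimes> inv c = a \<otimes> b \<otimes> inv c" by simp
    then show ?thesis using C cC by (simp add: m_assoc)
  qed
  have "z \<otimes> a = a \<otimes> (b \<otimes> inv c) [^] (\<nu> * int p ^ s)"
    unfolding z(2) using C cC ba by (intro int_pow_conj) auto
  also have "(b \<otimes> inv c) [^] (\<nu> * int p ^ s) = z \<otimes> inv (c [^] (\<nu> * int p ^ s))"
    using C cC commute_inv[OF cC C(2) cb'] by (simp add: z(2) int_pow_mult_distrib int_pow_inv)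
  also have "c [^] (\<nu> * int p ^ s) = \<one>"
    using pow cC s by (intro int_pow_eq_one[of _ p]) (auto simp: dvd_power)
  finally have za: "z \<otimes> a = a \<otimes> z" using zC by simp
  have "z [^] p = b [^] (\<nu> * int p ^ s * int p)"
    using C by (simp add: z(2) int_pow_int[symmetric] int_pow_pow)
  also have "\<dots> = \<one>" using C pow by (intro int_pow_eq_one[of _ "p ^ (s + 1)"]) auto
  finally have zp: "z [^] p = \<one>" .
  have "b [^] (p ^ s) = b [^] (int p ^ s)" by (simp add: int_pow_int[symmetric])
  also have "\<dots> = b [^] (\<nu> * int p ^ s * \<delta>)"
  proof (rule int_pow_cong[OF C(2) pow(2)])
    have "int p ^ s * int p dvd int p ^ s * (\<nu> * \<delta> - 1)" using \<nu> by (intro mult_dvd_mono) auto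
    then have "int p ^ s * int p dvd - (int p ^ s * (\<nu> * \<delta> - 1))" by (simp only: dvd_minus_iff)
    then show "int (p ^ (s + 1)) dvd int p ^ s - \<nu> * int p ^ s * \<delta>" by (simp add: algebra_simps)
  qed
  also have "\<dots> = z [^] \<delta>" using C by (simp add: z(2) int_pow_pow)
  finally have "b [^] (p ^ s) = z [^] \<delta>" .
  then show ?thesis
    using C cC zC c z(1) cb pow za zb zp by (simp add: nil4_rel_def commutator_eq_one_iff)
qed

lemma nil4_relD_b:
  assumes rel: "nil4_rel G p r s 0 \<delta> a b c z" and \<nu>: "int p dvd \<nu> * \<delta> - 1"
  shows "z = b [^] (\<nu> * int p ^ s)" "b [^] (p ^ (s + 1)) = \<one>"
proof -
  have C: "b \<in> carrier G" "z \<in> carrier G" and b: "b [^] (p ^ s) = z [^] \<delta>" and zp: "z [^] p = \<one>"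
    using rel by (auto simp: nil4_rel_def)
  have "b [^] (\<nu> * int p ^ s) = (b [^] int (p ^ s)) [^] \<nu>" using C by (simp add: int_pow_pow mult.commute)
  also have "\<dots> = z [^] (\<delta> * \<nu>)" using C by (simp add: int_pow_int b int_pow_pow del: of_nat_power)
  also have "\<dots> = z [^] (1::int)" using C zp \<nu> by (intro int_pow_cong) (auto simp: mult.commute)
  finally show "z = b [^] (\<nu> * int p ^ s)" using C by simp
  have "b [^] (p ^ (s + 1)) = (b [^] (p ^ s)) [^] p" using C by (simp add: nat_pow_pow mult.commute)
  also have "\<dots> = z [^] (\<delta> * int p)" using C int_pow_pow[of z \<delta> "int p"] by (simp add: b int_pow_int)
  also have "\<dots> = \<one>" using C zp by (intro int_pow_eq_one) auto
  finally show "b [^] (p ^ (s + 1)) = \<one>" .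
qed

text \<open>As a power of a, z commutes with a. Moving a^(p^r) past c yields the factor z^(p^r) = 1,
  so z commutes with c. Only then is the formula for b a^i available; at i = p^r its corrections
  vanish because p divides \<open>tri (p^r)\<close>.\<close>

lemma nil4_relI_a:
  assumes "nil4_params p r s"
    and C: "a \<in> carrier G" "b \<in> carrier G"
    and c: "\<lbrakk>a, b\<rbrakk> = c" and z: "\<lbrakk>c, a\<rbrakk> = z" "z = a [^] (p ^ r)" and cb: "\<lbrakk>c, b\<rbrakk> = \<one>"
    and pow: "a [^] (p ^ (r + 1)) = \<one>" "b [^] (p ^ s) = \<one>" "c [^] p = \<one>"
  shows "nil4_rel G p r s 1 0 a b c z"
proof -
  interpret nil4_params p r s by fact
  have cC: "c \<in> carrier G" and zC: "z \<in> carrier G" using c z C by auto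
  have z': "z = a [^] (int p ^ r)" by (simp add: z(2) int_pow_int[symmetric])
  have za: "z \<otimes> a = a \<otimes> z" unfolding z' using C int_pow_commute[of a a _ 1] by simp
  have "z [^] p = a [^] (p ^ (r + 1))" using C by (simp add: z(2) nat_pow_pow mult.commute)
  then have zp: "z [^] p = \<one>" using pow by simp
  have ca: "c \<otimes> a = a \<otimes> (c \<otimes> z)" using mult_eq_mult_commutator[of c a] C cC zC z by (simp add: m_assoc)
  have "z [^] (int p ^ r) = \<one>" using zC zp by (intro int_pow_eq_one) auto
  then have zc: "z \<otimes> c = c \<otimes> z"
    using commute_pow_central[OF C(1) cC zC ca za, of "int p ^ r"] cC by (simp add: z'[symmetric])
  interpret nil4_elements G a b c z
    using C c z(1) za zc by (intro nil4_elementsI) auto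
  have "X (int p ^ r) = b"
  proof -
    have "int p dvd tri (int p ^ r)" using dvd_tri_Pr[of 1] by simp
    then have "c [^] (- (int p ^ r)) = \<one>" "z [^] (- tri (int p ^ r)) = \<one>"
      using pow zp by (auto intro!: int_pow_eq_one[of _ p])
    then show ?thesis by (simp add: X_def)
  qed
  then have "z \<otimes> b = b \<otimes> z" using b_a_pow[of "int p ^ r"] by (simp add: z'[symmetric])
  then show ?thesis
    using C c z cb pow za zp by (simp add: nil4_rel_def commutator_eq_one_iff)
qed

lemma nil4_relD_a:
  assumes rel: "nil4_rel G p r s 1 0 a b c z"
  shows "z = a [^] (p ^ r)" "a [^] (p ^ (r + 1)) = \<one>"
proof -
  have C: "a \<in> carrier G" "z \<in> carrier G" and a: "a [^] (p ^ r) = z" and zp: "z [^] p = \<one>"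
    using rel by (auto simp: nil4_rel_def)
  show "z = a [^] (p ^ r)" using a by simp
  have "a [^] (p ^ (r + 1)) = (a [^] (p ^ r)) [^] p" using C by (simp add: nat_pow_pow mult.commute)
  then show "a [^] (p ^ (r + 1)) = \<one>" by (simp add: a zp)
qed

end

section \<open>Transport of relators along homomorphisms\<close>

lemma (in group_hom) hom_commutator:
  "x \<in> carrier G \<Longrightarrow> y \<in> carrier G \<Longrightarrow> h \<lbrakk>x, y\<rbrakk> = \<lbrakk>h x, h y\<rbrakk>\<^bsub>H\<^esub>"
  by (simp add: commutator_def)

lemmas rel_defs = rel_H3_def rel_J1_def rel_J2_def rel_J3_def rel_J4_def rel_J5_def rel_J6_def

lemma (in group) rel_closed:
  assumes "a \<in> carrier G" "b \<in> carrier G" "c \<in> carrier G" "d \<in> carrier G"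
  shows "rel_H3 G a b c \<subseteq> carrier G \<times> carrier G" "rel_J1 G p n m \<nu> a b c \<subseteq> carrier G \<times> carrier G"
    "rel_J2 G p n m a b c \<subseteq> carrier G \<times> carrier G" "rel_J3 G p n m a b c \<subseteq> carrier G \<times> carrier G"
    "rel_J4 G p n m \<nu> a b c \<subseteq> carrier G \<times> carrier G" "rel_J5 G p n m a b c d \<subseteq> carrier G \<times> carrier G"
    "rel_J6 G p n m a b c d \<subseteq> carrier G \<times> carrier G"
  using assms by (simp_all add: rel_defs)

context group_hom
begin

context
  fixes a b c d
  assumes gens: "a \<in> carrier G" "b \<in> carrier G" "c \<in> carrier G" "d \<in> carrier G"
begin

text \<open>This and its companions replace conditions on elements of the free group by equations
  between the images of the generators. The remaining families are special cases of these
  seven.\<close>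

lemma rel_H3_hom_iff:
  "(\<forall>(u, v)\<in>rel_H3 G a b c. h u = h v) \<longleftrightarrow> (\<forall>(u, v)\<in>rel_H3 H (h a) (h b) (h c). u = v)"
  using gens by (simp add: rel_H3_def hom_nat_pow hom_int_pow hom_commutator)

lemma rel_J1_hom_iff:
  "(\<forall>(u, v)\<in>rel_J1 G p n m \<nu> a b c. h u = h v) \<longleftrightarrow> (\<forall>(u, v)\<in>rel_J1 H p n m \<nu> (h a) (h b) (h c). u = v)"
  using gens by (simp add: rel_J1_def hom_nat_pow hom_int_pow hom_commutator)

lemma rel_J2_hom_iff:
  "(\<forall>(u, v)\<in>rel_J2 G p n m a b c. h u = h v) \<longleftrightarrow> (\<forall>(u, v)\<in>rel_J2 H p n m (h a) (h b) (h c). u = v)"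
  using gens by (simp add: rel_J2_def hom_nat_pow hom_int_pow hom_commutator)

lemma rel_J3_hom_iff:
  "(\<forall>(u, v)\<in>rel_J3 G p n m a b c. h u = h v) \<longleftrightarrow> (\<forall>(u, v)\<in>rel_J3 H p n m (h a) (h b) (h c). u = v)"
  using gens by (simp add: rel_J3_def hom_nat_pow hom_int_pow hom_commutator)

lemma rel_J4_hom_iff:
  "(\<forall>(u, v)\<in>rel_J4 G p n m \<nu> a b c. h u = h v) \<longleftrightarrow> (\<forall>(u, v)\<in>rel_J4 H p n m \<nu> (h a) (h b) (h c). u = v)"
  using gens by (simp add: rel_J4_def hom_nat_pow hom_int_pow hom_commutator)

lemma rel_J5_hom_iff:
  "(\<forall>(u, v)\<in>rel_J5 G p n m a b c d. h u = h v) \<longleftrightarrow> (\<forall>(u, v)\<in>rel_J5 H p n m (h a) (h b) (h c) (h d). u = v)"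
  using gens by (simp add: rel_J5_def hom_nat_pow hom_int_pow hom_commutator)

lemma rel_J6_hom_iff:
  "(\<forall>(u, v)\<in>rel_J6 G p n m a b c d. h u = h v) \<longleftrightarrow> (\<forall>(u, v)\<in>rel_J6 H p n m (h a) (h b) (h c) (h d). u = v)"
  using gens by (simp add: rel_J6_def hom_nat_pow hom_int_pow hom_commutator)

end

end

context nil4_params
begin

lemma model_hom_exists:
  fixes S :: "'x set"
  assumes "\<And>x. x \<in> S \<Longrightarrow> f x \<in> carrier model"
  shows "\<exists>h. group_hom (free_group S) model h \<and> (\<forall>x\<in>S. h (free_gen S x) = f x)"
proof -
  interpret M: nil4_image p r s \<epsilon> \<delta> model proj by (rule nil4_image_model)
  have "\<exists>h. h \<in> hom (free_group S) model \<and> (\<forall>x\<in>S. h (free_gen S x) = f x)"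
    by (rule free_group_hom_exists[OF M.is_group assms])
  then show ?thesis
    by (simp add: group_hom_def group_hom_axioms_def group_free_group M.is_group)
qed

text \<open>The implications guarded by \<open>GD \<in> S\<close> let one statement cover
  presentations on three and on four generators; a generator \<open>d\<close> always plays the role
  of z.\<close>

lemma has_Imax_presentation:
  fixes S :: "generator set"
  defines "F \<equiv> free_group S" and "g \<equiv> free_gen S"
  assumes S: "{GA, GB, GC} \<subseteq> S" and R: "R \<subseteq> carrier F \<times> carrier F"
    and rel: "\<And>(G :: pgroup) q. group_hom F G q \<Longrightarrow> \<forall>(u, v)\<in>R. q u = q v \<Longrightarrow>
      \<exists>z. nil4_rel G p r s \<epsilon> \<delta> (q (g GA)) (q (g GB)) (q (g GC)) z \<and> (GD \<in> S \<longrightarrow> q (g GD) = z)"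
    and model: "\<And>h. group_hom F model h \<Longrightarrow> h (g GA) = proj (1, 0, 0, 0) \<Longrightarrow> h (g GB) = proj (0, 1, 0, 0) \<Longrightarrow>
      h (g GC) = proj (0, 0, 1, 0) \<Longrightarrow> (GD \<in> S \<Longrightarrow> h (g GD) = proj (0, 0, 0, 1)) \<Longrightarrow> \<forall>(u, v)\<in>R. h u = h v"
  shows "has_Imax p (presented_group S R) (if p = 2 \<and> s = 1 then 2 else s)"
proof -
  let ?F = "free_group S" and ?g = "free_gen S"
  note defs = F_def g_def
  interpret M: nil4_image p r s \<epsilon> \<delta> model proj by (rule nil4_image_model)
  have gC: "?g GA \<in> carrier ?F" "?g GB \<in> carrier ?F"
    using S by (auto intro!: free_gen_closed)
  define f where "f x = (case x of GA \<Rightarrow> proj (1, 0, 0, 0) | GB \<Rightarrow> proj (0, 1, 0, 0) |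
    GC \<Rightarrow> proj (0, 0, 1, 0) | GD \<Rightarrow> proj (0, 0, 0, 1))" for x
  have "f x \<in> carrier model" for x by (cases x) (simp_all add: f_def)
  then have "\<exists>h. group_hom ?F model h \<and> (\<forall>x\<in>S. h (?g x) = f x)" by (rule model_hom_exists)
  then obtain h where h: "group_hom ?F model h" "\<forall>x\<in>S. h (?g x) = f x" by (elim exE conjE)
  interpret h: group_hom ?F model h by (rule h)
  have hg: "h (?g GA) = proj (1, 0, 0, 0)" "h (?g GB) = proj (0, 1, 0, 0)" "h (?g GC) = proj (0, 0, 1, 0)"
    "GD \<in> S \<Longrightarrow> h (?g GD) = proj (0, 0, 0, 1)"
    using h(2) S by (auto simp: f_def)
  show ?thesis
  proof (rule has_Imax_presented_group[OF R[unfolded defs] gC _ _ h(1) _ hg(1,2)])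
    show "\<forall>(u, v)\<in>R. h u = h v"
      by (rule model[unfolded defs, OF h(1) hg])
  next
    fix G :: pgroup and q assume q: "group_hom ?F G q" and Rq: "\<forall>(u, v)\<in>R. q u = q v"
    interpret q: group_hom ?F G q by (rule q)
    obtain z where z: "nil4_rel G p r s \<epsilon> \<delta> (q (?g GA)) (q (?g GB)) (q (?g GC)) z" "GD \<in> S \<longrightarrow> q (?g GD) = z"
      using rel[unfolded defs, OF q Rq] by (elim exE conjE)
    show "\<exists>c z. nil4_rel G p r s \<epsilon> \<delta> (q (?g GA)) (q (?g GB)) c z" using z(1) by (intro exI)
    fix H x assume H: "subgroup H G" "q (?g GA) \<in> H" "q (?g GB) \<in> H" and x: "x \<in> S"
    have "\<lbrakk>q (?g GA), q (?g GB)\<rbrakk>\<^bsub>G\<^esub> \<in> H" by (rule q.H.subgroup_commutator_closed[OF H])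
    then have c: "q (?g GC) \<in> H" using z(1) by (simp add: nil4_rel_def)
    have "\<lbrakk>q (?g GC), q (?g GA)\<rbrakk>\<^bsub>G\<^esub> \<in> H" by (rule q.H.subgroup_commutator_closed[OF H(1) c H(2)])
    then have "z \<in> H" using z(1) by (simp add: nil4_rel_def)
    then show "q (?g x) \<in> H" using H c x z(2) by (cases x) auto
  qed
qed

text \<open>If \<open>c\<close> commutes with \<open>a\<close> instead of \<open>b\<close>, the pair \<open>(b, inv a)\<close> has the commutator \<open>c\<close> as well and
  plays the role of \<open>(a, b)\<close>.\<close>

lemma has_Imax_presentation_swap:
  fixes S :: "generator set"
  defines "F \<equiv> free_group S" and "g \<equiv> free_gen S"
  assumes S: "{GA, GB, GC} \<subseteq> S" and R: "R \<subseteq> carrier F \<times> carrier F"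
    and rel: "\<And>(G :: pgroup) q. group_hom F G q \<Longrightarrow> \<forall>(u, v)\<in>R. q u = q v \<Longrightarrow>
      \<exists>z. nil4_rel G p r s \<epsilon> \<delta> (q (g GB)) (inv\<^bsub>G\<^esub> (q (g GA))) (q (g GC)) z \<and> (GD \<in> S \<longrightarrow> q (g GD) = z)"
    and model: "\<And>h. group_hom F model h \<Longrightarrow> h (g GA) = inv\<^bsub>model\<^esub> (proj (0, 1, 0, 0)) \<Longrightarrow>
      h (g GB) = proj (1, 0, 0, 0) \<Longrightarrow>
      h (g GC) = proj (0, 0, 1, 0) \<Longrightarrow> (GD \<in> S \<Longrightarrow> h (g GD) = proj (0, 0, 0, 1)) \<Longrightarrow> \<forall>(u, v)\<in>R. h u = h v"
  shows "has_Imax p (presented_group S R) (if p = 2 \<and> s = 1 then 2 else s)"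
proof -
  let ?F = "free_group S" and ?g = "free_gen S"
  note defs = F_def g_def
  interpret F: group ?F by (rule group_free_group)
  interpret M: nil4_image p r s \<epsilon> \<delta> model proj by (rule nil4_image_model)
  have gA: "?g GA \<in> carrier ?F"
    using S by (auto intro!: free_gen_closed)
  have gC: "?g GB \<in> carrier ?F" "inv\<^bsub>?F\<^esub> (?g GA) \<in> carrier ?F"
    using S gA by (auto intro!: free_gen_closed)
  define f where "f x = (case x of GA \<Rightarrow> inv\<^bsub>model\<^esub> (proj (0, 1, 0, 0)) | GB \<Rightarrow> proj (1, 0, 0, 0) |
    GC \<Rightarrow> proj (0, 0, 1, 0) | GD \<Rightarrow> proj (0, 0, 0, 1))" for x
  have "f x \<in> carrier model" for x by (cases x) (simp_all add: f_def)
  then have "\<exists>h. group_hom ?F model h \<and> (\<forall>x\<in>S. h (?g x) = f x)" by (rule model_hom_exists)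
  then obtain h where h: "group_hom ?F model h" "\<forall>x\<in>S. h (?g x) = f x" by (elim exE conjE)
  interpret h: group_hom ?F model h by (rule h)
  have hg: "h (?g GA) = inv\<^bsub>model\<^esub> (proj (0, 1, 0, 0))" "h (?g GB) = proj (1, 0, 0, 0)" "h (?g GC) = proj (0, 0, 1, 0)"
    "GD \<in> S \<Longrightarrow> h (?g GD) = proj (0, 0, 0, 1)"
    using h(2) S by (auto simp: f_def)
  have hA: "h (inv\<^bsub>?F\<^esub> (?g GA)) = proj (0, 1, 0, 0)" using gA by (simp add: hg(1) del: M.\<phi>.hom_inv)
  show ?thesis
  proof (rule has_Imax_presented_group[OF R[unfolded defs] gC _ _ h(1) _ hg(2) hA])
    show "\<forall>(u, v)\<in>R. h u = h v"
      by (rule model[unfolded defs, OF h(1) hg])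
  next
    fix G :: pgroup and q assume q: "group_hom ?F G q" and Rq: "\<forall>(u, v)\<in>R. q u = q v"
    interpret q: group_hom ?F G q by (rule q)
    have inv: "q (inv\<^bsub>?F\<^esub> (?g GA)) = inv\<^bsub>G\<^esub> (q (?g GA))" using gA by simp
    obtain z where z: "nil4_rel G p r s \<epsilon> \<delta> (q (?g GB)) (inv\<^bsub>G\<^esub> (q (?g GA))) (q (?g GC)) z"
        "GD \<in> S \<longrightarrow> q (?g GD) = z"
      using rel[unfolded defs, OF q Rq] by (elim exE conjE)
    show "\<exists>c z. nil4_rel G p r s \<epsilon> \<delta> (q (?g GB)) (q (inv\<^bsub>?F\<^esub> (?g GA))) c z"
      unfolding inv using z(1) by (intro exI)
    fix H x assume H: "subgroup H G" "q (?g GB) \<in> H" "q (inv\<^bsub>?F\<^esub> (?g GA)) \<in> H" and x: "x \<in> S"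
    have "\<lbrakk>q (?g GB), inv\<^bsub>G\<^esub> (q (?g GA))\<rbrakk>\<^bsub>G\<^esub> \<in> H"
      by (rule q.H.subgroup_commutator_closed[OF H[unfolded inv]])
    then have c: "q (?g GC) \<in> H" using z(1) by (simp add: nil4_rel_def)
    have "\<lbrakk>q (?g GC), q (?g GB)\<rbrakk>\<^bsub>G\<^esub> \<in> H" by (rule q.H.subgroup_commutator_closed[OF H(1) c H(2)])
    then have "z \<in> H" using z(1) by (simp add: nil4_rel_def)
    moreover have "q (?g GA) \<in> H"
      using subgroup.m_inv_closed[OF H(1) H(3)] gA by (simp add: inv)
    ultimately show "q (?g x) \<in> H" using H c x z(2) by (cases x) auto
  qed
qed

end

section \<open>The seven basic families\<close>

abbreviation "gens3 \<equiv> {GA, GB, GC}"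
abbreviation "gens4 \<equiv> {GA, GB, GC, GD}"
abbreviation "F3 \<equiv> free_group gens3"
abbreviation "F4 \<equiv> free_group gens4"
abbreviation "g3 \<equiv> free_gen gens3"
abbreviation "g4 \<equiv> free_gen gens4"

text \<open>The fourth fact for three generators is a repetition: the lemmas on relators take four elements.\<close>

lemma gens_closed:
  shows gens3_closed: "g3 GA \<in> carrier F3" "g3 GB \<in> carrier F3" "g3 GC \<in> carrier F3" "g3 GC \<in> carrier F3"
    and gens4_closed: "g4 GA \<in> carrier F4" "g4 GB \<in> carrier F4" "g4 GC \<in> carrier F4" "g4 GD \<in> carrier F4"
  by (simp_all add: free_gen_closed)

lemmas rel_closed3 = group.rel_closed[OF group_free_group gens3_closed]
lemmas rel_closed4 = group.rel_closed[OF group_free_group gens4_closed]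

lemma (in group) commutator_inv_right_eq_one_iff:
  assumes "x \<in> carrier G" "y \<in> carrier G"
  shows "\<lbrakk>x, inv y\<rbrakk> = \<one> \<longleftrightarrow> \<lbrakk>x, y\<rbrakk> = \<one>"
proof -
  have "x \<otimes> inv y = inv y \<otimes> x \<longleftrightarrow> x \<otimes> y = y \<otimes> x"
    using assms commute_inv[of y x] commute_inv[of "inv y" x] by auto
  then show ?thesis using assms by (simp add: commutator_eq_one_iff)
qed

lemma (in group) nil4_rel_swap:
  assumes "nil4_rel G p r s \<epsilon> \<delta> a b c z"
  shows "\<lbrakk>inv b, a\<rbrakk> = c"
  using assms by (intro commutator_inv_left) (auto simp: nil4_rel_def commutator_eq_one_iff)

lemma (in group) commutator_swap:
  assumes "a \<in> carrier G" "b \<in> carrier G" "\<lbrakk>a, b\<rbrakk> = c" "\<lbrakk>c, a\<rbrakk> = \<one>"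
  shows "\<lbrakk>b, inv a\<rbrakk> = c"
  using assms by (intro commutator_inv_right) (auto simp: commutator_eq_one_iff)

text \<open>Here z is the generator \<open>d\<close>, independent of the powers of a and b, hence
  \<epsilon> = \<delta> = 0.\<close>

lemma has_Imax_J6:
  assumes params: "nil4_params p n m"
  shows "has_Imax p (group_J6 p n m) (if p = 2 \<and> m = 1 then 2 else m)"
proof -
  interpret nil4_params p n m 0 0 by (rule params)
  interpret M: nil4_image p n m 0 0 model proj by (rule nil4_image_model)
  note relM = M.nil4_rel_\<phi>
  show ?thesis
    unfolding group_J6_def presented4_def Let_def
  proof (rule has_Imax_presentation[OF _ rel_closed4(7)])
    fix G :: pgroup and q
    assume q: "group_hom F4 G q" and R: "\<forall>(u, v)\<in>rel_J6 F4 p n m (g4 GA) (g4 GB) (g4 GC) (g4 GD). q u = q v"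
    interpret q: group_hom F4 G q by (rule q)
    note C = gens4_closed[THEN q.hom_closed]
    have R': "\<forall>(u, v)\<in>rel_J6 G p n m (q (g4 GA)) (q (g4 GB)) (q (g4 GC)) (q (g4 GD)). u = v"
      using R unfolding q.rel_J6_hom_iff[OF gens4_closed] .
    show "\<exists>z. nil4_rel G p n m 0 0 (q (g4 GA)) (q (g4 GB)) (q (g4 GC)) z \<and>
        (GD \<in> gens4 \<longrightarrow> q (g4 GD) = z)"
      using C R' by (intro exI[of _ "q (g4 GD)"]) (simp add: nil4_rel_def rel_J6_def)
  next
    fix h assume h: "group_hom F4 model h" "h (g4 GA) = proj (1, 0, 0, 0)" "h (g4 GB) = proj (0, 1, 0, 0)"
      "h (g4 GC) = proj (0, 0, 1, 0)" "GD \<in> gens4 \<Longrightarrow> h (g4 GD) = proj (0, 0, 0, 1)"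
    show "\<forall>(u, v)\<in>rel_J6 F4 p n m (g4 GA) (g4 GB) (g4 GC) (g4 GD). h u = h v"
      unfolding group_hom.rel_J6_hom_iff[OF h(1) gens4_closed] h(2-4)
      using relM h(5) by (simp add: rel_J6_def nil4_rel_def)
  qed simp
qed

text \<open>The generators exchange roles, so r = m belongs to b and s = n to a. This is why the
  answer is n here.\<close>

lemma has_Imax_J5:
  assumes params: "nil4_params p m n"
  shows "has_Imax p (group_J5 p n m) (if p = 2 \<and> n = 1 then 2 else n)"
proof -
  interpret nil4_params p m n 0 0 by (rule params)
  interpret M: nil4_image p m n 0 0 model proj by (rule nil4_image_model)
  note relM = M.nil4_rel_\<phi>
  show ?thesis
    unfolding group_J5_def presented4_def Let_def
  proof (rule has_Imax_presentation_swap[OF _ rel_closed4(6)])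
    fix G :: pgroup and q
    assume q: "group_hom F4 G q" and R: "\<forall>(u, v)\<in>rel_J5 F4 p n m (g4 GA) (g4 GB) (g4 GC) (g4 GD). q u = q v"
    interpret q: group_hom F4 G q by (rule q)
    note C = gens4_closed[THEN q.hom_closed]
    have R': "\<forall>(u, v)\<in>rel_J5 G p n m (q (g4 GA)) (q (g4 GB)) (q (g4 GC)) (q (g4 GD)). u = v"
      using R unfolding q.rel_J5_hom_iff[OF gens4_closed] .
    show "\<exists>z. nil4_rel G p m n 0 0 (q (g4 GB)) (inv\<^bsub>G\<^esub> (q (g4 GA))) (q (g4 GC)) z \<and>
        (GD \<in> gens4 \<longrightarrow> q (g4 GD) = z)"
      using C R' q.H.commutator_swap[OF C(1,2)]
      by (intro exI[of _ "q (g4 GD)"])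
        (simp add: nil4_rel_def rel_J5_def q.H.commutator_inv_right_eq_one_iff q.H.nat_pow_inv)
  next
    fix h assume h: "group_hom F4 model h" "h (g4 GA) = inv\<^bsub>model\<^esub> (proj (0, 1, 0, 0))" "h (g4 GB) = proj (1, 0, 0, 0)"
      "h (g4 GC) = proj (0, 0, 1, 0)" "GD \<in> gens4 \<Longrightarrow> h (g4 GD) = proj (0, 0, 0, 1)"
    show "\<forall>(u, v)\<in>rel_J5 F4 p n m (g4 GA) (g4 GB) (g4 GC) (g4 GD). h u = h v"
      unfolding group_hom.rel_J5_hom_iff[OF h(1) gens4_closed] h(2-4)
      using relM h(5) M.nil4_rel_swap[OF relM]
      by (simp add: rel_J5_def nil4_rel_def M.commutator_inv_right_eq_one_iff M.nat_pow_inv)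
  qed simp
qed

lemma has_Imax_J2:
  assumes params: "nil4_params p n m"
  shows "has_Imax p (group_J2 p n m) (if p = 2 \<and> m = 1 then 2 else m)"
proof -
  interpret nil4_params p n m 1 0 by (rule params)
  interpret M: nil4_image p n m 1 0 model proj by (rule nil4_image_model)
  note relM = M.nil4_rel_\<phi>
  show ?thesis
    unfolding group_J2_def presented3_def Let_def
  proof (rule has_Imax_presentation[OF _ rel_closed3(3)])
    fix G :: pgroup and q
    assume q: "group_hom F3 G q" and R: "\<forall>(u, v)\<in>rel_J2 F3 p n m (g3 GA) (g3 GB) (g3 GC). q u = q v"
    interpret q: group_hom F3 G q by (rule q)
    note C = gens3_closed[THEN q.hom_closed]
    have R': "\<forall>(u, v)\<in>rel_J2 G p n m (q (g3 GA)) (q (g3 GB)) (q (g3 GC)). u = v"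
      using R unfolding q.rel_J2_hom_iff[OF gens3_closed] .
    show "\<exists>z. nil4_rel G p n m 1 0 (q (g3 GA)) (q (g3 GB)) (q (g3 GC)) z \<and>
        (GD \<in> gens3 \<longrightarrow> q (g3 GD) = z)"
      using R' q.H.nil4_relI_a[OF params C(1,2) refl refl]
      by (simp add: rel_J2_def) blast
  next
    fix h assume h: "group_hom F3 model h" "h (g3 GA) = proj (1, 0, 0, 0)" "h (g3 GB) = proj (0, 1, 0, 0)"
      "h (g3 GC) = proj (0, 0, 1, 0)" "GD \<in> gens3 \<Longrightarrow> h (g3 GD) = proj (0, 0, 0, 1)"
    show "\<forall>(u, v)\<in>rel_J2 F3 p n m (g3 GA) (g3 GB) (g3 GC). h u = h v"
      unfolding group_hom.rel_J2_hom_iff[OF h(1) gens3_closed] h(2-4)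
      using relM M.nil4_relD_a[OF relM] by (simp add: rel_J2_def nil4_rel_def)
  qed simp
qed

text \<open>After the exchange b takes the place of a, so z = b^(p^m) is the case \<epsilon> =
  1.\<close>

lemma has_Imax_J3:
  assumes params: "nil4_params p m n"
  shows "has_Imax p (group_J3 p n m) (if p = 2 \<and> n = 1 then 2 else n)"
proof -
  interpret nil4_params p m n 1 0 by (rule params)
  interpret M: nil4_image p m n 1 0 model proj by (rule nil4_image_model)
  note relM = M.nil4_rel_\<phi>
  show ?thesis
    unfolding group_J3_def presented3_def Let_def
  proof (rule has_Imax_presentation_swap[OF _ rel_closed3(4)])
    fix G :: pgroup and q
    assume q: "group_hom F3 G q" and R: "\<forall>(u, v)\<in>rel_J3 F3 p n m (g3 GA) (g3 GB) (g3 GC). q u = q v"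
    interpret q: group_hom F3 G q by (rule q)
    note C = gens3_closed[THEN q.hom_closed]
    have R': "\<forall>(u, v)\<in>rel_J3 G p n m (q (g3 GA)) (q (g3 GB)) (q (g3 GC)). u = v"
      using R unfolding q.rel_J3_hom_iff[OF gens3_closed] .
    show "\<exists>z. nil4_rel G p m n 1 0 (q (g3 GB)) (inv\<^bsub>G\<^esub> (q (g3 GA))) (q (g3 GC)) z \<and>
        (GD \<in> gens3 \<longrightarrow> q (g3 GD) = z)"
      using C R' q.H.commutator_swap[OF C(1,2)]
        q.H.nil4_relI_a[OF params C(2) q.H.inv_closed[OF C(1)] refl refl]
      by (simp add: rel_J3_def q.H.commutator_inv_right_eq_one_iff q.H.nat_pow_inv) blast
  next
    fix h assume h: "group_hom F3 model h" "h (g3 GA) = inv\<^bsub>model\<^esub> (proj (0, 1, 0, 0))" "h (g3 GB) = proj (1, 0, 0, 0)"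
      "h (g3 GC) = proj (0, 0, 1, 0)" "GD \<in> gens3 \<Longrightarrow> h (g3 GD) = proj (0, 0, 0, 1)"
    show "\<forall>(u, v)\<in>rel_J3 F3 p n m (g3 GA) (g3 GB) (g3 GC). h u = h v"
      unfolding group_hom.rel_J3_hom_iff[OF h(1) gens3_closed] h(2-4)
      using relM M.nil4_relD_a[OF relM] M.nil4_rel_swap[OF relM]
      by (simp add: rel_J3_def nil4_rel_def M.commutator_inv_right_eq_one_iff M.nat_pow_inv)
  qed simp
qed

lemma has_Imax_J4:
  assumes params: "nil4_params p n m" and \<nu>: "int p dvd \<nu> * \<delta> - 1"
  shows "has_Imax p (group_J4 p n m \<nu>) (if p = 2 \<and> m = 1 then 2 else m)"
proof -
  interpret nil4_params p n m 0 \<delta> by (rule params)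
  interpret M: nil4_image p n m 0 \<delta> model proj by (rule nil4_image_model)
  note relM = M.nil4_rel_\<phi>
  show ?thesis
    unfolding group_J4_def presented3_def Let_def
  proof (rule has_Imax_presentation[OF _ rel_closed3(5)])
    fix G :: pgroup and q
    assume q: "group_hom F3 G q" and R: "\<forall>(u, v)\<in>rel_J4 F3 p n m \<nu> (g3 GA) (g3 GB) (g3 GC). q u = q v"
    interpret q: group_hom F3 G q by (rule q)
    note C = gens3_closed[THEN q.hom_closed]
    have R': "\<forall>(u, v)\<in>rel_J4 G p n m \<nu> (q (g3 GA)) (q (g3 GB)) (q (g3 GC)). u = v"
      using R unfolding q.rel_J4_hom_iff[OF gens3_closed] .
    show "\<exists>z. nil4_rel G p n m 0 \<delta> (q (g3 GA)) (q (g3 GB)) (q (g3 GC)) z \<and>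
        (GD \<in> gens3 \<longrightarrow> q (g3 GD) = z)"
      using R' q.H.nil4_relI_b[OF C(1,2) s_pos \<nu> refl refl, of n]
      by (simp add: rel_J4_def) blast
  next
    fix h assume h: "group_hom F3 model h" "h (g3 GA) = proj (1, 0, 0, 0)" "h (g3 GB) = proj (0, 1, 0, 0)"
      "h (g3 GC) = proj (0, 0, 1, 0)" "GD \<in> gens3 \<Longrightarrow> h (g3 GD) = proj (0, 0, 0, 1)"
    show "\<forall>(u, v)\<in>rel_J4 F3 p n m \<nu> (g3 GA) (g3 GB) (g3 GC). h u = h v"
      unfolding group_hom.rel_J4_hom_iff[OF h(1) gens3_closed] h(2-4)
      using relM M.nil4_relD_b[OF relM \<nu>] by (simp add: rel_J4_def nil4_rel_def)
  qed simp
qed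

text \<open>After the exchange a^(-1) takes the place of b. Written as a power of a^(-1), z has
  exponent -\<nu> * p^n, which explains the sign in the hypothesis on \<delta>.\<close>

lemma has_Imax_J1:
  assumes params: "nil4_params p m n" and \<nu>: "int p dvd - \<nu> * \<delta> - 1"
  shows "has_Imax p (group_J1 p n m \<nu>) (if p = 2 \<and> n = 1 then 2 else n)"
proof -
  interpret nil4_params p m n 0 \<delta> by (rule params)
  interpret M: nil4_image p m n 0 \<delta> model proj by (rule nil4_image_model)
  note relM = M.nil4_rel_\<phi>
  show ?thesis
    unfolding group_J1_def presented3_def Let_def
  proof (rule has_Imax_presentation_swap[OF _ rel_closed3(2)])
    fix G :: pgroup and q
    assume q: "group_hom F3 G q" and R: "\<forall>(u, v)\<in>rel_J1 F3 p n m \<nu> (g3 GA) (g3 GB) (g3 GC). q u = q v"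
    interpret q: group_hom F3 G q by (rule q)
    note C = gens3_closed[THEN q.hom_closed]
    have R': "\<forall>(u, v)\<in>rel_J1 G p n m \<nu> (q (g3 GA)) (q (g3 GB)) (q (g3 GC)). u = v"
      using R unfolding q.rel_J1_hom_iff[OF gens3_closed] .
    show "\<exists>z. nil4_rel G p m n 0 \<delta> (q (g3 GB)) (inv\<^bsub>G\<^esub> (q (g3 GA))) (q (g3 GC)) z \<and>
        (GD \<in> gens3 \<longrightarrow> q (g3 GD) = z)"
      using C R' q.H.commutator_swap[OF C(1,2)]
        q.H.nil4_relI_b[OF C(2) q.H.inv_closed[OF C(1)] s_pos \<nu> refl refl, of m]
      by (simp add: rel_J1_def q.H.commutator_inv_right_eq_one_iff q.H.nat_pow_inv q.H.int_pow_inv q.H.int_pow_neg)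
        blast
  next
    fix h assume h: "group_hom F3 model h" "h (g3 GA) = inv\<^bsub>model\<^esub> (proj (0, 1, 0, 0))" "h (g3 GB) = proj (1, 0, 0, 0)"
      "h (g3 GC) = proj (0, 0, 1, 0)" "GD \<in> gens3 \<Longrightarrow> h (g3 GD) = proj (0, 0, 0, 1)"
    show "\<forall>(u, v)\<in>rel_J1 F3 p n m \<nu> (g3 GA) (g3 GB) (g3 GC). h u = h v"
      unfolding group_hom.rel_J1_hom_iff[OF h(1) gens3_closed] h(2-4)
      using relM M.nil4_relD_b[OF relM \<nu>] M.nil4_rel_swap[OF relM]
      by (simp add: rel_J1_def nil4_rel_def M.commutator_inv_right_eq_one_iff M.nat_pow_inv M.int_pow_inv M.int_pow_neg)
  qed simp
qed

text \<open>The one group in which z is a power of both generators: a^4 = z = b^2, so \<epsilon> =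
  \<delta> = 1. For the same reason z commutes with both.\<close>

lemma has_Imax_H3:
  assumes params: "nil4_params 2 2 1"
  shows "has_Imax 2 (group_H3) (if (2::nat) = 2 \<and> (1::nat) = 1 then 2 else 1)"
proof -
  interpret nil4_params 2 2 1 1 1 by (rule params)
  interpret M: nil4_image 2 2 1 1 1 model proj by (rule nil4_image_model)
  note relM = M.nil4_rel_\<phi>
  show ?thesis
    unfolding group_H3_def presented3_def Let_def
  proof (rule has_Imax_presentation[OF _ rel_closed3(1)])
    fix G :: pgroup and q
    assume q: "group_hom F3 G q" and R: "\<forall>(u, v)\<in>rel_H3 F3 (g3 GA) (g3 GB) (g3 GC). q u = q v"
    interpret q: group_hom F3 G q by (rule q)
    note C = gens3_closed[THEN q.hom_closed]
    have R': "\<forall>(u, v)\<in>rel_H3 G (q (g3 GA)) (q (g3 GB)) (q (g3 GC)). u = v"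
      using R unfolding q.rel_H3_hom_iff[OF gens3_closed] .
    show "\<exists>z. nil4_rel G 2 2 1 1 1 (q (g3 GA)) (q (g3 GB)) (q (g3 GC)) z \<and>
        (GD \<in> gens3 \<longrightarrow> q (g3 GD) = z)"
    proof (intro exI conjI)
      let ?a = "q (g3 GA)" and ?b = "q (g3 GB)" and ?c = "q (g3 GC)"
      let ?z = "?a [^]\<^bsub>G\<^esub> (4::nat)"
      have z: "?z = ?b [^]\<^bsub>G\<^esub> (2::nat)" using R' by (simp add: rel_H3_def)
      have "?z \<otimes>\<^bsub>G\<^esub> ?a = ?a \<otimes>\<^bsub>G\<^esub> ?z" using C by (intro q.H.group_commutes_pow) auto
      moreover have "?z \<otimes>\<^bsub>G\<^esub> ?b = ?b \<otimes>\<^bsub>G\<^esub> ?z"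
        unfolding z using C by (intro q.H.group_commutes_pow) auto
      moreover have "?z [^]\<^bsub>G\<^esub> (2::nat) = \<one>\<^bsub>G\<^esub>"
        using R' C by (simp add: rel_H3_def q.H.nat_pow_pow)
      ultimately show "nil4_rel G 2 2 1 1 1 ?a ?b ?c ?z"
        using C R' by (simp add: rel_H3_def nil4_rel_def q.H.commutator_eq_one_iff)
    qed simp
  next
    fix h assume h: "group_hom F3 model h" "h (g3 GA) = proj (1, 0, 0, 0)" "h (g3 GB) = proj (0, 1, 0, 0)"
      "h (g3 GC) = proj (0, 0, 1, 0)" "GD \<in> gens3 \<Longrightarrow> h (g3 GD) = proj (0, 0, 0, 1)"
    show "\<forall>(u, v)\<in>rel_H3 F3 (g3 GA) (g3 GB) (g3 GC). h u = h v"
      unfolding group_hom.rel_H3_hom_iff[OF h(1) gens3_closed] h(2-4)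
    proof -
      let ?A = "proj (1, 0, 0, 0)" and ?Z = "proj (0, 0, 0, 1)"
      have "(?A [^]\<^bsub>model\<^esub> (4::nat)) [^]\<^bsub>model\<^esub> (2::nat) = ?A [^]\<^bsub>model\<^esub> (4 * 2 :: nat)"
        by (rule M.nat_pow_pow[OF M.\<phi>_closed])
      then have "?A [^]\<^bsub>model\<^esub> (8::nat) = \<one>\<^bsub>model\<^esub>"
        using relM by (simp add: nil4_rel_def del: One_nat_def)
      then show "\<forall>(u, v)\<in>rel_H3 model ?A (proj (0, 1, 0, 0)) (proj (0, 0, 1, 0)). u = v"
        using relM by (simp add: rel_H3_def nil4_rel_def del: One_nat_def)
    qed
  qed simp
qed

subsection \<open>Coincidences between the families\<close>

lemma group_H1_eq: "group_H1 = group_I1 2"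
  unfolding group_H1_def group_I1_def
  by (intro arg_cong[where f = presented4] ext) (simp add: rel_H1_def rel_I1_def)

lemma group_H2_eq: "group_H2 = group_I2 2"
  unfolding group_H2_def group_I2_def
  by (intro arg_cong[where f = presented3] ext) (simp add: rel_H2_def rel_I2_def)

lemma group_I1_eq: "group_I1 n = group_J6 2 n 1"
  unfolding group_I1_def group_J6_def
  by (intro arg_cong[where f = presented4] ext) (simp add: rel_I1_def rel_J6_def)

lemma group_I2_eq: "group_I2 n = group_J2 2 n 1"
  unfolding group_I2_def group_J2_def
  by (intro arg_cong[where f = presented3] ext) (simp add: rel_I2_def rel_J2_def)

lemma group_I3_eq: "group_I3 n = group_J4 2 n 1 1"
proof -
  \<comment> \<open>The exponent of b in \<open>rel_J4\<close> is an integer because of the factor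
    \<nu>, whereas the one in \<open>rel_I3\<close> is a natural number.\<close>
  have "x [^]\<^bsub>F\<^esub> (2::int) = x [^]\<^bsub>F\<^esub> (2::nat)" for F :: "generator word set monoid" and x
    using int_pow_int[of F x 2] by (metis of_nat_numeral)
  then show ?thesis
    unfolding group_I3_def group_J4_def
    by (intro arg_cong[where f = presented3] ext) (simp add: rel_I3_def rel_J4_def)
qed

lemma group_G1_eq: "group_G1 p m \<nu> = group_J1 p m m \<nu>"
  unfolding group_G1_def group_J1_def
  by (intro arg_cong[where f = presented3] ext) (simp add: rel_G1_def rel_J1_def)

lemma group_G2_eq: "group_G2 p m = group_J6 p m m"
  unfolding group_G2_def group_J6_def
  by (intro arg_cong[where f = presented4] ext) (simp add: rel_G2_def rel_J6_def)

lemma group_G3_eq: "group_G3 p m = group_J2 p m m"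
  unfolding group_G3_def group_J2_def
  by (intro arg_cong[where f = presented3] ext) (simp add: rel_G3_def rel_J2_def)

text \<open>Of admissibility only invertibility modulo p is used. A multiple of p is the square of 0
  modulo p, so it is no non-residue.\<close>

lemma admissible_nu_inverse:
  assumes "prime p" "admissible_nu p \<nu>"
  shows "\<exists>\<delta>. int p dvd \<nu> * \<delta> - 1"
proof -
  have "\<not> int p dvd \<nu>"
  proof
    assume dvd: "int p dvd \<nu>"
    have "\<nu> \<noteq> 1" using dvd assms(1) by (auto simp: zdvd1_eq)
    moreover have "[0\<^sup>2 = \<nu>] (mod int p)" using dvd by (simp add: cong_def)
    then have "QuadRes (int p) \<nu>" unfolding QuadRes_def by blast
    ultimately show False using assms(2) by (simp add: admissible_nu_def)
  qed
  then have "coprime (int p) \<nu>" using assms(1) by (intro prime_imp_coprime) auto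
  then obtain \<delta> where "[\<nu> * \<delta> = 1] (mod int p)"
    using cong_solve_coprime_int[of \<nu> "int p"] by (auto simp: coprime_commute)
  then show ?thesis by (auto simp: cong_iff_dvd_diff)
qed

lemma nil4_paramsI:
  "prime p \<Longrightarrow> r \<ge> 1 \<Longrightarrow> s \<ge> 1 \<Longrightarrow> (p = 2 \<Longrightarrow> r \<ge> 2) \<Longrightarrow> nil4_params p r s"
  by (simp add: nil4_params_def)

theorem theorem4p7:
  fixes p :: nat
  assumes "Factorial_Ring.prime p"
  shows
    "(\<forall>G :: ('a, 'b) monoid_scheme.
        group G \<and> order G = 3 ^ 4 \<and> has_nilpotency_class G 3 \<longrightarrow> has_Imax 3 G 1)
     \<and>
     (has_Imax 2 group_H1 2 \<and> has_Imax 2 group_H2 2 \<and> has_Imax 2 group_H3 2 \<and>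
      (\<forall>n\<ge>3. has_Imax 2 (group_I1 n) 2 \<and> has_Imax 2 (group_I2 n) 2 \<and> has_Imax 2 (group_I3 n) 2))
     \<and>
     ((\<forall>m \<nu>. m \<ge> 1 \<and> (p \<le> 3 \<longrightarrow> m > 1) \<and> admissible_nu p \<nu> \<longrightarrow>
         has_Imax p (group_G1 p m \<nu>) m) \<and>
      (\<forall>m. m \<ge> 1 \<and> (p \<le> 3 \<longrightarrow> m > 1) \<longrightarrow>
         has_Imax p (group_G2 p m) m \<and> has_Imax p (group_G3 p m) m) \<and>
      (\<forall>n m. m \<ge> 1 \<and> n > m \<and> (p = 2 \<longrightarrow> m > 1) \<longrightarrow>
         has_Imax p (group_J2 p n m) m \<and>
         (\<forall>\<nu>. admissible_nu p \<nu> \<longrightarrow> has_Imax p (group_J4 p n m \<nu>) m) \<and>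
         has_Imax p (group_J6 p n m) m))
     \<and>
     (\<forall>n m. m \<ge> 1 \<and> n > m \<and> (p = 2 \<longrightarrow> m > 1) \<longrightarrow>
         (\<forall>\<nu>. admissible_nu p \<nu> \<longrightarrow> has_Imax p (group_J1 p n m \<nu>) n) \<and>
         has_Imax p (group_J3 p n m) n \<and>
         has_Imax p (group_J5 p n m) n)"
proof (intro conjI allI impI)
  have two: "has_Imax 2 (group_J6 2 n 1) 2" "has_Imax 2 (group_J2 2 n 1) 2" "has_Imax 2 (group_J4 2 n 1 1) 2"
    if "n \<ge> 2" for n
  proof -
    have params: "nil4_params 2 n 1" using that by (intro nil4_paramsI) auto
    show "has_Imax 2 (group_J6 2 n 1) 2" "has_Imax 2 (group_J2 2 n 1) 2" "has_Imax 2 (group_J4 2 n 1 1) 2"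
      using has_Imax_J6[OF params] has_Imax_J2[OF params] has_Imax_J4[OF params, of 1 1] by simp_all
  qed
  show "has_Imax 3 G 1" if "group G \<and> order G = 3 ^ 4 \<and> has_nilpotency_class G 3" for G :: "('a, 'b) monoid_scheme"
    using that by (intro has_Imax_maximal_class) auto
  show "has_Imax 2 group_H1 2" "has_Imax 2 group_H2 2"
    unfolding group_H1_eq group_H2_eq group_I1_eq group_I2_eq by (rule two; simp)+
  show "has_Imax 2 group_H3 2"
    using has_Imax_H3[OF nil4_paramsI] by simp
  show "has_Imax 2 (group_I1 n) 2" "has_Imax 2 (group_I2 n) 2" "has_Imax 2 (group_I3 n) 2" if "3 \<le> n" for n
    unfolding group_I1_eq group_I2_eq group_I3_eq using that two[of n] by auto
  \<comment> \<open>Allowing n = m covers two of the families (G) as well, and \<open>J_b\<close>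
    below covers the third. For p = 2 the bound m > 1 both yields r \<ge> 2 and rules out the
    exceptional value.\<close>
  have J_a: "has_Imax p (group_J6 p n m) m" "has_Imax p (group_J2 p n m) m"
      "admissible_nu p \<nu> \<Longrightarrow> has_Imax p (group_J4 p n m \<nu>) m"
    if nm: "m \<ge> 1" "n \<ge> m" "p = 2 \<Longrightarrow> m > 1" for n m \<nu>
  proof -
    have params: "nil4_params p n m" using nm assms by (intro nil4_paramsI) auto
    have ne: "(if p = 2 \<and> m = 1 then 2 else m) = m" using nm by auto
    show "has_Imax p (group_J6 p n m) m" "has_Imax p (group_J2 p n m) m"
      using has_Imax_J6[OF params] has_Imax_J2[OF params] unfolding ne by auto
    assume "admissible_nu p \<nu>"
    then obtain \<delta> where "int p dvd \<nu> * \<delta> - 1" using admissible_nu_inverse assms by blast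
    then show "has_Imax p (group_J4 p n m \<nu>) m" using has_Imax_J4[OF params] unfolding ne by auto
  qed
  have J_b: "has_Imax p (group_J5 p n m) n" "has_Imax p (group_J3 p n m) n"
      "admissible_nu p \<nu> \<Longrightarrow> has_Imax p (group_J1 p n m \<nu>) n"
    if nm: "m \<ge> 1" "n \<ge> m" "p = 2 \<Longrightarrow> m > 1" for n m \<nu>
  proof -
    have params: "nil4_params p m n" using nm assms by (intro nil4_paramsI) auto
    have ne: "(if p = 2 \<and> n = 1 then 2 else n) = n" using nm by auto
    show "has_Imax p (group_J5 p n m) n" "has_Imax p (group_J3 p n m) n"
      using has_Imax_J5[OF params] has_Imax_J3[OF params] unfolding ne by auto
    assume "admissible_nu p \<nu>"
    then obtain \<delta> where "int p dvd \<nu> * \<delta> - 1" using admissible_nu_inverse assms by blast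
    \<comment> \<open>Negating the inverse compensates the sign that comes from using
      a^(-1).\<close>
    then have "int p dvd - \<nu> * (- \<delta>) - 1" by simp
    then show "has_Imax p (group_J1 p n m \<nu>) n" using has_Imax_J1[OF params, of \<nu> "- \<delta>"] unfolding ne by auto
  qed
  show "has_Imax p (group_G1 p m \<nu>) m" if "m \<ge> 1 \<and> (p \<le> 3 \<longrightarrow> m > 1) \<and> admissible_nu p \<nu>" for m \<nu>
    unfolding group_G1_eq using that by (intro J_b(3)) auto
  show "has_Imax p (group_G2 p m) m" "has_Imax p (group_G3 p m) m" if "m \<ge> 1 \<and> (p \<le> 3 \<longrightarrow> m > 1)" for m
    unfolding group_G2_eq group_G3_eq using that by (intro J_a(1,2); auto)+
  fix n m :: nat assume nm: "m \<ge> 1 \<and> n > m \<and> (p = 2 \<longrightarrow> m > 1)"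
  show "has_Imax p (group_J2 p n m) m" "has_Imax p (group_J6 p n m) m"
    "has_Imax p (group_J3 p n m) n" "has_Imax p (group_J5 p n m) n"
    using nm by (intro J_a(1,2) J_b(1,2); auto)+
  show "has_Imax p (group_J4 p n m \<nu>) m" "has_Imax p (group_J1 p n m \<nu>) n" if "admissible_nu p \<nu>" for \<nu>
    using nm that by (intro J_a(3) J_b(3); auto)+
qed

end
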